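(* Define $f_0=F$, $f_{n+1}=\mathcal Jf_n$ for $n\ge0$, and let $f_\infty:=\lim_{n\to\infty}f_n$ be the pointwise limit of this decreasing sequence. Then the value function $V$ of the quickest detection problem with costly observations satisfies $V=f_\infty$ on $[0,1]$; i.e. $V$ is the unique fixed point of $\mathcal J$ in $\mathbb F$.
   Context: Constants: $\lambda>0$, $c>0$, $d>0$, $\alpha\in\mathbb R$. For $\pi\in[0,1]$, $(\Omega,\mathcal F,\mathbb P_\pi)$ carries a standard Brownian motion $W$ and an independent random variable $\Theta\ge0$ with $\mathbb P_\pi(\Theta=0)=\pi$ and $\mathbb P_\pi(\Theta>t)=(1-\pi)e^{-\lambda t}$, $t\ge0$; $\mathbb E_\pi$ is the expectation under $\mathbb P_\pi$. The observed process is $X_t=\alpha(t-\Theta)^++W_t$. Observation sequences: $\mathcal T$ is the set of strictly increasing sequences $\hat\tau=\{\tau_1,\tau_2,\dots\}$ of random variables with $\tau_1$ positive and deterministic and $\tau_j$ measurable with respect to $\sigma(X_{\tau_1},\dots,X_{\tau_{j-1}},\tau_1,\dots,\tau_{j-1})$ for $j\ge2$. The value $+\infty$ is allowed (meaning no further observation; once $\tau_j=\infty$ all later terms are $\infty$, and strict increase is required only as long as the terms are finite; by convention $X_\infty:=0$). Filtration: $\mathcal F^{\hat\tau}_t=\sigma(X_{\tau_1},\dots,X_{\tau_j},\tau_1,\dots,\tau_j;\ j=\sup\{k:\tau_k\le t\})$, i.e. the information generated by the observation times up to $t$ and the values of $X$ observed at them; $\mathbb F^{\hat\tau}=(\mathcal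 F^{\hat\tau}_t)_{t\ge0}$. $\mathcal S^{\hat\tau}$ is the set of $\mathbb F^{\hat\tau}$-stopping times; one may restrict to those with $\mathbb E_\pi[\tau]<\infty$. Value function: $$V(\pi)=\inf_{\hat\tau\in\mathcal T}\inf_{\tau\in\mathcal S^{\hat\tau}}\Big\{\mathbb P_\pi(\tau<\Theta)+\mathbb E_\pi\Big[c(\tau-\Theta)^++d\sum_{k=1}^\infty\mathbf 1_{\{\tau_k\le\tau\}}\Big]\Big\}.$$ For $t>0$, $\pi\in[0,1)$, $x\in\mathbb R$, $$j(t,\pi,x)=\exp\Big\{\alpha x+\Big(\lambda-\frac{\alpha^2}2\Big)t\Big\}\frac\pi{1-\pi}+\lambda\int_0^t\exp\Big\{\Big(\lambda+\frac{\alpha x}t\Big)u-\frac{\alpha^2u^2}{2t}\Big\}\,du,$$ and for $\pi=1$ the quotient $j/(1+j)$ is interpreted as $1$. $$F(\pi)=\inf_{t\ge0}\Big\{(1-\pi)e^{-\lambda t}+ct-c(1-\pi)\frac{1-e^{-\lambda t}}\lambda\Big\},$$ which equals $\frac c\lambda\big(\pi+\log\frac{(\lambda+c)(1-\pi)}c\big)$ if $\pi<\frac\lambda{c+\lambda}$ and $1-\pi$ if $\pi\ge\frac\lambda{c+\lambda}$. $\mathbb F:=\{f:[0,1]\to[0,1]\text{ measurable with }f(\pi)\le1-\pi\text{ for all }\pi\}$. For $f\in\mathbb F$ and $t>0$, $$\mathcal J_0f(\pi,t)=d+\mathbb E_\pi\Big[f\Big(\frac{j(t,\pi,X_t)}{1+j(t,\pi,X_t)}\Big)\Big]+ct-c(1-\pi)\frac{1-e^{-\lambda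 t}}\lambda,$$ and $$\mathcal Jf(\pi)=\min\Big\{F(\pi),\ \inf_{t>0}\mathcal J_0f(\pi,t)\Big\}.$$ *)

theory Defs
  imports "HOL-Probability.Probability"
begin

section \<open>The probabilistic setting\<close>

text \<open>Only the values at times \<open>t \<ge> 0\<close> matter. All sample paths are continuous, as
  usual for a Brownian motion; in particular, the process may be evaluated at random times.\<close>

definition standard_brownian_motion :: "'a measure \<Rightarrow> (real \<Rightarrow> 'a \<Rightarrow> real) \<Rightarrow> bool" where
  "standard_brownian_motion M W \<longleftrightarrow>
     prob_space M \<and>
     (\<forall>t\<ge>0. W t \<in> borel_measurable M) \<and>
     (\<forall>\<omega>\<in>space M. continuous_on {0..} (\<lambda>t. W t \<omega>)) \<and>
     (AE \<omega> in M. W 0 \<omega> = 0) \<and>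
     (\<forall>s t. 0 \<le> s \<longrightarrow> s < t \<longrightarrow>
        distributed M lborel (\<lambda>\<omega>. W t \<omega> - W s \<omega>) (normal_density 0 (sqrt (t - s)))) \<and>
     (\<forall>(n::nat) s. 0 \<le> s 0 \<longrightarrow> (\<forall>i<n. s i < s (Suc i)) \<longrightarrow>
        prob_space.indep_vars M (\<lambda>_. borel) (\<lambda>i \<omega>. W (s (Suc i)) \<omega> - W (s i) \<omega>) {..<n})"

text \<open>\<open>M\<close> only provides the measurable space \<open>(\<Omega>, \<F>)\<close> that all the measures \<open>P \<pi>\<close> live on;
  its own measure is irrelevant.\<close>

definition detection_setting ::
    "real \<Rightarrow> 'a measure \<Rightarrow> (real \<Rightarrow> 'a measure) \<Rightarrow> (real \<Rightarrow> 'a \<Rightarrow> real) \<Rightarrow> ('a \<Rightarrow> real) \<Rightarrow> bool" where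
  "detection_setting lam M P W \<Theta> \<longleftrightarrow>
     \<Theta> \<in> borel_measurable M \<and>
     (\<forall>\<omega>\<in>space M. 0 \<le> \<Theta> \<omega>) \<and>
     (\<forall>\<pi>\<in>{0..1}.
        sets (P \<pi>) = sets M \<and>
        standard_brownian_motion (P \<pi>) W \<and>
        prob_space.indep_set (P \<pi>)
          (sets (vimage_algebra (space M) \<Theta> borel))
          (sets (vimage_algebra (space M) (\<lambda>\<omega>. \<lambda>t\<in>{0..}. W t \<omega>) (\<Pi>\<^sub>M t\<in>{0..}. borel))) \<and>
        measure (P \<pi>) {\<omega>\<in>space M. \<Theta> \<omega> = 0} = \<pi> \<and>
        (\<forall>t\<ge>0. measure (P \<pi>) {\<omega>\<in>space M. t < \<Theta> \<omega>} = (1 - \<pi>) * exp (- lam * t)))"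

definition obs_process :: "real \<Rightarrow> (real \<Rightarrow> 'a \<Rightarrow> real) \<Rightarrow> ('a \<Rightarrow> real) \<Rightarrow> real \<Rightarrow> 'a \<Rightarrow> real" where
  "obs_process \<alpha> W \<Theta> t \<omega> = \<alpha> * max 0 (t - \<Theta> \<omega>) + W t \<omega>"


section \<open>Observation sequences, filtrations and stopping times\<close>

text \<open>Times are of type \<^typ>\<open>ennreal\<close>. Observation times are numbered from \<open>0\<close>: the usual
  \<open>\<tau>\<^sub>1, \<tau>\<^sub>2, \<dots>\<close> are \<open>\<tau> 0, \<tau> 1, \<dots>\<close>. A pair \<open>(\<tau>\<^sub>k, X\<^sub>\<tau>\<^sub>k)\<close> is one observation, with
  \<open>X\<^sub>\<infinity> = 0\<close>.\<close>

definition observation ::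
    "(real \<Rightarrow> 'a \<Rightarrow> real) \<Rightarrow> (nat \<Rightarrow> 'a \<Rightarrow> ennreal) \<Rightarrow> nat \<Rightarrow> 'a \<Rightarrow> ennreal \<times> real" where
  "observation X \<tau> k \<omega> = (\<tau> k \<omega>, if \<tau> k \<omega> = \<top> then 0 else X (enn2real (\<tau> k \<omega>)) \<omega>)"

definition observation_sequences ::
    "'a set \<Rightarrow> (real \<Rightarrow> 'a \<Rightarrow> real) \<Rightarrow> (nat \<Rightarrow> 'a \<Rightarrow> ennreal) set" where
  "observation_sequences \<Omega> X = {\<tau>.
     (\<exists>t>0. \<forall>\<omega>\<in>\<Omega>. \<tau> 0 \<omega> = t) \<and>
     (\<forall>k\<ge>1. \<tau> k \<in> borel_measurable
        (vimage_algebra \<Omega> (\<lambda>\<omega>. \<lambda>i\<in>{..<k}. observation X \<tau> i \<omega>)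
           (\<Pi>\<^sub>M i\<in>{..<k}. borel \<Otimes>\<^sub>M borel))) \<and>
     (\<forall>k. \<forall>\<omega>\<in>\<Omega>. if \<tau> k \<omega> = \<top> then \<tau> (Suc k) \<omega> = \<top> else \<tau> k \<omega> < \<tau> (Suc k) \<omega>)}"

text \<open>The number of observations made up to time \<open>t\<close> is random, so \<open>\<F>\<^sub>t\<close> is generated by the
  whole record up to \<open>t\<close>, in which observations not yet made at time \<open>t\<close> are replaced by the
  void observation \<open>(\<infinity>, 0)\<close>.\<close>

definition obs_filtration ::
    "'a set \<Rightarrow> (real \<Rightarrow> 'a \<Rightarrow> real) \<Rightarrow> (nat \<Rightarrow> 'a \<Rightarrow> ennreal) \<Rightarrow> ennreal \<Rightarrow> 'a measure" where
  "obs_filtration \<Omega> X \<tau> t =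
     vimage_algebra \<Omega> (\<lambda>\<omega> k. if \<tau> k \<omega> \<le> t then observation X \<tau> k \<omega> else (\<top>, 0))
       (\<Pi>\<^sub>M k\<in>UNIV. borel \<Otimes>\<^sub>M borel)"

text \<open>Since \<open>T\<close> is \<^typ>\<open>ennreal\<close>-valued, the condition in \<^const>\<open>stopping_time\<close> at the index
  \<open>\<infinity>\<close> is void. Subtraction on \<^typ>\<open>ennreal\<close> is truncated, so that
  \<open>T \<omega> - ennreal (\<Theta> \<omega>)\<close> is \<open>(T - \<Theta>)\<^sup>+\<close>.\<close>

definition cost ::
    "real \<Rightarrow> real \<Rightarrow> 'a measure \<Rightarrow> ('a \<Rightarrow> real) \<Rightarrow> (nat \<Rightarrow> 'a \<Rightarrow> ennreal) \<Rightarrow> ('a \<Rightarrow> ennreal) \<Rightarrow> ennreal"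
where
  "cost c d Q \<Theta> \<tau> T =
     emeasure Q {\<omega>\<in>space Q. T \<omega> < ennreal (\<Theta> \<omega>)} +
     (\<integral>\<^sup>+\<omega>. ennreal c * (T \<omega> - ennreal (\<Theta> \<omega>)) +
            ennreal d * (\<Sum>k. if \<tau> k \<omega> \<le> T \<omega> then 1 else 0) \<partial>Q)"

definition value_function ::
    "real \<Rightarrow> real \<Rightarrow> (real \<Rightarrow> 'a measure) \<Rightarrow> (real \<Rightarrow> 'a \<Rightarrow> real) \<Rightarrow> ('a \<Rightarrow> real) \<Rightarrow> real \<Rightarrow> ennreal"
where
  "value_function c d P X \<Theta> \<pi> =
     (INF \<tau>\<in>observation_sequences (space (P \<pi>)) X.
        INF T\<in>{T. stopping_time (obs_filtration (space (P \<pi>)) X \<tau>) T}.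
          cost c d (P \<pi>) \<Theta> \<tau> T)"


section \<open>The operator and its iterates\<close>

definition j_fun :: "real \<Rightarrow> real \<Rightarrow> real \<Rightarrow> real \<Rightarrow> real \<Rightarrow> real" where
  "j_fun lam \<alpha> t \<pi> x =
     exp (\<alpha> * x + (lam - \<alpha>\<^sup>2 / 2) * t) * (\<pi> / (1 - \<pi>)) +
     lam * integral {0..t} (\<lambda>u. exp ((lam + \<alpha> * x / t) * u - \<alpha>\<^sup>2 * u\<^sup>2 / (2 * t)))"

definition posterior :: "real \<Rightarrow> real \<Rightarrow> real \<Rightarrow> real \<Rightarrow> real \<Rightarrow> real" where
  "posterior lam \<alpha> t \<pi> x =
     (if \<pi> = 1 then 1 else j_fun lam \<alpha> t \<pi> x / (1 + j_fun lam \<alpha> t \<pi> x))"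

definition F_fun :: "real \<Rightarrow> real \<Rightarrow> real \<Rightarrow> real" where
  "F_fun lam c \<pi> =
     (INF t\<in>{0..}. (1 - \<pi>) * exp (- lam * t) + c * t - c * (1 - \<pi>) * ((1 - exp (- lam * t)) / lam))"

text \<open>Functions on \<open>[0,1]\<close> are represented by functions on the reals whose values outside
  \<open>[0,1]\<close> are irrelevant.\<close>

definition FF :: "(real \<Rightarrow> real) set" where
  "FF = {f. f \<in> borel_measurable (restrict_space borel {0..1}) \<and>
            (\<forall>\<pi>\<in>{0..1}. f \<pi> \<in> {0..1} \<and> f \<pi> \<le> 1 - \<pi>)}"

definition J0_op ::
    "real \<Rightarrow> real \<Rightarrow> real \<Rightarrow> real \<Rightarrow> (real \<Rightarrow> 'a measure) \<Rightarrow> (real \<Rightarrow> 'a \<Rightarrow> real) \<Rightarrow>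
     (real \<Rightarrow> real) \<Rightarrow> real \<Rightarrow> real \<Rightarrow> real" where
  "J0_op lam c d \<alpha> P X f \<pi> t =
     d + (LINT \<omega>|P \<pi>. f (posterior lam \<alpha> t \<pi> (X t \<omega>))) +
     c * t - c * (1 - \<pi>) * ((1 - exp (- lam * t)) / lam)"

definition J_op ::
    "real \<Rightarrow> real \<Rightarrow> real \<Rightarrow> real \<Rightarrow> (real \<Rightarrow> 'a measure) \<Rightarrow> (real \<Rightarrow> 'a \<Rightarrow> real) \<Rightarrow>
     (real \<Rightarrow> real) \<Rightarrow> real \<Rightarrow> real" where
  "J_op lam c d \<alpha> P X f \<pi> =
     min (F_fun lam c \<pi>) (INF t\<in>{0<..}. J0_op lam c d \<alpha> P X f \<pi> t)"

primrec J_iter ::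
    "real \<Rightarrow> real \<Rightarrow> real \<Rightarrow> real \<Rightarrow> (real \<Rightarrow> 'a measure) \<Rightarrow> (real \<Rightarrow> 'a \<Rightarrow> real) \<Rightarrow>
     nat \<Rightarrow> real \<Rightarrow> real" where
  "J_iter lam c d \<alpha> P X 0 = F_fun lam c"
| "J_iter lam c d \<alpha> P X (Suc n) = J_op lam c d \<alpha> P X (J_iter lam c d \<alpha> P X n)"

definition is_unique_fixed_point_in_FF ::
    "((real \<Rightarrow> real) \<Rightarrow> real \<Rightarrow> real) \<Rightarrow> (real \<Rightarrow> real) \<Rightarrow> bool" where
  "is_unique_fixed_point_in_FF J v \<longleftrightarrow>
     v \<in> FF \<and> (\<forall>\<pi>\<in>{0..1}. J v \<pi> = v \<pi>) \<and>
     (\<forall>g\<in>FF. (\<forall>\<pi>\<in>{0..1}. J g \<pi> = g \<pi>) \<longrightarrow> (\<forall>\<pi>\<in>{0..1}. g \<pi> = v \<pi>))"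

end

theory Submission
  imports Defs
begin

text \<open>
Write \<open>p\<close> for the current probability that the change has already happened. Everything rests on
one Markov property. If the remaining time to the change has law
\<open>p \<delta>\<^sub>0 + (1 - p) Exp(\<lambda>)\<close>, and the process is observed after a further waiting time \<open>t\<close>, then
given the observed increment \<open>y\<close> the new remaining time has again a law of this form, with weight
\<open>posterior lam \<alpha> t p y\<close>. This is Bayes' formula together with the lack of memory of the
exponential law (\<open>bayes_formula\<close>); the increment \<open>y\<close> itself has the density \<open>obs_density\<close>.

To apply it along an observation sequence, the Brownian increment between two consecutive
observations must be Gaussian and independent of the change time and of all that was observed
before, although the observation times are random. This form of the strong Markov property is proved
by rounding the observation times up to dyadic times (\<open>strong_markov_prob\<close>, \<open>noise_independent\<close>).
By induction on the number of observations, the conditional law of the remaining time given the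
observations is always such a mixture, with a recursively computed weight, the belief
(\<open>filter_correct\<close>). The detection problem is thereby a Markov decision problem with the belief as state:
stopping after a further time \<open>s\<close> without looking costs \<open>stop_cost p s\<close>, whose infimum over \<open>s\<close> is
\<open>F\<close>, and looking again after time \<open>t\<close> costs \<open>J0 f p t\<close> when \<open>f\<close> is the cost to go.

The lower bound \<open>f\<^sub>\<infinity> \<le> V\<close> is the verification argument. As \<open>f\<^sub>\<infinity> = J f\<^sub>\<infinity>\<close>, the cost accumulated
up to the \<open>k\<close>-th observation plus \<open>f\<^sub>\<infinity>\<close> of the belief increases with \<open>k\<close> in expectation, whatever
strategy is used. A strategy of finite cost makes a \<open>k\<close>-th observation with probability at most
\<open>const / (d k)\<close>, so that the error at stage \<open>k\<close> vanishes (\<open>cost_lower_bound\<close>). For the upper bound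
\<open>V \<le> f\<^sub>n\<close>, a strategy that makes at most \<open>n\<close> observations and chooses an almost optimal waiting time each
time has cost at most \<open>f\<^sub>n + (n + 1) \<epsilon>\<close> (\<open>strategy_value\<close>). The waiting times must depend measurably on
the belief, and the iterates must be measurable although they are infima over uncountable families.
Both follow from concavity: \<open>J\<close> preserves concavity, because the expected value of a concave function
of the posterior is the integral of its perspective, and a family of concave functions on \<open>[0,1]\<close> admits
an almost optimal measurable choice with countably many values (\<open>concave_selection\<close>).

Uniqueness of the fixed point is a comparison of iterates with multiples of a fixed point. If \<open>g = J g\<close> and \<open>f\<^sub>n \<le> (1 + \<kappa>) g\<close>, then,
as every observation costs at least \<open>d \<ge> d g\<close>, also \<open>f\<^sub>n\<^sub>+\<^sub>1 \<le> (1 + (1 - b) \<kappa>) g\<close> with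
\<open>b = min d (1/2)\<close> (\<open>iter_le_multiple\<close>). Hence \<open>f\<^sub>\<infinity> \<le> g\<close>, and \<open>g \<le> f\<^sub>n\<close> is immediate by
monotonicity.
\<close>


section \<open>The posterior after one observation\<close>

text \<open>The integral in the definition of \<open>j_fun\<close>. Its integrand is, up to the factor \<open>lam * exp (- lam * t)\<close>,
  the likelihood ratio of the increment \<open>y\<close> under drift during a time \<open>u\<close> against no drift, weighted with
  the density of the change time \<open>t - u\<close>.\<close>

definition lik_integral :: "real \<Rightarrow> real \<Rightarrow> real \<Rightarrow> real \<Rightarrow> real" where
  "lik_integral lam \<alpha> t y =
     integral {0..t} (\<lambda>u. exp ((lam + \<alpha> * y / t) * u - \<alpha>\<^sup>2 * u\<^sup>2 / (2 * t)))"

text \<open>The part of the density of the increment \<open>y\<close> over a time \<open>t\<close> that comes from a change before the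
  end of that time; the first summand belongs to a change that has already happened at the start. Both this function and
  \<open>obs_density\<close> are affine in \<open>p\<close>.\<close>

definition changed_density :: "real \<Rightarrow> real \<Rightarrow> real \<Rightarrow> real \<Rightarrow> real \<Rightarrow> real" where
  "changed_density lam \<alpha> t p y =
     normal_density 0 (sqrt t) y * exp (- lam * t) *
     (p * exp (\<alpha> * y + (lam - \<alpha>\<^sup>2 / 2) * t) + (1 - p) * (lam * lik_integral lam \<alpha> t y))"

definition obs_density :: "real \<Rightarrow> real \<Rightarrow> real \<Rightarrow> real \<Rightarrow> real \<Rightarrow> real" where
  "obs_density lam \<alpha> t p y =
     changed_density lam \<alpha> t p y + (1 - p) * (normal_density 0 (sqrt t) y * exp (- lam * t))"

text \<open>The integral of \<open>g\<close> against \<open>p \<delta>\<^sub>0 + (1 - p) Exp(lam)\<close>, the law of the remaining time to the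
  change when the change has happened with probability \<open>p\<close>.\<close>

definition prior_integral :: "real \<Rightarrow> real \<Rightarrow> (real \<Rightarrow> ennreal) \<Rightarrow> ennreal" where
  "prior_integral lam p g =
     ennreal p * g 0 + ennreal (1 - p) * (\<integral>\<^sup>+r. ennreal (exponential_density lam r) * g r \<partial>lborel)"

lemma lik_integral_integrable:
  "set_integrable lborel {0..t} (\<lambda>u::real. exp ((lam + \<alpha> * y / t) * u - \<alpha>\<^sup>2 * u\<^sup>2 / (2 * t)))"
proof (cases "t = 0")
  case True then show ?thesis by (intro borel_integrable_atLeastAtMost') (auto intro!: continuous_intros)
next
  case False then show ?thesis by (intro borel_integrable_atLeastAtMost') (auto intro!: continuous_intros)
qed

text \<open>The Henstock-Kurzweil integral is rewritten as a Lebesgue integral to get joint measurability in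
  \<open>t\<close> and \<open>y\<close>.\<close>

lemma lik_integral_lebesgue:
  "lik_integral lam \<alpha> t y =
     (LBINT u. indicator {0..t} u * exp ((lam + \<alpha> * y / t) * u - \<alpha>\<^sup>2 * u\<^sup>2 / (2 * t)))"
  using set_borel_integral_eq_integral(2)[OF lik_integral_integrable, of t lam \<alpha> y]
  by (simp add: lik_integral_def set_lebesgue_integral_def)

lemma lik_integral_nonneg: "0 \<le> lik_integral lam \<alpha> t y"
  unfolding lik_integral_lebesgue by (rule integral_nonneg_AE) auto

lemma lik_integral_nn:
  "(\<integral>\<^sup>+u. ennreal (indicator {0..t} u * exp ((lam + \<alpha> * y / t) * u - \<alpha>\<^sup>2 * u\<^sup>2 / (2 * t))) \<partial>lborel)
     = ennreal (lik_integral lam \<alpha> t y)"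
  unfolding lik_integral_lebesgue
  using lik_integral_integrable[of t lam \<alpha> y]
  by (intro nn_integral_eq_integral) (auto simp: set_integrable_def)

lemma lik_integral_measurable [measurable]:
  assumes [measurable]: "f \<in> borel_measurable N" "g \<in> borel_measurable N"
  shows "(\<lambda>x. lik_integral lam \<alpha> (f x) (g x)) \<in> borel_measurable N"
proof -
  have "(\<lambda>z::real\<times>real. lik_integral lam \<alpha> (fst z) (snd z)) \<in> borel_measurable (borel \<Otimes>\<^sub>M borel)"
    unfolding lik_integral_lebesgue
  proof (rule lborel.borel_measurable_lebesgue_integral)
    show "(\<lambda>(z::real\<times>real, u). indicator {0..fst z} u * exp ((lam + \<alpha> * snd z / fst z) * u - \<alpha>\<^sup>2 * u\<^sup>2 / (2 * fst z)))
        \<in> borel_measurable ((borel \<Otimes>\<^sub>M borel) \<Otimes>\<^sub>M lborel)"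
      unfolding indicator_def atLeastAtMost_iff case_prod_beta by measurable
  qed
  from measurable_compose[OF _ this, of "\<lambda>x. (f x, g x)" N] show ?thesis by simp
qed

lemma posterior_measurable [measurable]:
  assumes [measurable]: "f \<in> borel_measurable N" "h \<in> borel_measurable N" "g \<in> borel_measurable N"
  shows "(\<lambda>x. posterior lam \<alpha> (f x) (h x) (g x)) \<in> borel_measurable N"
  unfolding posterior_def j_fun_def lik_integral_def[symmetric] by measurable

lemma changed_density_measurable [measurable]:
  assumes [measurable]: "f \<in> borel_measurable N" "h \<in> borel_measurable N" "g \<in> borel_measurable N"
  shows "(\<lambda>x. changed_density lam \<alpha> (f x) (h x) (g x)) \<in> borel_measurable N"
  unfolding changed_density_def normal_density_def by measurable

lemma obs_density_measurable [measurable]: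
  assumes [measurable]: "f \<in> borel_measurable N" "h \<in> borel_measurable N" "g \<in> borel_measurable N"
  shows "(\<lambda>x. obs_density lam \<alpha> (f x) (h x) (g x)) \<in> borel_measurable N"
  unfolding obs_density_def normal_density_def by measurable

lemma prior_integral_measurable [measurable]:
  assumes [measurable]: "p \<in> borel_measurable N" "(\<lambda>(x, r). h x r) \<in> borel_measurable (N \<Otimes>\<^sub>M borel)"
  shows "(\<lambda>x. prior_integral lam (p x) (h x)) \<in> borel_measurable N"
proof -
  have [measurable]: "(\<lambda>x. h x 0) \<in> borel_measurable N"
    using measurable_compose[OF measurable_Pair2'[of 0 borel N] assms(2)] by simp
  have [measurable]: "(\<lambda>(x, r). h x r) \<in> borel_measurable (N \<Otimes>\<^sub>M lborel)"
    using assms(2) measurable_cong_sets[OF sets_pair_measure_cong[OF refl sets_lborel] refl] by blast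
  have "(\<lambda>x. \<integral>\<^sup>+r. ennreal (exponential_density lam r) * h x r \<partial>lborel) \<in> borel_measurable N"
    by measurable
  then show ?thesis unfolding prior_integral_def by measurable
qed

lemma posterior_bounds:
  assumes "0 < lam" "0 \<le> p" "p \<le> 1"
  shows "0 \<le> posterior lam \<alpha> t p y" "posterior lam \<alpha> t p y \<le> 1"
proof -
  have "0 \<le> j_fun lam \<alpha> t p y" if "p \<noteq> 1"
    using that assms lik_integral_nonneg[of lam \<alpha> t y]
    unfolding j_fun_def lik_integral_def[symmetric] by auto
  then show "0 \<le> posterior lam \<alpha> t p y" "posterior lam \<alpha> t p y \<le> 1"
    unfolding posterior_def by auto
qed

lemma density_bounds:
  assumes "0 < lam" "0 \<le> p" "p \<le> 1" "0 < t"
  shows "0 \<le> changed_density lam \<alpha> t p y" "0 < obs_density lam \<alpha> t p y"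
proof -
  have *: "0 \<le> p * exp (\<alpha> * y + (lam - \<alpha>\<^sup>2 / 2) * t) + (1 - p) * (lam * lik_integral lam \<alpha> t y)"
    using assms lik_integral_nonneg[of lam \<alpha> t y] by auto
  have n: "0 < normal_density 0 (sqrt t) y * exp (- lam * t)"
    using assms by (simp add: normal_density_pos)
  show a: "0 \<le> changed_density lam \<alpha> t p y"
    unfolding changed_density_def using * n by (intro mult_nonneg_nonneg) auto
  show "0 < obs_density lam \<alpha> t p y"
  proof (cases "p = 1")
    case True then show ?thesis unfolding obs_density_def changed_density_def using n by simp
  next
    case False then show ?thesis unfolding obs_density_def using n a assms by (intro add_nonneg_pos) auto
  qed
qed

text \<open>The case distinction at \<open>p = 1\<close> in the definition of the posterior disappears in this form.\<close>

lemma posterior_eq: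
  assumes "0 < lam" "0 \<le> p" "p \<le> 1" "0 < t"
  shows "posterior lam \<alpha> t p y = changed_density lam \<alpha> t p y / obs_density lam \<alpha> t p y"
proof (cases "p = 1")
  case True
  then show ?thesis using density_bounds(2)[OF assms, of \<alpha> y]
    by (simp add: posterior_def obs_density_def)
next
  case False
  define n where "n = normal_density 0 (sqrt t) y * exp (- lam * t)"
  have n: "0 < n" unfolding n_def using assms by (simp add: normal_density_pos)
  have q: "0 < 1 - p" using False assms by simp
  have j: "j_fun lam \<alpha> t p y = changed_density lam \<alpha> t p y / (n * (1 - p))"
    using n q unfolding j_fun_def lik_integral_def[symmetric] changed_density_def n_def[symmetric]
    by (simp add: field_simps)
  have o: "obs_density lam \<alpha> t p y = changed_density lam \<alpha> t p y + n * (1 - p)"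
    unfolding obs_density_def n_def by simp
  have nq: "n * (1 - p) > 0" using n q by simp
  have "c / m / (1 + c / m) = c / (c + m)" if "0 < m" "0 \<le> c" for c m :: real
    using that by (simp add: divide_simps)
  then show ?thesis using False nq density_bounds(1)[OF assms, of \<alpha> y] unfolding posterior_def j o
    by simp
qed

lemma obs_density_posterior:
  assumes "0 < lam" "0 \<le> p" "p \<le> 1" "0 < t"
  shows "obs_density lam \<alpha> t p y * posterior lam \<alpha> t p y = changed_density lam \<alpha> t p y"
    "obs_density lam \<alpha> t p y * (1 - posterior lam \<alpha> t p y)
       = (1 - p) * (normal_density 0 (sqrt t) y * exp (- lam * t))"
proof -
  show a: "obs_density lam \<alpha> t p y * posterior lam \<alpha> t p y = changed_density lam \<alpha> t p y"
    using density_bounds(2)[OF assms, of \<alpha> y] by (simp add: posterior_eq[OF assms])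
  show "obs_density lam \<alpha> t p y * (1 - posterior lam \<alpha> t p y)
       = (1 - p) * (normal_density 0 (sqrt t) y * exp (- lam * t))"
    by (simp add: right_diff_distrib a) (simp add: obs_density_def)
qed

lemma nn_integral_std_normal_affine:
  assumes [measurable]: "G \<in> borel_measurable borel" and "0 < t"
  shows "(\<integral>\<^sup>+z. ennreal (std_normal_density z) * G (a + sqrt t * z) \<partial>lborel)
       = (\<integral>\<^sup>+y. ennreal (normal_density a (sqrt t) y) * G y \<partial>lborel)"
proof -
  have s: "0 < sqrt t" using assms by simp
  have *: "ennreal (sqrt t) * ennreal (normal_density a (sqrt t) (a + sqrt t * z)) = ennreal (std_normal_density z)" for z
    using assms(2) s by (subst ennreal_mult'[symmetric])
      (auto simp: normal_density_def real_sqrt_mult power_mult_distrib)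
  have "(\<integral>\<^sup>+y. ennreal (normal_density a (sqrt t) y) * G y \<partial>lborel)
     = ennreal (sqrt t) * (\<integral>\<^sup>+z. ennreal (normal_density a (sqrt t) (a + sqrt t * z)) * G (a + sqrt t * z) \<partial>lborel)"
    using s by (subst nn_integral_real_affine[where c="sqrt t" and t=a]) auto
  also have "\<dots> = (\<integral>\<^sup>+z. ennreal (sqrt t) * (ennreal (normal_density a (sqrt t) (a + sqrt t * z)) * G (a + sqrt t * z)) \<partial>lborel)"
    by (rule nn_integral_cmult[symmetric]) simp
  also have "\<dots> = (\<integral>\<^sup>+z. ennreal (std_normal_density z) * G (a + sqrt t * z) \<partial>lborel)"
    by (simp add: * mult.assoc[symmetric])
  finally show ?thesis by simp
qed

text \<open>Girsanov's likelihood ratio in one dimension.\<close>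

lemma normal_density_shift:
  assumes "0 < t"
  shows "normal_density (\<alpha> * s) (sqrt t) y
    = normal_density 0 (sqrt t) y * exp (\<alpha> * y * s / t - \<alpha>\<^sup>2 * s\<^sup>2 / (2 * t))"
proof -
  have "- ((y - \<alpha> * s)\<^sup>2 / (2 * t)) = - (y\<^sup>2 / (2 * t)) + (\<alpha> * y * s / t - \<alpha>\<^sup>2 * s\<^sup>2 / (2 * t))"
    using assms by (simp add: field_simps power2_eq_square)
  then show ?thesis using assms by (simp add: normal_density_def exp_add[symmetric])
qed

text \<open>Splitting at \<open>r = t\<close>: before \<open>t\<close> the substitution \<open>u = t - r\<close> produces the likelihood integral,
  and after \<open>t\<close> the lack of memory of the exponential law restores the same integral with the factor
  \<open>exp (- lam * t)\<close>.\<close>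

lemma nn_integral_change_time_split:
  assumes "0 < lam" "0 < t" and [measurable]: "h \<in> borel_measurable borel"
  shows "(\<integral>\<^sup>+r. ennreal (exponential_density lam r) *
            (ennreal (exp (\<alpha> * y * max 0 (t - r) / t - \<alpha>\<^sup>2 * (max 0 (t - r))\<^sup>2 / (2 * t))) * h (max 0 (r - t))) \<partial>lborel)
    = ennreal (exp (- lam * t)) *
        (ennreal (lam * lik_integral lam \<alpha> t y) * h 0 +
         (\<integral>\<^sup>+r. ennreal (exponential_density lam r) * h r \<partial>lborel))" (is "?L = ?R")
proof -
  define Fr where "Fr r = ennreal (exponential_density lam r) *
     (ennreal (exp (\<alpha> * y * max 0 (t - r) / t - \<alpha>\<^sup>2 * (max 0 (t - r))\<^sup>2 / (2 * t))) * h (max 0 (r - t)))" for r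
  have [measurable]: "Fr \<in> borel_measurable borel" unfolding Fr_def by measurable
  have "?L = (\<integral>\<^sup>+u. Fr (t + -1 * u) \<partial>lborel)"
    unfolding Fr_def[symmetric] by (subst nn_integral_real_affine[where c="-1" and t=t]) auto
  also have "\<dots> = (\<integral>\<^sup>+u. (ennreal (exp (- lam * t) * lam) * h 0) *
        ennreal (indicator {0..t} u * exp ((lam + \<alpha> * y / t) * u - \<alpha>\<^sup>2 * u\<^sup>2 / (2 * t)))
      + ennreal (exp (- lam * t)) * (indicator {..<0} u * (ennreal (exponential_density lam (- u)) * h (- u))) \<partial>lborel)"
  proof (rule nn_integral_cong)
    fix u :: real
    show "Fr (t + -1 * u) = (ennreal (exp (- lam * t) * lam) * h 0) *
        ennreal (indicator {0..t} u * exp ((lam + \<alpha> * y / t) * u - \<alpha>\<^sup>2 * u\<^sup>2 / (2 * t)))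
      + ennreal (exp (- lam * t)) * (indicator {..<0} u * (ennreal (exponential_density lam (- u)) * h (- u)))"
    proof (cases "u < 0")
      case True
      have "exponential_density lam (t - u) = exp (- lam * t) * exponential_density lam (- u)"
        using True assms by (simp add: exponential_density_def exp_add[symmetric] algebra_simps)
      then show ?thesis using True assms unfolding Fr_def
        by (simp add: ennreal_mult' mult.assoc)
    next
      case False
      have "exponential_density lam (t - u) * exp (\<alpha> * y * u / t - \<alpha>\<^sup>2 * u\<^sup>2 / (2 * t))
         = exp (- lam * t) * lam * (indicator {0..t} u * exp ((lam + \<alpha> * y / t) * u - \<alpha>\<^sup>2 * u\<^sup>2 / (2 * t)))"
        using False assms by (auto simp: exponential_density_def indicator_def exp_add[symmetric] algebra_simps)
      then show ?thesis using False assms unfolding Fr_def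
        by (simp add: ennreal_mult'[symmetric] mult_ac exponential_density_nonneg)
    qed
  qed
  also have "\<dots> = (ennreal (exp (- lam * t) * lam) * h 0) * ennreal (lik_integral lam \<alpha> t y)
      + ennreal (exp (- lam * t)) * (\<integral>\<^sup>+u. indicator {..<0} u * (ennreal (exponential_density lam (- u)) * h (- u)) \<partial>lborel)"
    by (simp add: nn_integral_add nn_integral_cmult lik_integral_nn)
  also have "(\<integral>\<^sup>+u. indicator {..<0} u * (ennreal (exponential_density lam (- u)) * h (- u)) \<partial>lborel)
      = (\<integral>\<^sup>+r. indicator {..<0} (0 + -1 * r) * (ennreal (exponential_density lam (- (0 + -1 * r))) * h (- (0 + -1 * r))) \<partial>lborel)"
    by (subst nn_integral_real_affine[where c="-1" and t=0]) auto
  also have "\<dots> = (\<integral>\<^sup>+r. ennreal (exponential_density lam r) * h r \<partial>lborel)"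
  proof (rule nn_integral_cong_AE)
    have "AE r in lborel. r \<noteq> (0::real)" by (rule AE_lborel_singleton)
    then show "AE r in lborel. indicator {..<0} (0 + -1 * r) * (ennreal (exponential_density lam (- (0 + -1 * r))) * h (- (0 + -1 * r)))
       = ennreal (exponential_density lam r) * h r"
      by eventually_elim (auto simp: indicator_def exponential_density_def)
  qed
  finally show ?thesis using assms
    by (simp add: ennreal_mult' distrib_left mult_ac lik_integral_nonneg)
qed

text \<open>The joint law of the increment and the new remaining time is disintegrated in two ways. On the left, the remaining time \<open>r\<close> has the mixture law and the increment over a time \<open>t\<close> is
  \<open>\<alpha> (t - r)\<^sup>+\<close> plus Gaussian noise, after which the remaining time is \<open>(r - t)\<^sup>+\<close>. On the right,
  the increment comes first. Writing the Gaussian density as a likelihood ratio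
  times the centred density makes the order of integration exchangeable.\<close>

lemma bayes_formula:
  assumes l: "0 < lam" and p: "0 \<le> p" "p \<le> 1" and t: "0 < t"
    and H [measurable]: "(\<lambda>(y, r). H y r) \<in> borel_measurable (borel \<Otimes>\<^sub>M borel)"
  shows "prior_integral lam p (\<lambda>r. \<integral>\<^sup>+z. ennreal (std_normal_density z) *
             H (\<alpha> * max 0 (t - r) + sqrt t * z) (max 0 (r - t)) \<partial>lborel)
       = (\<integral>\<^sup>+y. ennreal (obs_density lam \<alpha> t p y) *
             prior_integral lam (posterior lam \<alpha> t p y) (H y) \<partial>lborel)"
proof -
  let ?n = "\<lambda>y. normal_density 0 (sqrt t) y"
  let ?e = "\<lambda>r. exponential_density lam r"
  let ?l = "\<lambda>y s. exp (\<alpha> * y * s / t - \<alpha>\<^sup>2 * s\<^sup>2 / (2 * t))"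
  have Hm [measurable]: "(\<lambda>y. H y r) \<in> borel_measurable borel" "H y \<in> borel_measurable borel" for y r
    using measurable_compose[OF measurable_Pair2'[of r borel borel] H]
      measurable_compose[OF measurable_Pair1'[of y borel borel] H] by simp_all
  have inner: "(\<integral>\<^sup>+z. ennreal (std_normal_density z) * H (\<alpha> * s + sqrt t * z) r \<partial>lborel)
     = (\<integral>\<^sup>+y. ennreal (?n y) * (ennreal (?l y s) * H y r) \<partial>lborel)" for s r
    by (subst nn_integral_std_normal_affine[OF _ t])
       (auto simp: normal_density_shift[OF t] ennreal_mult' mult.assoc)
  have sw: "(\<integral>\<^sup>+r. ennreal (?e r) * (\<integral>\<^sup>+y. ennreal (?n y) * (ennreal (?l y (max 0 (t - r))) * H y (max 0 (r - t))) \<partial>lborel) \<partial>lborel)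
     = (\<integral>\<^sup>+y. ennreal (?n y) * (ennreal (exp (- lam * t)) *
        (ennreal (lam * lik_integral lam \<alpha> t y) * H y 0 +
         (\<integral>\<^sup>+r. ennreal (?e r) * H y r \<partial>lborel))) \<partial>lborel)"
  proof -
    have "(\<integral>\<^sup>+r. ennreal (?e r) * (\<integral>\<^sup>+y. ennreal (?n y) * (ennreal (?l y (max 0 (t - r))) * H y (max 0 (r - t))) \<partial>lborel) \<partial>lborel)
      = (\<integral>\<^sup>+r. \<integral>\<^sup>+y. ennreal (?n y) * (ennreal (?e r) * (ennreal (?l y (max 0 (t - r))) * H y (max 0 (r - t)))) \<partial>lborel \<partial>lborel)"
      by (subst nn_integral_cmult[symmetric], measurable) (simp add: mult.left_commute)
    also have "\<dots> = (\<integral>\<^sup>+y. \<integral>\<^sup>+r. ennreal (?n y) * (ennreal (?e r) * (ennreal (?l y (max 0 (t - r))) * H y (max 0 (r - t)))) \<partial>lborel \<partial>lborel)"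
      by (rule lborel_pair.Fubini') measurable
    also have "\<dots> = (\<integral>\<^sup>+y. ennreal (?n y) * (\<integral>\<^sup>+r. ennreal (?e r) * (ennreal (?l y (max 0 (t - r))) * H y (max 0 (r - t))) \<partial>lborel) \<partial>lborel)"
      by (simp add: nn_integral_cmult)
    also have "\<dots> = (\<integral>\<^sup>+y. ennreal (?n y) * (ennreal (exp (- lam * t)) *
        (ennreal (lam * lik_integral lam \<alpha> t y) * H y 0 +
         (\<integral>\<^sup>+r. ennreal (?e r) * H y r \<partial>lborel))) \<partial>lborel)"
      by (subst nn_integral_change_time_split[OF l t]) auto
    finally show ?thesis .
  qed
  have "prior_integral lam p (\<lambda>r. \<integral>\<^sup>+z. ennreal (std_normal_density z) *
             H (\<alpha> * max 0 (t - r) + sqrt t * z) (max 0 (r - t)) \<partial>lborel)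
    = ennreal p * (\<integral>\<^sup>+y. ennreal (?n y) * (ennreal (?l y t) * H y 0) \<partial>lborel)
      + ennreal (1 - p) * (\<integral>\<^sup>+y. ennreal (?n y) * (ennreal (exp (- lam * t)) *
        (ennreal (lam * lik_integral lam \<alpha> t y) * H y 0 +
         (\<integral>\<^sup>+r. ennreal (?e r) * H y r \<partial>lborel))) \<partial>lborel)"
    unfolding prior_integral_def inner sw using t by simp
  also have "\<dots> = (\<integral>\<^sup>+y. ennreal p * (ennreal (?n y) * (ennreal (?l y t) * H y 0))
      + ennreal (1 - p) * (ennreal (?n y) * (ennreal (exp (- lam * t)) *
        (ennreal (lam * lik_integral lam \<alpha> t y) * H y 0 +
         (\<integral>\<^sup>+r. ennreal (?e r) * H y r \<partial>lborel)))) \<partial>lborel)"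
    by (simp add: nn_integral_add nn_integral_cmult)
  also have "\<dots> = (\<integral>\<^sup>+y. ennreal (obs_density lam \<alpha> t p y) *
             prior_integral lam (posterior lam \<alpha> t p y) (H y) \<partial>lborel)"
  proof (rule nn_integral_cong)
    fix y
    let ?I = "\<integral>\<^sup>+r. ennreal (?e r) * H y r \<partial>lborel"
    have ob: "0 \<le> obs_density lam \<alpha> t p y" using density_bounds(2)[OF l p t, of \<alpha> y] by simp
    note pb = posterior_bounds[OF l p, of \<alpha> t y]
    have "ennreal (obs_density lam \<alpha> t p y) * prior_integral lam (posterior lam \<alpha> t p y) (H y)
       = ennreal (obs_density lam \<alpha> t p y * posterior lam \<alpha> t p y) * H y 0
       + ennreal (obs_density lam \<alpha> t p y * (1 - posterior lam \<alpha> t p y)) * ?I"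
      unfolding prior_integral_def using ob pb by (simp add: ennreal_mult distrib_left mult.assoc)
    also have "\<dots> = ennreal (changed_density lam \<alpha> t p y) * H y 0
       + ennreal ((1 - p) * (?n y * exp (- lam * t))) * ?I"
      unfolding obs_density_posterior[OF l p t] ..
    also have "changed_density lam \<alpha> t p y = p * (?n y * ?l y t)
         + (1 - p) * (?n y * (exp (- lam * t) * (lam * lik_integral lam \<alpha> t y)))"
    proof -
      have "exp (- lam * t) * exp (\<alpha> * y + (lam - \<alpha>\<^sup>2 / 2) * t) = ?l y t"
        using t by (simp add: exp_add[symmetric] field_simps power2_eq_square)
      then show ?thesis unfolding changed_density_def by (simp add: algebra_simps)
    qed
    also have "ennreal \<dots> = ennreal (p * (?n y * ?l y t))
       + ennreal ((1 - p) * (?n y * (exp (- lam * t) * (lam * lik_integral lam \<alpha> t y))))"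
      using p l by (intro ennreal_plus mult_nonneg_nonneg) (auto simp: lik_integral_nonneg)
    finally show "ennreal p * (ennreal (?n y) * (ennreal (?l y t) * H y 0))
      + ennreal (1 - p) * (ennreal (?n y) * (ennreal (exp (- lam * t)) *
        (ennreal (lam * lik_integral lam \<alpha> t y) * H y 0 + ?I)))
      = ennreal (obs_density lam \<alpha> t p y) * prior_integral lam (posterior lam \<alpha> t p y) (H y)"
      using p l by (simp add: ennreal_mult lik_integral_nonneg distrib_left distrib_right mult_ac add_ac)
  qed
  finally show ?thesis .
qed

lemma prior_integral_const:
  assumes "0 < lam" "0 \<le> p" "p \<le> 1"
  shows "prior_integral lam p (\<lambda>_. k) = k"
proof -
  have "(\<integral>\<^sup>+r. ennreal (exponential_density lam r) * k \<partial>lborel)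
      = (\<integral>\<^sup>+r. ennreal (exponential_density lam r) \<partial>lborel) * k"
    by (rule nn_integral_multc) simp
  also have "(\<integral>\<^sup>+r. ennreal (exponential_density lam r) \<partial>lborel) = 1"
    using prob_space.emeasure_space_1[OF prob_space_exponential_density[OF assms(1)]]
    by (simp add: emeasure_density)
  finally show ?thesis
    using assms by (simp add: prior_integral_def distrib_right[symmetric] ennreal_plus[symmetric] del: ennreal_plus)
qed

lemma std_normal_integral_1: "(\<integral>\<^sup>+z. ennreal (std_normal_density z) \<partial>lborel) = 1"
  using prob_space.emeasure_space_1[OF prob_space_normal_density[of 1 0]] by (simp add: emeasure_density)

text \<open>The case \<open>H = 1\<close> of Bayes' formula.\<close>

lemma obs_density_integral:
  assumes "0 < lam" "0 \<le> p" "p \<le> 1" "0 < t"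
  shows "(\<integral>\<^sup>+y. ennreal (obs_density lam \<alpha> t p y) \<partial>lborel) = 1"
proof -
  have "prior_integral lam p (\<lambda>r. \<integral>\<^sup>+z. ennreal (std_normal_density z) * 1 \<partial>lborel)
     = (\<integral>\<^sup>+y. ennreal (obs_density lam \<alpha> t p y) *
             prior_integral lam (posterior lam \<alpha> t p y) (\<lambda>_. 1) \<partial>lborel)"
    using bayes_formula[OF assms, of "\<lambda>_ _. 1" \<alpha>] by simp
  then show ?thesis
    using assms by (simp add: prior_integral_const std_normal_integral_1 posterior_bounds)
qed


section \<open>The dynamic programming operator\<close>

lemma FF_compose_measurable:
  assumes "f \<in> FF" and g: "g \<in> borel_measurable N" and "\<And>x. x \<in> space N \<Longrightarrow> g x \<in> {0..1}"
  shows "(\<lambda>x. f (g x)) \<in> borel_measurable N"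
proof -
  have "g \<in> measurable N (restrict_space borel {0..1})"
    using assms by (intro measurable_restrict_space2) auto
  then show ?thesis using assms(1) unfolding FF_def by (auto intro: measurable_compose)
qed

lemma FF_bounds: "f \<in> FF \<Longrightarrow> 0 \<le> p \<Longrightarrow> p \<le> 1 \<Longrightarrow> 0 \<le> f p \<and> f p \<le> 1 \<and> f p \<le> 1 - p"
  unfolding FF_def by auto

lemma concave_continuous:
  fixes f :: "real \<Rightarrow> real"
  assumes "concave_on {0..1} f"
  shows "continuous_on {0<..<1} f"
proof -
  have "convex_on {0<..<1} (\<lambda>x. - f x)"
    using assms unfolding concave_on_def by (rule convex_on_subset) auto
  then have "continuous_on {0<..<1} (\<lambda>x. - f x)" by (intro convex_on_continuous) auto
  then have "continuous_on {0<..<1} (\<lambda>x. - (- f x))" by (rule continuous_on_minus)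
  then show ?thesis by simp
qed

text \<open>A concave function is continuous in the open interval, and its two boundary values do not affect
  measurability.\<close>

lemma concave_measurable:
  fixes f :: "real \<Rightarrow> real"
  assumes "concave_on {0..1} f"
  shows "f \<in> borel_measurable (restrict_space borel {0..1})"
proof -
  have [measurable]: "(\<lambda>x. indicator {0<..<1} x *\<^sub>R f x) \<in> borel_measurable borel"
    using concave_continuous[OF assms] by (intro borel_measurable_continuous_on_indicator) auto
  have "(\<lambda>x. indicator {0<..<1} x *\<^sub>R f x + indicator {0} x * f 0 + indicator {1} x * f 1)
      \<in> borel_measurable borel" by measurable
  also have "(\<lambda>x. indicator {0<..<1} x *\<^sub>R f x + indicator {0} x * f 0 + indicator {1} x * f 1)
      = (\<lambda>x. indicator {0..1} x *\<^sub>R f x)" by (rule ext) (auto simp: indicator_def)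
  finally show ?thesis by (subst borel_measurable_restrict_space_iff) auto
qed

lemma concave_INF:
  fixes h :: "'i \<Rightarrow> real \<Rightarrow> real"
  assumes "I \<noteq> {}" and h: "\<And>i. i \<in> I \<Longrightarrow> concave_on {0..1} (h i)"
    and pos: "\<And>i p. i \<in> I \<Longrightarrow> p \<in> {0..1} \<Longrightarrow> 0 \<le> h i p"
  shows "concave_on {0..1} (\<lambda>p. INF i\<in>I. h i p)"
  unfolding concave_on_iff
proof (intro conjI ballI allI impI)
  fix x y u v :: real
  assume xy: "x \<in> {0..1}" "y \<in> {0..1}" and uv: "0 \<le> u" "0 \<le> v" "u + v = 1"
  have bdd: "bdd_below ((\<lambda>i. h i p) ` I)" if "p \<in> {0..1}" for p
    using pos that by (intro bdd_belowI[of _ 0]) auto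
  show "u * (INF i\<in>I. h i x) + v * (INF i\<in>I. h i y) \<le> (INF i\<in>I. h i (u *\<^sub>R x + v *\<^sub>R y))"
  proof (rule cINF_greatest[OF assms(1)])
    fix i assume i: "i \<in> I"
    have "u * (INF i\<in>I. h i x) + v * (INF i\<in>I. h i y) \<le> u * h i x + v * h i y"
      using i uv xy by (intro add_mono mult_left_mono cINF_lower bdd) auto
    also have "\<dots> \<le> h i (u *\<^sub>R x + v *\<^sub>R y)"
      using h[OF i] xy uv unfolding concave_on_iff by auto
    finally show "u * (INF i\<in>I. h i x) + v * (INF i\<in>I. h i y) \<le> h i (u *\<^sub>R x + v *\<^sub>R y)" .
  qed
qed simp

text \<open>In the open interval, each \<open>h i\<close> and the infimum are concave, hence continuous, so that the set where \<open>i\<close>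
  is almost optimal is open. By Lindelof's theorem countably many indices suffice there, and two further
  indices serve the end points. Choosing the first almost optimal index in an enumeration is measurable.\<close>

lemma concave_selection:
  fixes h :: "real \<Rightarrow> real \<Rightarrow> real"
  assumes ne: "I \<noteq> {}" and h: "\<And>i. i \<in> I \<Longrightarrow> concave_on {0..1} (h i)"
    and pos: "\<And>i p. i \<in> I \<Longrightarrow> p \<in> {0..1} \<Longrightarrow> 0 \<le> h i p" and e: "0 < e"
  shows "\<exists>s \<in> borel_measurable borel. (\<forall>p. s p \<in> I) \<and>
    (\<forall>p\<in>{0..1}. h (s p) p \<le> (INF i\<in>I. h i p) + e)"
proof -
  define m where "m p = (INF i\<in>I. h i p)" for p
  have mc: "concave_on {0..1} m" unfolding m_def using ne h pos by (rule concave_INF)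
  have ex: "\<exists>i\<in>I. h i p < m p + e" if "p \<in> {0..1}" for p
  proof -
    have "m p < m p + e" using e by simp
    then show ?thesis unfolding m_def
      by (subst (asm) cINF_less_iff) (auto intro!: bdd_belowI[of _ 0] ne pos that)
  qed
  define U where "U i = {p\<in>{0<..<1}. h i p - m p < e}" for i
  have "open (U i)" if "i \<in> I" for i
  proof -
    have "continuous_on {0<..<1} (\<lambda>p. h i p - m p)"
      by (intro continuous_on_diff concave_continuous h mc that)
    then have "open ({0<..<1} \<inter> (\<lambda>p. h i p - m p) -` {..<e})"
      by (intro continuous_open_preimage) auto
    moreover have "{0<..<1} \<inter> (\<lambda>p. h i p - m p) -` {..<e} = U i" unfolding U_def by auto
    ultimately show ?thesis by simp
  qed
  then obtain C' where C': "C' \<subseteq> U ` I" "countable C'" "\<Union>C' = \<Union>(U ` I)"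
    using Lindelof[of "U ` I"] by (metis imageE)
  obtain C where C: "countable C" "C \<subseteq> I" "C' = U ` C"
    using C'(1,2) by (metis countable_subset_image)
  obtain i0 i1 where i01: "i0 \<in> I" "h i0 0 < m 0 + e" "i1 \<in> I" "h i1 1 < m 1 + e"
    using ex[of 0] ex[of 1] by auto
  define K where "K = insert i0 (insert i1 C)"
  have K: "countable K" "K \<noteq> {}" "K \<subseteq> I" using C i01 unfolding K_def by auto
  have exK: "\<exists>i\<in>K. h i p < m p + e" if p: "p \<in> {0..1}" for p
  proof (cases "p = 0 \<or> p = 1")
    case True then show ?thesis using i01 unfolding K_def by auto
  next
    case False
    obtain i where "i \<in> I" "h i p < m p + e" using ex[OF p] by auto
    then have "p \<in> U i" using False p unfolding U_def by auto
    then have "p \<in> \<Union>(U ` I)" using \<open>i \<in> I\<close> by blast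
    then obtain i' where "i' \<in> C" "p \<in> U i'" using C'(3) C(3) by auto
    then have "h i' p < m p + e" unfolding U_def by auto
    then show ?thesis using \<open>i' \<in> C\<close> unfolding K_def by blast
  qed
  define en where "en = from_nat_into K"
  have enI: "en n \<in> I" for n using K from_nat_into[OF K(2)] unfolding en_def by auto
  define Pd where "Pd n p \<longleftrightarrow> p \<in> {0..1} \<and> h (en n) p < m p + e" for n p
  have [measurable]: "Measurable.pred borel (Pd n)" for n
  proof -
    have *: "(\<lambda>x. indicator {0..1} x *\<^sub>R g x) \<in> borel_measurable borel" if "concave_on {0..1} g" for g :: "real \<Rightarrow> real"
      using concave_measurable[OF that] by (subst (asm) borel_measurable_restrict_space_iff) auto
    have [measurable]: "(\<lambda>x. indicator {0..1} x *\<^sub>R h (en n) x) \<in> borel_measurable borel"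
       "(\<lambda>x. indicator {0..1} x *\<^sub>R m x) \<in> borel_measurable borel"
      by (intro * h enI mc)+
    have eq: "Pd n = (\<lambda>p. p \<in> {0..1} \<and> indicator {0..1} p *\<^sub>R h (en n) p < indicator {0..1} p *\<^sub>R m p + e)"
      unfolding Pd_def by (rule ext) auto
    show ?thesis unfolding eq by measurable
  qed
  define s where "s p = en (LEAST n. Pd n p)" for p
  have "s \<in> borel_measurable borel"
  proof -
    have "(\<lambda>p. LEAST n. Pd n p) \<in> measurable borel (count_space UNIV)" by measurable
    then have "(\<lambda>p. en (LEAST n. Pd n p)) \<in> borel_measurable borel" by (rule measurable_compose) simp
    then show ?thesis unfolding s_def[abs_def] .
  qed
  moreover have "\<forall>p. s p \<in> I" unfolding s_def using enI by auto
  moreover have "\<forall>p\<in>{0..1}. h (s p) p \<le> m p + e"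
  proof
    fix p :: real assume p: "p \<in> {0..1}"
    obtain i where "i \<in> K" "h i p < m p + e" using exK[OF p] by auto
    then obtain n where "Pd n p" using from_nat_into_surj[OF K(1)] p unfolding Pd_def en_def by metis
    then have "Pd (LEAST n. Pd n p) p" by (rule LeastI)
    then show "h (s p) p \<le> m p + e"
      using Pd_def[of "LEAST n. Pd n p" p] unfolding s_def by simp
  qed
  ultimately show ?thesis unfolding m_def by blast
qed

locale detection_params =
  fixes lam c d \<alpha> :: real
  assumes lam: "0 < lam" and c: "0 < c" and d: "0 < d"
begin

definition delay_cost :: "real \<Rightarrow> real \<Rightarrow> real" where
  "delay_cost p t = c * t - c * (1 - p) * ((1 - exp (- lam * t)) / lam)"

definition stop_cost :: "real \<Rightarrow> real \<Rightarrow> real" where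
  "stop_cost p t = (1 - p) * exp (- lam * t) + delay_cost p t"

text \<open>The expected value of \<open>f\<close> at the posterior after waiting for a time \<open>t\<close>, written with the density of
  the increment and so without reference to any probability space. That it is the expectation in \<open>J0_op\<close>
  is shown later, in \<open>expectation_posterior\<close>.\<close>

definition next_value :: "(real \<Rightarrow> real) \<Rightarrow> real \<Rightarrow> real \<Rightarrow> real" where
  "next_value f p t = (LBINT y. obs_density lam \<alpha> t p y * f (posterior lam \<alpha> t p y))"

definition J0 :: "(real \<Rightarrow> real) \<Rightarrow> real \<Rightarrow> real \<Rightarrow> real" where
  "J0 f p t = d + next_value f p t + delay_cost p t"

definition J :: "(real \<Rightarrow> real) \<Rightarrow> real \<Rightarrow> real" where
  "J f p = min (F_fun lam c p) (INF t\<in>{0<..}. J0 f p t)"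

lemma F_fun_eq: "F_fun lam c p = (INF t\<in>{0..}. stop_cost p t)"
  unfolding F_fun_def stop_cost_def delay_cost_def by (simp add: add_diff_eq)

lemma delay_cost_nonneg:
  assumes "0 \<le> p" "p \<le> 1" "0 \<le> t"
  shows "0 \<le> delay_cost p t"
proof -
  have "1 - exp (- lam * t) \<le> lam * t" using exp_ge_add_one_self[of "- lam * t"] by simp
  then have a: "(1 - exp (- lam * t)) / lam \<le> t" using lam by (simp add: field_simps)
  have b: "0 \<le> (1 - exp (- lam * t)) / lam" using lam assms by simp
  have "(1 - p) * ((1 - exp (- lam * t)) / lam) \<le> 1 * t"
    using a b assms by (intro mult_mono) auto
  then have "c * ((1 - p) * ((1 - exp (- lam * t)) / lam)) \<le> c * t"
    using c by (intro mult_left_mono) auto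
  then show ?thesis unfolding delay_cost_def by (simp add: mult.assoc)
qed

lemma stop_cost_nonneg: "0 \<le> p \<Longrightarrow> p \<le> 1 \<Longrightarrow> 0 \<le> t \<Longrightarrow> 0 \<le> stop_cost p t"
  unfolding stop_cost_def using delay_cost_nonneg by simp

lemma stop_cost_concave: "concave_on {0..1} (\<lambda>p. stop_cost p t)"
proof -
  have v: "v = 1 - u" if "u + v = 1" for u v :: real using that by simp
  show ?thesis unfolding concave_on_iff stop_cost_def delay_cost_def
    by (auto dest!: v simp: algebra_simps add_divide_distrib diff_divide_distrib)
qed

lemma F_bounds:
  assumes "0 \<le> p" "p \<le> 1"
  shows "0 \<le> F_fun lam c p" "F_fun lam c p \<le> 1 - p"
    "\<And>t. 0 \<le> t \<Longrightarrow> F_fun lam c p \<le> stop_cost p t"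
proof -
  have bdd: "bdd_below ((\<lambda>t. stop_cost p t) ` {0..})"
    using stop_cost_nonneg assms by (intro bdd_belowI[of _ 0]) auto
  show "0 \<le> F_fun lam c p" unfolding F_fun_eq
    using stop_cost_nonneg assms by (intro cINF_greatest) auto
  show *: "F_fun lam c p \<le> stop_cost p t" if "0 \<le> t" for t
    unfolding F_fun_eq using that by (intro cINF_lower bdd) auto
  show "F_fun lam c p \<le> 1 - p" using *[of 0] by (simp add: stop_cost_def delay_cost_def)
qed

lemma F_concave: "concave_on {0..1} (F_fun lam c)"
proof -
  have "concave_on {0..1} (\<lambda>p. INF t\<in>{0..}. stop_cost p t)"
    using stop_cost_nonneg by (intro concave_INF stop_cost_concave) auto
  then show ?thesis by (simp add: F_fun_eq[symmetric])
qed

lemma F_in_FF: "F_fun lam c \<in> FF"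
  unfolding FF_def using F_bounds concave_measurable[OF F_concave] by (fastforce)

lemma next_value_integrable:
  assumes f: "f \<in> FF" and p: "0 \<le> p" "p \<le> 1" and t: "0 < t"
  shows "integrable lborel (\<lambda>y. obs_density lam \<alpha> t p y * f (posterior lam \<alpha> t p y))"
    and "0 \<le> next_value f p t" "next_value f p t \<le> 1"
    and "(\<integral>\<^sup>+y. ennreal (obs_density lam \<alpha> t p y) * ennreal (f (posterior lam \<alpha> t p y)) \<partial>lborel)
         = ennreal (next_value f p t)"
proof -
  note pb = posterior_bounds[OF lam p, of \<alpha> t]
  have fb: "0 \<le> f (posterior lam \<alpha> t p y)" "f (posterior lam \<alpha> t p y) \<le> 1" for y
    using FF_bounds[OF f pb] by auto
  have ob: "0 \<le> obs_density lam \<alpha> t p y" for y using density_bounds(2)[OF lam p t, of \<alpha> y] by simp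
  have [measurable]: "(\<lambda>y. f (posterior lam \<alpha> t p y)) \<in> borel_measurable lborel"
    using pb by (intro FF_compose_measurable[OF f]) auto
  have le: "(\<integral>\<^sup>+y. ennreal (obs_density lam \<alpha> t p y * f (posterior lam \<alpha> t p y)) \<partial>lborel) \<le> 1"
  proof -
    have "(\<integral>\<^sup>+y. ennreal (obs_density lam \<alpha> t p y * f (posterior lam \<alpha> t p y)) \<partial>lborel)
       \<le> (\<integral>\<^sup>+y. ennreal (obs_density lam \<alpha> t p y) \<partial>lborel)"
      using mult_left_mono[OF fb(2) ob] by (intro nn_integral_mono ennreal_leI) simp
    then show ?thesis by (simp add: obs_density_integral[OF lam p t])
  qed
  show i: "integrable lborel (\<lambda>y. obs_density lam \<alpha> t p y * f (posterior lam \<alpha> t p y))"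
    using le ob fb by (intro integrableI_nonneg) (auto intro: le_less_trans)
  show "0 \<le> next_value f p t" unfolding next_value_def using ob fb by (intro Bochner_Integration.integral_nonneg) auto
  have "(\<integral>\<^sup>+y. ennreal (obs_density lam \<alpha> t p y * f (posterior lam \<alpha> t p y)) \<partial>lborel) = ennreal (next_value f p t)"
    unfolding next_value_def using i ob fb by (intro nn_integral_eq_integral) auto
  then show "(\<integral>\<^sup>+y. ennreal (obs_density lam \<alpha> t p y) * ennreal (f (posterior lam \<alpha> t p y)) \<partial>lborel)
         = ennreal (next_value f p t)" "next_value f p t \<le> 1"
    using le ob fb by (simp_all add: ennreal_mult ennreal_le_1)
qed

text \<open>The factor \<open>K\<close> is 1 for the monotonicity of \<open>J\<close> and larger than 1 in the uniqueness proof.\<close>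

lemma next_value_mono:
  assumes "f \<in> FF" "g \<in> FF" and p: "0 \<le> p" "p \<le> 1" and t: "0 < t"
    and le: "\<And>p. 0 \<le> p \<Longrightarrow> p \<le> 1 \<Longrightarrow> f p \<le> K * g p"
  shows "next_value f p t \<le> K * next_value g p t"
proof -
  note pb = posterior_bounds[OF lam p, of \<alpha> t]
  have ob: "0 \<le> obs_density lam \<alpha> t p y" for y using density_bounds(2)[OF lam p t, of \<alpha> y] by simp
  have "next_value f p t \<le> (LBINT y. K * (obs_density lam \<alpha> t p y * g (posterior lam \<alpha> t p y)))"
    unfolding next_value_def
    using mult_left_mono[OF le[OF pb] ob]
    by (intro integral_mono next_value_integrable(1) assms integrable_mult_right) (simp add: mult.left_commute)
  then show ?thesis unfolding next_value_def by simp
qed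

lemma J0_ge_d: "f \<in> FF \<Longrightarrow> 0 \<le> p \<Longrightarrow> p \<le> 1 \<Longrightarrow> 0 < t \<Longrightarrow> d \<le> J0 f p t"
  unfolding J0_def using next_value_integrable(2)[of f p t] delay_cost_nonneg[of p t] by simp

lemma J0_bdd: "f \<in> FF \<Longrightarrow> 0 \<le> p \<Longrightarrow> p \<le> 1 \<Longrightarrow> bdd_below ((\<lambda>t. J0 f p t) ` {0<..})"
  using J0_ge_d by (intro bdd_belowI[of _ d]) auto

lemma J_le:
  assumes "f \<in> FF" "0 \<le> p" "p \<le> 1"
  shows "J f p \<le> F_fun lam c p" "0 < t \<Longrightarrow> J f p \<le> J0 f p t"
proof -
  show "J f p \<le> F_fun lam c p" unfolding J_def by simp
  show "J f p \<le> J0 f p t" if "0 < t"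
    unfolding J_def using that J0_bdd[OF assms] by (intro min.coboundedI2 cINF_lower) auto
qed

lemma J_greatest:
  assumes "a \<le> F_fun lam c p" "\<And>t. 0 < t \<Longrightarrow> a \<le> J0 f p t"
  shows "a \<le> J f p"
  unfolding J_def using assms by (auto intro!: cINF_greatest)

lemma J_mono:
  assumes "f \<in> FF" "g \<in> FF" "0 \<le> p" "p \<le> 1" "\<And>p. 0 \<le> p \<Longrightarrow> p \<le> 1 \<Longrightarrow> f p \<le> g p"
  shows "J f p \<le> J g p"
proof (rule J_greatest)
  show "J f p \<le> F_fun lam c p" using J_le assms by simp
  fix t :: real assume t: "0 < t"
  have "J f p \<le> J0 f p t" using J_le assms t by simp
  also have "\<dots> \<le> J0 g p t"
    using next_value_mono[OF assms(1-4) t, of 1] assms(5) unfolding J0_def by simp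
  finally show "J f p \<le> J0 g p t" .
qed

text \<open>The posterior is the quotient \<open>N / D\<close> of two affine functions of \<open>p\<close>, and the integrand \<open>D f(N / D)\<close> is
  the perspective of \<open>f\<close>, which is concave in \<open>(N, D)\<close> and hence in \<open>p\<close>.\<close>

lemma next_value_concave:
  assumes f: "f \<in> FF" and conc: "concave_on {0..1} f" and t: "0 < t"
  shows "concave_on {0..1} (\<lambda>p. next_value f p t)"
  unfolding concave_on_iff
proof (intro conjI ballI allI impI)
  fix x y u v :: real
  assume xy: "x \<in> {0..1}" "y \<in> {0..1}" and uv: "0 \<le> u" "0 \<le> v" "u + v = 1"
  define p where "p = u * x + v * y"
  have p: "0 \<le> p" "p \<le> 1"
  proof -
    show "0 \<le> p" using xy uv unfolding p_def by simp
    have "p \<le> u * 1 + v * 1" using xy uv unfolding p_def by (intro add_mono mult_left_mono) auto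
    then show "p \<le> 1" using uv by simp
  qed
  have x: "0 \<le> x" "x \<le> 1" and y: "0 \<le> y" "y \<le> 1" using xy by auto
  let ?D = "\<lambda>p z. obs_density lam \<alpha> t p z" and ?N = "\<lambda>p z. changed_density lam \<alpha> t p z"
  let ?q = "\<lambda>p z. posterior lam \<alpha> t p z"
  have v: "v = 1 - u" using uv by simp
  have Npt: "?N p z = u * ?N x z + v * ?N y z" for z
    unfolding p_def v changed_density_def by (simp add: algebra_simps)
  have Dpt: "?D p z = u * ?D x z + v * ?D y z" for z
    unfolding obs_density_def Npt unfolding p_def v by (simp add: algebra_simps)
  have key: "u * (?D x z * f (?q x z)) + v * (?D y z * f (?q y z)) \<le> ?D p z * f (?q p z)" for z
  proof -
    have D: "0 < ?D p z" "0 < ?D x z" "0 < ?D y z" using density_bounds(2)[OF lam _ _ t] p x y by auto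
    define a b where "a = u * ?D x z / ?D p z" and "b = v * ?D y z / ?D p z"
    have ab: "0 \<le> a" "0 \<le> b" "a + b = 1"
      using D uv Dpt[of z] unfolding a_def b_def by (auto simp: add_divide_distrib[symmetric])
    have q: "?q p z = a * ?q x z + b * ?q y z"
    proof -
      have "a * ?q x z = u * ?N x z / ?D p z" "b * ?q y z = v * ?N y z / ?D p z"
        using D unfolding a_def b_def posterior_eq[OF lam x t] posterior_eq[OF lam y t] by auto
      then show ?thesis unfolding posterior_eq[OF lam p t] Npt by (simp add: add_divide_distrib)
    qed
    have "a * f (?q x z) + b * f (?q y z) \<le> f (a *\<^sub>R ?q x z + b *\<^sub>R ?q y z)"
      using conc ab posterior_bounds[OF lam x] posterior_bounds[OF lam y]
      unfolding concave_on_iff by (auto simp del: real_scaleR_def)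
    then have "?D p z * (a * f (?q x z) + b * f (?q y z)) \<le> ?D p z * f (?q p z)"
      using D q by simp
    moreover have "?D p z * a = u * ?D x z" "?D p z * b = v * ?D y z" using D unfolding a_def b_def by auto
    ultimately show ?thesis by (simp add: distrib_left mult.assoc[symmetric])
  qed
  have "u * next_value f x t + v * next_value f y t
      = (LBINT z. u * (?D x z * f (?q x z)) + v * (?D y z * f (?q y z)))"
    unfolding next_value_def using next_value_integrable(1)[OF f _ _ t] x y by simp
  also have "\<dots> \<le> next_value f p t"
    unfolding next_value_def using key next_value_integrable(1)[OF f _ _ t] x y p
    by (intro integral_mono) auto
  finally show "u * next_value f x t + v * next_value f y t \<le> next_value f (u *\<^sub>R x + v *\<^sub>R y) t"
    unfolding p_def by simp
qed simp

lemma J0_concave: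
  assumes f: "f \<in> FF" and conc: "concave_on {0..1} f" and t: "0 < t"
  shows "concave_on {0..1} (\<lambda>p. J0 f p t)"
proof -
  have v: "v = 1 - u" if "u + v = 1" for u v :: real using that by simp
  have "concave_on {0..1} (\<lambda>p. d + delay_cost p t)" unfolding concave_on_iff delay_cost_def
    by (auto dest!: v simp: algebra_simps add_divide_distrib diff_divide_distrib)
  from concave_on_add[OF next_value_concave[OF assms] this] show ?thesis
    unfolding J0_def by (simp add: add_ac)
qed

lemma concave_min:
  fixes f g :: "real \<Rightarrow> real"
  assumes "concave_on {0..1} f" "concave_on {0..1} g"
  shows "concave_on {0..1} (\<lambda>x. min (f x) (g x))"
  unfolding concave_on_iff
proof (intro conjI ballI allI impI)
  fix x y u v :: real
  assume xy: "x \<in> {0..1}" "y \<in> {0..1}" and uv: "0 \<le> u" "0 \<le> v" "u + v = 1"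
  have "u * min (f x) (g x) + v * min (f y) (g y) \<le> u * f x + v * f y"
    "u * min (f x) (g x) + v * min (f y) (g y) \<le> u * g x + v * g y"
    using uv by (intro add_mono mult_left_mono; simp)+
  moreover have "u * f x + v * f y \<le> f (u *\<^sub>R x + v *\<^sub>R y)" "u * g x + v * g y \<le> g (u *\<^sub>R x + v *\<^sub>R y)"
    using assms xy uv unfolding concave_on_iff by blast+
  ultimately show "u * min (f x) (g x) + v * min (f y) (g y) \<le> min (f (u *\<^sub>R x + v *\<^sub>R y)) (g (u *\<^sub>R x + v *\<^sub>R y))"
    by linarith
qed simp

lemma J_concave:
  assumes f: "f \<in> FF" and conc: "concave_on {0..1} f"
  shows "concave_on {0..1} (J f)"
proof -
  have "concave_on {0..1} (\<lambda>p. INF t\<in>{0<..}. J0 f p t)"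
    using J0_ge_d[OF f] d by (intro concave_INF J0_concave assms) (auto intro: order_trans[of 0 d])
  from concave_min[OF F_concave this] show ?thesis by (simp add: J_def[abs_def])
qed

lemma J_in_FF:
  assumes f: "f \<in> FF" and conc: "concave_on {0..1} f"
  shows "J f \<in> FF"
proof -
  have "0 \<le> J f p" "J f p \<le> 1 - p" if "0 \<le> p" "p \<le> 1" for p
  proof -
    show "0 \<le> J f p" using that F_bounds(1)[OF that] J0_ge_d[OF f that] d
      by (intro J_greatest) (auto intro: order_trans[of 0 d])
    show "J f p \<le> 1 - p" using J_le(1)[OF f that] F_bounds(2)[OF that] by linarith
  qed
  then show ?thesis unfolding FF_def using concave_measurable[OF J_concave[OF assms]] by fastforce
qed

text \<open>The iterates, with the operator in its density form; they agree with \<open>J_iter\<close> on \<open>[0,1]\<close>.\<close>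

primrec iter :: "nat \<Rightarrow> real \<Rightarrow> real" where
  "iter 0 = F_fun lam c"
| "iter (Suc n) = J (iter n)"

text \<open>Membership in \<open>FF\<close> alone would not survive the induction: it is concavity that makes the infimum in the
  next step measurable.\<close>

lemma iter_FF: "iter n \<in> FF \<and> concave_on {0..1} (iter n)"
  by (induction n) (auto simp: F_in_FF F_concave J_in_FF J_concave)

lemmas iter_in_FF = iter_FF[THEN conjunct1] and iter_concave = iter_FF[THEN conjunct2]

lemma iter_decreasing: "0 \<le> p \<Longrightarrow> p \<le> 1 \<Longrightarrow> iter (Suc n) p \<le> iter n p"
proof (induction n arbitrary: p)
  case 0 then show ?case using J_le(1)[OF F_in_FF] by simp
next
  case (Suc n)
  show ?case unfolding iter.simps(2)[of "Suc n"] iter.simps(2)[of n]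
    using J_mono[OF iter_in_FF[of "Suc n"] iter_in_FF[of n] Suc.prems Suc.IH] by simp
qed

lemma iter_decseq: "0 \<le> p \<Longrightarrow> p \<le> 1 \<Longrightarrow> decseq (\<lambda>n. iter n p)"
  using iter_decreasing by (intro decseq_SucI)

definition iter_lim :: "real \<Rightarrow> real" where
  "iter_lim p = lim (\<lambda>n. iter n p)"

lemma iter_tendsto:
  assumes "0 \<le> p" "p \<le> 1"
  shows "(\<lambda>n. iter n p) \<longlonglongrightarrow> iter_lim p"
proof -
  have "\<And>n. 0 \<le> iter n p" using FF_bounds[OF iter_in_FF assms] by simp
  then obtain L where "(\<lambda>n. iter n p) \<longlonglongrightarrow> L"
    using decseq_convergent[OF iter_decseq[OF assms], of 0] by blast
  then show ?thesis unfolding iter_lim_def using limI by blast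
qed

lemma iter_lim_le: "0 \<le> p \<Longrightarrow> p \<le> 1 \<Longrightarrow> iter_lim p \<le> iter n p"
  by (rule decseq_ge[OF iter_decseq iter_tendsto])

lemma iter_lim_in_FF: "iter_lim \<in> FF"
proof -
  have "iter_lim \<in> borel_measurable (restrict_space borel {0..1})"
  proof (rule borel_measurable_LIMSEQ_real)
    show "(\<lambda>n. iter n p) \<longlonglongrightarrow> iter_lim p" if "p \<in> space (restrict_space borel {0..1})" for p
      using that by (intro iter_tendsto) (auto simp: space_restrict_space)
    show "iter n \<in> borel_measurable (restrict_space borel {0..1})" for n
      using iter_in_FF[of n] unfolding FF_def by auto
  qed
  moreover have "0 \<le> iter_lim p" "iter_lim p \<le> 1 - p" if "0 \<le> p" "p \<le> 1" for p
  proof -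
    show "0 \<le> iter_lim p" using FF_bounds[OF iter_in_FF that]
      by (intro LIMSEQ_le_const[OF iter_tendsto[OF that]]) auto
    show "iter_lim p \<le> 1 - p" using iter_lim_le[OF that, of 0] FF_bounds[OF iter_in_FF[of 0] that] by linarith
  qed
  ultimately show ?thesis unfolding FF_def by fastforce
qed

lemma next_value_tendsto:
  assumes p: "0 \<le> p" "p \<le> 1" and t: "0 < t"
  shows "(\<lambda>n. next_value (iter n) p t) \<longlonglongrightarrow> next_value iter_lim p t"
proof -
  note pb = posterior_bounds[OF lam p, of \<alpha> t]
  have ob: "0 \<le> obs_density lam \<alpha> t p y" for y using density_bounds(2)[OF lam p t, of \<alpha> y] by simp
  have b: "\<bar>iter n (posterior lam \<alpha> t p y)\<bar> \<le> 1" for n y using FF_bounds[OF iter_in_FF pb, of n y] by auto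
  have "integrable lborel (obs_density lam \<alpha> t p)"
    using obs_density_integral[OF lam p t, of \<alpha>] ob by (intro integrableI_nonneg) auto
  then show ?thesis unfolding next_value_def
    using mult_left_mono[OF b ob] ob
    by (intro integral_dominated_convergence[where w="obs_density lam \<alpha> t p"]
          borel_measurable_integrable next_value_integrable(1) iter_in_FF iter_lim_in_FF p t
          AE_I2 tendsto_intros iter_tendsto pb)
       (auto simp: abs_mult)
qed

text \<open>For \<open>\<ge>\<close>, dominated convergence is applied for each fixed \<open>t\<close>; the infimum over \<open>t\<close> is taken only
  afterwards.\<close>

lemma iter_lim_fixed:
  assumes p: "0 \<le> p" "p \<le> 1"
  shows "J iter_lim p = iter_lim p"
proof (rule antisym)
  show "J iter_lim p \<le> iter_lim p"
  proof (rule LIMSEQ_le_const[OF LIMSEQ_Suc[OF iter_tendsto[OF p]]], intro exI allI impI)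
    fix n
    show "J iter_lim p \<le> iter (Suc n) p"
      unfolding iter.simps(2) by (intro J_mono iter_lim_in_FF iter_in_FF p iter_lim_le)
  qed
  show "iter_lim p \<le> J iter_lim p"
  proof (rule J_greatest)
    show "iter_lim p \<le> F_fun lam c p" using iter_lim_le[OF p, of 0] by simp
    fix t :: real assume t: "0 < t"
    have "(\<lambda>n. J0 (iter n) p t) \<longlonglongrightarrow> J0 iter_lim p t"
      unfolding J0_def by (intro tendsto_intros next_value_tendsto p t)
    then show "iter_lim p \<le> J0 iter_lim p t"
    proof (rule LIMSEQ_le_const, intro exI allI impI)
      fix n show "iter_lim p \<le> J0 (iter n) p t"
        using iter_lim_le[OF p, of "Suc n"] J_le(2)[OF iter_in_FF p t, of n] by simp
    qed
  qed
qed

text \<open>Where \<open>g\<close> equals \<open>F\<close> there is nothing to do, since all iterates lie below \<open>F\<close>. Elsewhere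
  \<open>g\<close> is the infimum of \<open>J0 g\<close>. The value \<open>J0 ((1 + \<kappa>) g)\<close> falls short of \<open>(1 + \<kappa>) J0 g\<close> by \<open>\<kappa>\<close> times the
  sum of observation fee and delay cost, hence by at least \<open>\<kappa> b g\<close>. The minimum with \<open>1/2\<close> keeps \<open>1 - b\<close>
  positive. The induction starts because \<open>g\<close> is at least \<open>min(F, d)\<close> and \<open>F \<le> 1\<close>.\<close>

lemma iter_le_multiple:
  assumes g: "g \<in> FF" and fix_g: "\<And>p. 0 \<le> p \<Longrightarrow> p \<le> 1 \<Longrightarrow> J g p = g p"
  defines "b \<equiv> min d (1 / 2)"
  shows "0 \<le> p \<Longrightarrow> p \<le> 1 \<Longrightarrow> iter n p \<le> (1 + (1 - b) ^ n / b) * g p"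
proof (induction n arbitrary: p)
  case 0
  note p = 0
  have b: "0 < b" "b \<le> d" "b < 1" using d unfolding b_def by auto
  have F: "0 \<le> F_fun lam c p" "F_fun lam c p \<le> 1" using F_bounds[OF p] p by auto
  have "b * F_fun lam c p \<le> J g p"
  proof (rule J_greatest)
    show "b * F_fun lam c p \<le> F_fun lam c p" using F b by (intro mult_left_le_one_le) auto
    show "b * F_fun lam c p \<le> J0 g p t" if "0 < t" for t
    proof -
      have "b * F_fun lam c p \<le> d * 1" using F b d by (intro mult_mono) auto
      then show ?thesis using J0_ge_d[OF g p that] by simp
    qed
  qed
  then have "F_fun lam c p \<le> g p / b" using b fix_g[OF p] by (simp add: field_simps)
  then show ?case using FF_bounds[OF g p] b by (simp add: distrib_right)
next
  case (Suc n)
  note p = Suc.prems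
  have b: "0 < b" "b \<le> d" "b < 1" using d unfolding b_def by auto
  let ?k = "(1 - b) ^ n / b"
  have k: "0 \<le> ?k" using b by simp
  have g01: "0 \<le> g p" "g p \<le> 1" using FF_bounds[OF g p] by auto
  have kS: "(1 - b) ^ Suc n / b = ?k - b * ?k" using b by (simp add: field_simps)
  have bk: "0 \<le> ?k - b * ?k" using b unfolding kS[symmetric] by simp
  let ?K' = "1 + (1 - b) ^ Suc n / b"
  show ?case
  proof (cases "g p = F_fun lam c p")
    case True
    have "iter (Suc n) p \<le> g p" using J_le(1)[OF iter_in_FF p, of n] True by simp
    also have "\<dots> \<le> ?K' * g p" using bk g01 unfolding kS by (simp add: distrib_right mult_nonneg_nonneg)
    finally show ?thesis .
  next
    case False
    then have gi: "g p = (INF t\<in>{0<..}. J0 g p t)"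
      using fix_g[OF p] unfolding J_def by (auto simp: min_def split: if_splits)
    have "iter (Suc n) p + ?k * b * g p \<le> (1 + ?k) * J0 g p t" if t: "0 < t" for t
    proof -
      have "iter (Suc n) p \<le> d + next_value (iter n) p t + delay_cost p t"
        using J_le(2)[OF iter_in_FF p t, of n] by (simp add: J0_def)
      also have "next_value (iter n) p t \<le> (1 + ?k) * next_value g p t"
        by (intro next_value_mono iter_in_FF g p t Suc.IH)
      finally have 1: "iter (Suc n) p \<le> d + (1 + ?k) * next_value g p t + delay_cost p t" by simp
      have 2: "0 \<le> ?k * delay_cost p t" using k delay_cost_nonneg[OF p, of t] t by (intro mult_nonneg_nonneg) auto
      have "b * g p \<le> d * 1" using b g01 by (intro mult_mono) auto
      then have "?k * (b * g p) \<le> ?k * d" using k by (intro mult_left_mono) auto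
      then have 3: "?k * b * g p \<le> ?k * d" by (simp only: mult.assoc)
      have "(1 + ?k) * J0 g p t = d + (1 + ?k) * next_value g p t + delay_cost p t + ?k * d + ?k * delay_cost p t"
        unfolding J0_def by (simp only: distrib_left distrib_right mult_1_left add_ac)
      then show ?thesis using 1 2 3 by linarith
    qed
    then have "(iter (Suc n) p + ?k * b * g p) / (1 + ?k) \<le> J0 g p t" if "0 < t" for t
      using that k by (subst pos_divide_le_eq) (auto simp: mult.commute)
    then have "(iter (Suc n) p + ?k * b * g p) / (1 + ?k) \<le> g p"
      unfolding gi by (intro cINF_greatest) auto
    then have "iter (Suc n) p + ?k * b * g p \<le> g p * (1 + ?k)"
      using k by (subst (asm) pos_divide_le_eq) auto
    then show ?thesis unfolding kS by (simp add: algebra_simps)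
  qed
qed

lemma fixed_point_unique:
  assumes g: "g \<in> FF" and fix_g: "\<And>p. 0 \<le> p \<Longrightarrow> p \<le> 1 \<Longrightarrow> J g p = g p"
    and p: "0 \<le> p" "p \<le> 1"
  shows "g p = iter_lim p"
proof (rule antisym)
  have "g p \<le> iter n p" if "0 \<le> p" "p \<le> 1" for n p using that
  proof (induction n arbitrary: p)
    case 0 then show ?case using J_le(1)[OF g 0] fix_g[OF 0] by simp
  next
    case (Suc n)
    then show ?case using J_mono[OF g iter_in_FF Suc.prems Suc.IH] fix_g[OF Suc.prems] by simp
  qed
  then show "g p \<le> iter_lim p" using p by (intro LIMSEQ_le_const[OF iter_tendsto[OF p]]) auto
  define b where "b = min d (1 / 2)"
  have b: "0 < b" "b < 1" using d unfolding b_def by auto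
  have "(\<lambda>n. (1 + (1 - b) ^ n / b) * g p) \<longlonglongrightarrow> (1 + 0 / b) * g p"
    using b by (intro tendsto_intros LIMSEQ_realpow_zero) auto
  then show "iter_lim p \<le> g p"
    using LIMSEQ_le[OF iter_tendsto[OF p]] iter_le_multiple[OF g fix_g p] unfolding b_def by fastforce
qed

end


section \<open>Brownian increments after random times\<close>

definition dyadics :: "real set" where
  "dyadics = {s. \<exists>m i. s = real i / 2 ^ m}"

text \<open>The next dyadic number of level \<open>m\<close> that is strictly above \<open>x\<close>. Strictness matters: on the event that
  a random time is rounded to \<open>q\<close>, the time itself is \<open>< q\<close>, and so the event belongs to the past of \<open>q\<close>.\<close>

definition dyadic_above :: "nat \<Rightarrow> real \<Rightarrow> real" where
  "dyadic_above m x = real (Suc (nat \<lfloor>2 ^ m * x\<rfloor>)) / 2 ^ m"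

lemma dyadic_above_in: "dyadic_above m x \<in> dyadics"
  unfolding dyadics_def dyadic_above_def by blast

lemma dyadics_nonneg: "s \<in> dyadics \<Longrightarrow> 0 \<le> s" unfolding dyadics_def by auto

lemma dyadic_above_bounds:
  assumes "0 \<le> x"
  shows "x < dyadic_above m x" "dyadic_above m x \<le> x + 1 / 2 ^ m"
proof -
  have n: "real (nat \<lfloor>2 ^ m * x\<rfloor>) = of_int \<lfloor>2 ^ m * x\<rfloor>" using assms by simp
  have "2 ^ m * x < of_int \<lfloor>2 ^ m * x\<rfloor> + 1" "of_int \<lfloor>2 ^ m * x\<rfloor> \<le> 2 ^ m * x" by linarith+
  then show "x < dyadic_above m x" "dyadic_above m x \<le> x + 1 / 2 ^ m"
    unfolding dyadic_above_def of_nat_Suc n by (auto simp: field_simps)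
qed

lemma dyadic_above_tendsto:
  assumes "0 \<le> x"
  shows "(\<lambda>m. dyadic_above m x) \<longlonglongrightarrow> x"
proof (rule tendsto_sandwich[of "\<lambda>_. x" _ _ "\<lambda>m. x + 1 / 2 ^ m"])
  have "(\<lambda>m. x + (1 / 2) ^ m) \<longlonglongrightarrow> x + 0" by (intro tendsto_intros LIMSEQ_realpow_zero) auto
  then show "(\<lambda>m. x + 1 / 2 ^ m) \<longlonglongrightarrow> x" by (simp add: power_one_over)
  show "\<forall>\<^sub>F m in sequentially. x \<le> dyadic_above m x" "\<forall>\<^sub>F m in sequentially. dyadic_above m x \<le> x + 1 / 2 ^ m"
    using dyadic_above_bounds[OF assms] by (auto intro!: eventuallyI less_imp_le)
qed simp

lemma common_dyadic_level:
  "finite K \<Longrightarrow> K \<subseteq> dyadics \<Longrightarrow> \<exists>m. \<forall>s\<in>K. \<exists>i. s = real i / 2 ^ m"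
proof (induction K rule: finite_induct)
  case (insert s K)
  then obtain m where m: "\<And>s. s \<in> K \<Longrightarrow> \<exists>i. s = real i / 2 ^ m" by auto
  obtain l j where j: "s = real j / 2 ^ l" using insert.prems unfolding dyadics_def by auto
  have *: "real i / 2 ^ k = real (i * 2 ^ l') / 2 ^ (k + l')" for i k l' :: nat by (simp add: power_add)
  show ?case
  proof (rule exI[of _ "m + l"], rule ballI)
    fix r assume "r \<in> insert s K"
    then consider "r = s" | "r \<in> K" by auto
    then show "\<exists>i. r = real i / 2 ^ (m + l)"
    proof cases
      case 1 then show ?thesis using j *[of j l m] by (metis add.commute)
    next
      case 2 then show ?thesis using m[OF 2] * by metis
    qed
  qed
qed simp

abbreviation std_normal :: "real measure" where
  "std_normal \<equiv> density lborel (\<lambda>x. ennreal (std_normal_density x))"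

text \<open>One measure \<open>P \<pi>\<close> of the family, called \<open>Q\<close>, with \<open>p0\<close> for \<open>\<pi>\<close>.\<close>

locale detection_model = detection_params lam c d \<alpha> + prob_space Q
  for lam c d \<alpha> :: real and Q :: "'a measure" +
  fixes W :: "real \<Rightarrow> 'a \<Rightarrow> real" and \<Theta> :: "'a \<Rightarrow> real" and p0 :: real
  assumes W_measurable: "0 \<le> t \<Longrightarrow> W t \<in> borel_measurable Q"
    and W_continuous: "\<omega> \<in> space Q \<Longrightarrow> continuous_on {0..} (\<lambda>t. W t \<omega>)"
    and W_zero: "AE \<omega> in Q. W 0 \<omega> = 0"
    and W_increment: "0 \<le> s \<Longrightarrow> s < t \<Longrightarrow>
        distributed Q lborel (\<lambda>\<omega>. W t \<omega> - W s \<omega>) (normal_density 0 (sqrt (t - s)))"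
    and W_indep: "0 \<le> r 0 \<Longrightarrow> (\<And>i::nat. i < n \<Longrightarrow> r i < r (Suc i)) \<Longrightarrow>
        indep_vars (\<lambda>_. borel) (\<lambda>i \<omega>. W (r (Suc i)) \<omega> - W (r i) \<omega>) {..<n}"
    and \<Theta>_measurable [measurable]: "\<Theta> \<in> borel_measurable Q"
    and \<Theta>_nonneg: "\<omega> \<in> space Q \<Longrightarrow> 0 \<le> \<Theta> \<omega>"
    and \<Theta>_W_indep: "indep_set (sets (vimage_algebra (space Q) \<Theta> borel))
          (sets (vimage_algebra (space Q) (\<lambda>\<omega>. \<lambda>t\<in>{0..}. W t \<omega>) (\<Pi>\<^sub>M t\<in>{0..}. borel)))"
    and p0: "0 \<le> p0" "p0 \<le> 1"
    and \<Theta>_zero: "prob {\<omega>\<in>space Q. \<Theta> \<omega> = 0} = p0"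
    and \<Theta>_tail: "0 \<le> t \<Longrightarrow> prob {\<omega>\<in>space Q. t < \<Theta> \<omega>} = (1 - p0) * exp (- lam * t)"
begin

abbreviation X :: "real \<Rightarrow> 'a \<Rightarrow> real" where "X \<equiv> obs_process \<alpha> W \<Theta>"

text \<open>The past at time \<open>q\<close> contains the change time itself, so that its independence of later increments covers
  the joint law of noise and change time. Only dyadic times enter: finitely many of them lie on a
  common grid, where the independence of increments applies, and path continuity recovers the others.\<close>

definition past_gen :: "real \<Rightarrow> 'a set set" where
  "past_gen q = {A. \<exists>B0\<in>sets borel. \<exists>K B. finite K \<and> K \<subseteq> dyadics \<inter> {..q} \<and> (\<forall>s. B s \<in> sets borel) \<and>
     A = {\<omega>\<in>space Q. \<Theta> \<omega> \<in> B0 \<and> (\<forall>s\<in>K. W s \<omega> \<in> B s)}}"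

definition past :: "real \<Rightarrow> 'a measure" where
  "past q = sigma (space Q) (past_gen q)"

lemma past_gen_events: "past_gen q \<subseteq> sets Q"
proof
  fix A assume "A \<in> past_gen q"
  then obtain B0 K B where A: "B0 \<in> sets borel" "finite K" "K \<subseteq> dyadics \<inter> {..q}" "\<And>s. B s \<in> sets borel"
     "A = {\<omega>\<in>space Q. \<Theta> \<omega> \<in> B0 \<and> (\<forall>s\<in>K. W s \<omega> \<in> B s)}" unfolding past_gen_def by auto
  have "{\<omega>\<in>space Q. W s \<omega> \<in> B s} \<in> sets Q" if "s \<in> K" for s
    using measurable_sets[OF W_measurable A(4), of s s] that A(3) dyadics_nonneg
    by (auto simp: vimage_def Int_def conj_commute)
  then have "{\<omega>\<in>space Q. \<forall>s\<in>K. W s \<omega> \<in> B s} \<in> sets Q"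
    using A(2) by (intro sets.sets_Collect_finite_All) auto
  moreover have "{\<omega>\<in>space Q. \<Theta> \<omega> \<in> B0} \<in> sets Q" using A(1) by measurable
  ultimately show "A \<in> sets Q" unfolding A(5) by (rule sets.sets_Collect_conj)
qed

lemma space_past [simp]: "space (past q) = space Q"
  unfolding past_def using past_gen_events sets.space_closed by (intro space_measure_of) blast

lemma sets_past: "sets (past q) = sigma_sets (space Q) (past_gen q)"
  unfolding past_def using past_gen_events sets.space_closed by (intro sets_measure_of) blast

lemma past_subset: "sets (past q) \<subseteq> sets Q"
  unfolding sets_past using past_gen_events by (rule sets.sigma_sets_subset)

lemma past_W: "s \<in> dyadics \<Longrightarrow> s \<le> q \<Longrightarrow> W s \<in> borel_measurable (past q)"
proof (rule measurableI)
  fix B :: "real set" assume s: "s \<in> dyadics" "s \<le> q" and B: "B \<in> sets borel"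
  have "W s -` B \<inter> space (past q) = {\<omega>\<in>space Q. \<Theta> \<omega> \<in> UNIV \<and> (\<forall>r\<in>{s}. W r \<omega> \<in> (\<lambda>_. B) r)}" by auto
  also have "\<dots> \<in> past_gen q" unfolding past_gen_def using s B
    by (intro CollectI bexI[of _ UNIV] exI[of _ "{s}"] exI[of _ "\<lambda>_. B"]) auto
  finally show "W s -` B \<inter> space (past q) \<in> sets (past q)" unfolding sets_past by (rule sigma_sets.Basic)
qed simp

lemma past_\<Theta>: "\<Theta> \<in> borel_measurable (past q)"
proof (rule measurableI)
  fix B :: "real set" assume B: "B \<in> sets borel"
  have "\<Theta> -` B \<inter> space (past q) = {\<omega>\<in>space Q. \<Theta> \<omega> \<in> B \<and> (\<forall>r\<in>{}. W r \<omega> \<in> (\<lambda>_. UNIV) r)}" by auto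
  also have "\<dots> \<in> past_gen q" unfolding past_gen_def using B
    by (intro CollectI bexI[of _ B] exI[of _ "{}"] exI[of _ "\<lambda>_. UNIV"]) auto
  finally show "\<Theta> -` B \<inter> space (past q) \<in> sets (past q)" unfolding sets_past by (rule sigma_sets.Basic)
qed simp

lemma past_gen_Int_stable: "Int_stable (past_gen q)"
proof (rule Int_stableI)
  fix A A' assume "A \<in> past_gen q" "A' \<in> past_gen q"
  from \<open>A \<in> past_gen q\<close> obtain B0 K B where A: "B0 \<in> sets borel" "finite K" "K \<subseteq> dyadics \<inter> {..q}" "\<And>s. B s \<in> sets borel"
     "A = {\<omega>\<in>space Q. \<Theta> \<omega> \<in> B0 \<and> (\<forall>s\<in>K. W s \<omega> \<in> B s)}" unfolding past_gen_def by auto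
  from \<open>A' \<in> past_gen q\<close> obtain B0' K' B' where A': "B0' \<in> sets borel" "finite K'" "K' \<subseteq> dyadics \<inter> {..q}" "\<And>s. B' s \<in> sets borel"
     "A' = {\<omega>\<in>space Q. \<Theta> \<omega> \<in> B0' \<and> (\<forall>s\<in>K'. W s \<omega> \<in> B' s)}" unfolding past_gen_def by auto
  define B'' where "B'' s = (if s \<in> K then B s else UNIV) \<inter> (if s \<in> K' then B' s else UNIV)" for s
  have "A \<inter> A' = {\<omega>\<in>space Q. \<Theta> \<omega> \<in> B0 \<inter> B0' \<and> (\<forall>s\<in>K \<union> K'. W s \<omega> \<in> B'' s)}"
    unfolding A A' B''_def by auto
  moreover have "B'' s \<in> sets borel" for s unfolding B''_def using A A' by auto
  ultimately show "A \<inter> A' \<in> past_gen q"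
    unfolding past_gen_def using A A' by (intro CollectI bexI[of _ "B0 \<inter> B0'"] exI[of _ "K \<union> K'"] exI[of _ B'']) auto
qed

text \<open>On a common dyadic grid the values up to \<open>q\<close> are sums of the grid increments before \<open>q\<close> (as the path starts
  almost surely in 0), and the increment from \<open>q\<close> to \<open>q'\<close> is the sum of those after \<open>q\<close>.\<close>

lemma cylinder_increment_indep:
  assumes K: "finite K" "K \<subseteq> dyadics \<inter> {..q}" and B [measurable]: "\<And>s. B s \<in> sets borel"
    and q: "q \<in> dyadics" "q' \<in> dyadics" "q < q'" and C [measurable]: "C \<in> sets borel"
  shows "prob {\<omega>\<in>space Q. (\<forall>s\<in>K. W s \<omega> \<in> B s) \<and> W q' \<omega> - W q \<omega> \<in> C}
    = prob {\<omega>\<in>space Q. \<forall>s\<in>K. W s \<omega> \<in> B s} * prob {\<omega>\<in>space Q. W q' \<omega> - W q \<omega> \<in> C}"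
proof -
  have "\<exists>m. \<forall>s\<in>insert q (insert q' K). \<exists>i. s = real i / 2 ^ m"
    by (rule common_dyadic_level) (use K q in auto)
  then obtain m where "\<forall>s\<in>insert q (insert q' K). \<exists>i. s = real i / 2 ^ m" ..
  then have m: "\<And>s. s \<in> insert q (insert q' K) \<Longrightarrow> \<exists>i. s = real i / 2 ^ m" by blast
  define g :: "nat \<Rightarrow> real" where "g i = real i / 2 ^ m" for i
  obtain n n' where n: "q = g n" "q' = g n'" using m[of q] m[of q'] unfolding g_def by auto
  have g_less: "g i < g j \<longleftrightarrow> i < j" for i j unfolding g_def by (simp add: divide_less_cancel)
  have g_le: "g i \<le> g j \<longleftrightarrow> i \<le> j" for i j unfolding g_def by (simp add: divide_le_cancel)
  have nn: "n < n'" using q(3) n g_less by simp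
  have "\<forall>s\<in>K. \<exists>i. s = g i" using m unfolding g_def by blast
  then obtain ix where ix: "\<And>s. s \<in> K \<Longrightarrow> s = g (ix s)" by metis
  have ixn: "ix s \<le> n" if "s \<in> K" for s
  proof -
    have "s \<le> q" using K(2) that by auto
    then have "g (ix s) \<le> g n" by (simp only: ix[OF that, symmetric] n(1)[symmetric])
    then show ?thesis by (simp only: g_le)
  qed
  define Y where "Y i \<omega> = W (g (Suc i)) \<omega> - W (g i) \<omega>" for i \<omega>
  have ind: "indep_vars (\<lambda>_. borel) Y {..<n'}"
    unfolding Y_def[abs_def] by (rule W_indep) (auto simp: g_less, simp add: g_def)
  have iv: "indep_var (PiM {..<n} (\<lambda>_. borel)) (\<lambda>\<omega>. restrict (\<lambda>i. Y i \<omega>) {..<n})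
       (PiM {n..<n'} (\<lambda>_. borel)) (\<lambda>\<omega>. restrict (\<lambda>i. Y i \<omega>) {n..<n'})"
    using nn by (intro indep_var_restrict[OF ind]) auto
  define E1 where "E1 = {x\<in>space (PiM {..<n} (\<lambda>_. borel)). \<forall>s\<in>K. (\<Sum>i<ix s. x i) \<in> B s}"
  define E2 where "E2 = {x\<in>space (PiM {n..<n'} (\<lambda>_. borel)). (\<Sum>i\<in>{n..<n'}. x i) \<in> C}"
  have E1: "E1 \<in> sets (PiM {..<n} (\<lambda>_. borel :: real measure))"
    unfolding E1_def
  proof (rule sets.sets_Collect_finite_All[OF _ K(1)])
    fix s assume s: "s \<in> K"
    have [measurable]: "(\<lambda>x. \<Sum>i<ix s. x i) \<in> borel_measurable (PiM {..<n} (\<lambda>_. borel :: real measure))"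
      using ixn[OF s] by (intro borel_measurable_sum measurable_component_singleton) auto
    show "{x\<in>space (PiM {..<n} (\<lambda>_. borel :: real measure)). (\<Sum>i<ix s. x i) \<in> B s} \<in> sets (PiM {..<n} (\<lambda>_. borel))"
      by measurable
  qed
  have E2: "E2 \<in> sets (PiM {n..<n'} (\<lambda>_. borel :: real measure))"
    unfolding E2_def by measurable
  have tel: "(\<Sum>i<j. Y i \<omega>) = W (g j) \<omega> - W 0 \<omega>" for j :: nat and \<omega>
    unfolding Y_def using sum_lessThan_telescope[of "\<lambda>i. W (g i) \<omega>" j] by (simp add: g_def)
  have tel2: "(\<Sum>i\<in>{n..<n'}. Y i \<omega>) = W q' \<omega> - W q \<omega>" for \<omega>
    unfolding Y_def n using nn by (subst sum_Suc_diff') auto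
  let ?R1 = "\<lambda>\<omega>. restrict (\<lambda>i. Y i \<omega>) {..<n}" and ?R2 = "\<lambda>\<omega>. restrict (\<lambda>i. Y i \<omega>) {n..<n'}"
  have r1: "?R1 \<omega> \<in> E1 \<longleftrightarrow> (\<forall>s\<in>K. W s \<omega> - W 0 \<omega> \<in> B s)" for \<omega>
  proof -
    have "(\<Sum>i<ix s. ?R1 \<omega> i) = W s \<omega> - W 0 \<omega>" if "s \<in> K" for s
    proof -
      have "(\<Sum>i<ix s. ?R1 \<omega> i) = (\<Sum>i<ix s. Y i \<omega>)" using ixn[OF that] by (intro sum.cong) auto
      then show ?thesis using tel[of \<omega> "ix s"] by (simp only: ix[OF that, symmetric])
    qed
    then show ?thesis unfolding E1_def by (auto simp: space_PiM)
  qed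
  have r2: "?R2 \<omega> \<in> E2 \<longleftrightarrow> W q' \<omega> - W q \<omega> \<in> C" for \<omega>
    unfolding E2_def using tel2[of \<omega>] by (auto simp: space_PiM)
  have eq: "prob {\<omega>\<in>space Q. (\<forall>s\<in>K. W s \<omega> - W 0 \<omega> \<in> B s) \<and> W q' \<omega> - W q \<omega> \<in> C}
    = prob {\<omega>\<in>space Q. \<forall>s\<in>K. W s \<omega> - W 0 \<omega> \<in> B s} * prob {\<omega>\<in>space Q. W q' \<omega> - W q \<omega> \<in> C}"
  proof -
    have "(\<lambda>\<omega>. (?R1 \<omega>, ?R2 \<omega>)) -` (E1 \<times> E2) \<inter> space Q = {\<omega>\<in>space Q. (\<forall>s\<in>K. W s \<omega> - W 0 \<omega> \<in> B s) \<and> W q' \<omega> - W q \<omega> \<in> C}"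
      "?R1 -` E1 \<inter> space Q = {\<omega>\<in>space Q. \<forall>s\<in>K. W s \<omega> - W 0 \<omega> \<in> B s}"
      "?R2 -` E2 \<inter> space Q = {\<omega>\<in>space Q. W q' \<omega> - W q \<omega> \<in> C}"
      using r1 r2 by auto
    with indep_varD[OF iv E1 E2] show ?thesis by simp
  qed
  have W_m: "W s \<in> borel_measurable Q" if "s \<in> insert 0 (insert q (insert q' K))" for s
    using that K(2) q dyadics_nonneg by (intro W_measurable) auto
  note [measurable] = W_m[of 0, simplified] W_m[of q, simplified] W_m[of q', simplified]
  have Wd: "(\<lambda>\<omega>. W s \<omega> - W 0 \<omega>) \<in> borel_measurable Q" if "s \<in> K" for s
    using W_m[of s] that by auto
  have s1: "{\<omega>\<in>space Q. \<forall>s\<in>K. W s \<omega> - W 0 \<omega> \<in> B s} \<in> sets Q"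
  proof (rule sets.sets_Collect_finite_All[OF _ K(1)])
    fix s assume "s \<in> K"
    note [measurable] = Wd[OF this]
    show "{\<omega>\<in>space Q. W s \<omega> - W 0 \<omega> \<in> B s} \<in> sets Q" by measurable
  qed
  have s2: "{\<omega>\<in>space Q. \<forall>s\<in>K. W s \<omega> \<in> B s} \<in> sets Q"
  proof (rule sets.sets_Collect_finite_All[OF _ K(1)])
    fix s assume "s \<in> K"
    then have [measurable]: "W s \<in> borel_measurable Q" using W_m by auto
    show "{\<omega>\<in>space Q. W s \<omega> \<in> B s} \<in> sets Q" by measurable
  qed
  have s3: "{\<omega>\<in>space Q. W q' \<omega> - W q \<omega> \<in> C} \<in> sets Q" by measurable
  have "prob {\<omega>\<in>space Q. \<forall>s\<in>K. W s \<omega> - W 0 \<omega> \<in> B s} = prob {\<omega>\<in>space Q. \<forall>s\<in>K. W s \<omega> \<in> B s}"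
    using W_zero s1 s2 by (intro measure_eq_AE) auto
  moreover have "prob {\<omega>\<in>space Q. (\<forall>s\<in>K. W s \<omega> - W 0 \<omega> \<in> B s) \<and> W q' \<omega> - W q \<omega> \<in> C}
     = prob {\<omega>\<in>space Q. (\<forall>s\<in>K. W s \<omega> \<in> B s) \<and> W q' \<omega> - W q \<omega> \<in> C}"
    using W_zero sets.sets_Collect_conj[OF s3 s1] sets.sets_Collect_conj[OF s3 s2]
    by (intro measure_eq_AE) auto
  ultimately show ?thesis using eq by simp
qed

lemma past_increment_indep:
  assumes q: "q \<in> dyadics" "q' \<in> dyadics" "q < q'"
  shows "indep_set (sets (past q)) (sigma_sets (space Q) {{\<omega>\<in>space Q. W q' \<omega> - W q \<omega> \<in> C} | C. C \<in> sets borel})"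
  unfolding sets_past
proof (rule indep_set_sigma_sets[OF _ past_gen_Int_stable])
  have q0: "0 \<le> q" "0 \<le> q'" using q dyadics_nonneg by auto
  have [measurable]: "W q \<in> borel_measurable Q" "W q' \<in> borel_measurable Q"
    using W_measurable q0 by auto
  let ?I = "{{\<omega>\<in>space Q. W q' \<omega> - W q \<omega> \<in> C} | C. C \<in> sets borel}"
  show "Int_stable ?I"
  proof (rule Int_stableI)
    fix a b assume "a \<in> ?I" "b \<in> ?I"
    then obtain C C' where C: "C \<in> sets borel" "C' \<in> sets borel"
      "a = {\<omega>\<in>space Q. W q' \<omega> - W q \<omega> \<in> C}" "b = {\<omega>\<in>space Q. W q' \<omega> - W q \<omega> \<in> C'}" by auto
    show "a \<inter> b \<in> ?I" unfolding C using C by (intro CollectI exI[of _ "C \<inter> C'"]) auto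
  qed
  show "indep_set (past_gen q) ?I"
  proof (rule indep_setI)
    show "past_gen q \<subseteq> events" by (rule past_gen_events)
    show "?I \<subseteq> events" by auto
    fix A b assume "A \<in> past_gen q" "b \<in> ?I"
    then obtain B0 K B C where A: "B0 \<in> sets borel" "finite K" "K \<subseteq> dyadics \<inter> {..q}" "\<And>s. B s \<in> sets borel"
       "A = {\<omega>\<in>space Q. \<Theta> \<omega> \<in> B0 \<and> (\<forall>s\<in>K. W s \<omega> \<in> B s)}"
       and C: "C \<in> sets borel" "b = {\<omega>\<in>space Q. W q' \<omega> - W q \<omega> \<in> C}"
      unfolding past_gen_def by auto
    let ?V = "vimage_algebra (space Q) (\<lambda>\<omega>. \<lambda>t\<in>{0..}. W t \<omega>) (\<Pi>\<^sub>M t\<in>{0..}. borel)"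
    have Vm: "W t \<in> borel_measurable ?V" if "0 \<le> t" for t
    proof -
      have "(\<lambda>\<omega>. (\<lambda>t\<in>{0..}. W t \<omega>) t) \<in> borel_measurable ?V"
        using that by (intro measurable_compose[OF measurable_vimage_algebra1 measurable_component_singleton])
          (auto simp: space_PiM split: if_splits)
      then show ?thesis using that by simp
    qed
    have cy: "{\<omega>\<in>space ?V. \<forall>s\<in>K. W s \<omega> \<in> B s} \<in> sets ?V"
    proof (rule sets.sets_Collect_finite_All[OF _ A(2)])
      fix s assume "s \<in> K"
      then have [measurable]: "W s \<in> borel_measurable ?V" using A(3) dyadics_nonneg by (intro Vm) auto
      have [measurable]: "B s \<in> sets borel" by fact
      show "{\<omega>\<in>space ?V. W s \<omega> \<in> B s} \<in> sets ?V" by measurable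
    qed
    have in1: "{\<omega>\<in>space ?V. W q' \<omega> - W q \<omega> \<in> C} \<in> sets ?V"
    proof -
      note [measurable] = Vm[OF q0(1)] Vm[OF q0(2)] C(1)
      show ?thesis by measurable
    qed
    have th: "{\<omega>\<in>space Q. \<Theta> \<omega> \<in> B0} \<in> sets (vimage_algebra (space Q) \<Theta> borel)"
      using in_vimage_algebra[OF A(1), of \<Theta> "space Q"] by (simp add: vimage_def Int_def conj_commute)
    have cy2: "{\<omega>\<in>space ?V. (\<forall>s\<in>K. W s \<omega> \<in> B s) \<and> W q' \<omega> - W q \<omega> \<in> C} \<in> sets ?V"
      by (rule sets.sets_Collect_conj[OF in1 cy])
    let ?T = "{\<omega>\<in>space Q. \<Theta> \<omega> \<in> B0}" and ?C = "{\<omega>\<in>space Q. \<forall>s\<in>K. W s \<omega> \<in> B s}"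
    let ?CI = "{\<omega>\<in>space Q. (\<forall>s\<in>K. W s \<omega> \<in> B s) \<and> W q' \<omega> - W q \<omega> \<in> C}"
    have "A \<inter> b = ?T \<inter> ?CI" "A = ?T \<inter> ?C" unfolding A C by auto
    moreover have "prob (?T \<inter> ?CI) = prob ?T * prob ?CI" "prob (?T \<inter> ?C) = prob ?T * prob ?C"
      using indep_setD[OF \<Theta>_W_indep th cy2] indep_setD[OF \<Theta>_W_indep th cy] by auto
    moreover have "prob ?CI = prob ?C * prob b"
      unfolding C by (rule cylinder_increment_indep) (use A C q in auto)
    ultimately show "prob (A \<inter> b) = prob A * prob b" by simp
  qed
qed

lemma past_normalised_increment:
  assumes q: "q \<in> dyadics" "q' \<in> dyadics" "q < q'" and A: "A \<in> sets (past q)" and C [measurable]: "C \<in> sets borel"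
  shows "prob {\<omega>\<in>A. (W q' \<omega> - W q \<omega>) / sqrt (q' - q) \<in> C} = prob A * measure std_normal C"
proof -
  have q0: "0 \<le> q" "0 \<le> q'" using q dyadics_nonneg by auto
  have sA: "A \<subseteq> space Q" "A \<in> sets Q" using past_subset[of q] A sets.sets_into_space by auto
  have sp: "0 < sqrt (q' - q)" using q by simp
  let ?Z = "\<lambda>\<omega>. (W q' \<omega> - W q \<omega>) / sqrt (q' - q)"
  define C' where "C' = (\<lambda>x. x / sqrt (q' - q)) -` C \<inter> space borel"
  have C': "C' \<in> sets borel" unfolding C'_def by measurable
  have eq: "{\<omega>\<in>space Q. ?Z \<omega> \<in> C} = {\<omega>\<in>space Q. W q' \<omega> - W q \<omega> \<in> C'}" unfolding C'_def by auto
  have "prob (A \<inter> {\<omega>\<in>space Q. ?Z \<omega> \<in> C}) = prob A * prob {\<omega>\<in>space Q. ?Z \<omega> \<in> C}"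
    unfolding eq by (rule indep_setD[OF past_increment_indep[OF q] A]) (use C' in \<open>auto intro!: sigma_sets.Basic\<close>)
  moreover have "A \<inter> {\<omega>\<in>space Q. ?Z \<omega> \<in> C} = {\<omega>\<in>A. ?Z \<omega> \<in> C}" using sA by auto
  moreover have "prob {\<omega>\<in>space Q. ?Z \<omega> \<in> C} = measure std_normal C"
  proof -
    have "distributed Q lborel (\<lambda>\<omega>. (W q' \<omega> - W q \<omega> - 0) / sqrt (q' - q)) std_normal_density"
      using W_increment[OF q0(1) q(3)] by (subst normal_standard_normal_convert[OF sp, symmetric])
    then have Zd: "distributed Q lborel ?Z std_normal_density" by simp
    have "distr Q lborel ?Z = std_normal" using distributed_distr_eq_density[OF Zd] .
    moreover have "?Z \<in> measurable Q lborel" using distributed_measurable[OF Zd] .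
    ultimately have "measure std_normal C = prob (?Z -` C \<inter> space Q)"
      using measure_distr[of ?Z Q lborel C] by simp
    then show ?thesis by (simp add: vimage_def Int_def conj_commute)
  qed
  ultimately show ?thesis by simp
qed

text \<open>The path at the rounded times is measurable because these have countably many values, and it
  converges by continuity. Restricting the rounded times to a set \<open>T\<close> from some level on allows \<open>N\<close> to be the past
  of a time that \<open>\<rho>\<close> stays below.\<close>

lemma path_at_random_time_measurable:
  assumes sp: "space N \<subseteq> space Q" and T: "\<And>s. s \<in> T \<Longrightarrow> W s \<in> borel_measurable N"
    and \<rho> [measurable]: "\<rho> \<in> borel_measurable N" and pos: "\<And>\<omega>. \<omega> \<in> space N \<Longrightarrow> 0 \<le> \<rho> \<omega>"
    and ev: "\<And>\<omega>. \<omega> \<in> space N \<Longrightarrow> \<forall>\<^sub>F m in sequentially. dyadic_above m (\<rho> \<omega>) \<in> T"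
  shows "(\<lambda>\<omega>. W (\<rho> \<omega>) \<omega>) \<in> borel_measurable N"
proof (rule borel_measurable_LIMSEQ_real)
  define V where "V m i \<omega> = (if real (Suc i) / 2 ^ m \<in> T then W (real (Suc i) / 2 ^ m) \<omega> else 0)" for m i \<omega>
  have V: "V m i \<in> borel_measurable N" for m i
    unfolding V_def using T by (cases "real (Suc i) / 2 ^ m \<in> T") (simp_all add: fun_eq_iff)
  show "(\<lambda>\<omega>. V m (nat \<lfloor>2 ^ m * \<rho> \<omega>\<rfloor>) \<omega>) \<in> borel_measurable N" for m
    by (rule measurable_compose_countable[where f="V m"]) (use V in \<open>simp_all\<close>)
  fix \<omega> assume w: "\<omega> \<in> space N"
  have "continuous_on {0..} (\<lambda>t. W t \<omega>)" using W_continuous w sp by auto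
  then have "(\<lambda>m. W (dyadic_above m (\<rho> \<omega>)) \<omega>) \<longlonglongrightarrow> W (\<rho> \<omega>) \<omega>"
    using dyadic_above_tendsto[OF pos[OF w]]
    by (rule continuous_on_tendsto_compose) (auto intro!: eventuallyI dyadics_nonneg dyadic_above_in pos w)
  then show "(\<lambda>m. V m (nat \<lfloor>2 ^ m * \<rho> \<omega>\<rfloor>) \<omega>) \<longlonglongrightarrow> W (\<rho> \<omega>) \<omega>"
  proof (rule Lim_transform_eventually)
    show "\<forall>\<^sub>F m in sequentially. W (dyadic_above m (\<rho> \<omega>)) \<omega> = V m (nat \<lfloor>2 ^ m * \<rho> \<omega>\<rfloor>) \<omega>"
      using ev[OF w] by eventually_elim (simp add: V_def dyadic_above_def)
  qed
qed

lemma path_at_random_time: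
  assumes "\<rho> \<in> borel_measurable Q" "\<And>\<omega>. \<omega> \<in> space Q \<Longrightarrow> 0 \<le> \<rho> \<omega>"
  shows "(\<lambda>\<omega>. W (\<rho> \<omega>) \<omega>) \<in> borel_measurable Q"
proof (rule path_at_random_time_measurable[where T=dyadics])
  show "W s \<in> borel_measurable Q" if "s \<in> dyadics" for s using W_measurable dyadics_nonneg that by auto
qed (simp_all add: assms dyadic_above_in)

text \<open>The sigma-algebra \<open>G\<close> stands for what is known at the time \<open>\<sigma>\<close>, which the assumption \<open>past\<close>
  places in the past of every \<open>q > \<sigma>\<close>.
  Rounding \<open>\<sigma>\<close> and \<open>\<rho>\<close> up to dyadic times gives the statement exactly, by summing over their values (\<open>step1\<close>). In
  the limit Fatou's lemma gives an inequality for open sets (\<open>step2\<close>), which outer regularity extends to all Borel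
  sets (\<open>step3\<close>). Applied to a set and to its complement, the inequality becomes an equality. The increment
  is normalised so that its law does not depend on the random length \<open>\<rho> - \<sigma>\<close>.\<close>

lemma strong_markov_prob:
  assumes G: "space G = space Q" "sets G \<subseteq> sets Q" and A: "A \<in> sets G"
    and \<sigma> [measurable]: "\<sigma> \<in> borel_measurable G" and \<rho> [measurable]: "\<rho> \<in> borel_measurable G"
    and pos: "\<And>\<omega>. \<omega> \<in> space Q \<Longrightarrow> 0 \<le> \<sigma> \<omega>" "\<And>\<omega>. \<omega> \<in> space Q \<Longrightarrow> 0 \<le> \<rho> \<omega>"
    and less: "\<And>\<omega>. \<omega> \<in> A \<Longrightarrow> \<sigma> \<omega> < \<rho> \<omega>"
    and past: "\<And>A' q. A' \<in> sets G \<Longrightarrow> A' \<subseteq> A \<Longrightarrow> A' \<inter> {\<omega>\<in>space Q. \<sigma> \<omega> < q} \<in> sets (past q)"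
    and C: "C \<in> sets borel"
  shows "prob {\<omega>\<in>A. (W (\<rho> \<omega>) \<omega> - W (\<sigma> \<omega>) \<omega>) / sqrt (\<rho> \<omega> - \<sigma> \<omega>) \<in> C} = prob A * measure std_normal C"
proof -
  have AQ: "A \<in> sets Q" "A \<subseteq> space Q" using A G sets.sets_into_space[OF A] by auto
  have mQ: "f \<in> borel_measurable Q" if "f \<in> borel_measurable G" for f :: "'a \<Rightarrow> real"
    using that G by (auto simp: measurable_def)
  note [measurable] = mQ[OF \<sigma>] mQ[OF \<rho>]
  interpret N: prob_space std_normal by (rule prob_space_normal_density) simp
  have Ne: "N.prob B \<le> 1" "0 \<le> N.prob B" for B by auto
  define Z where "Z \<omega> = (W (\<rho> \<omega>) \<omega> - W (\<sigma> \<omega>) \<omega>) / sqrt (\<rho> \<omega> - \<sigma> \<omega>)" for \<omega>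
  define Zm where "Zm m \<omega> = (W (dyadic_above m (\<rho> \<omega>)) \<omega> - W (dyadic_above m (\<sigma> \<omega>)) \<omega>) /
      sqrt (dyadic_above m (\<rho> \<omega>) - dyadic_above m (\<sigma> \<omega>))" for m \<omega>
  have dm [measurable]: "(\<lambda>\<omega>. dyadic_above m (f \<omega>)) \<in> borel_measurable N" if [measurable]: "f \<in> borel_measurable N"
    for f m and N :: "'a measure" unfolding dyadic_above_def by measurable
  have [measurable]: "(\<lambda>\<omega>. W (\<rho> \<omega>) \<omega>) \<in> borel_measurable Q" "(\<lambda>\<omega>. W (\<sigma> \<omega>) \<omega>) \<in> borel_measurable Q"
    "(\<lambda>\<omega>. W (dyadic_above m (\<rho> \<omega>)) \<omega>) \<in> borel_measurable Q"
    "(\<lambda>\<omega>. W (dyadic_above m (\<sigma> \<omega>)) \<omega>) \<in> borel_measurable Q" for m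
    using pos dyadics_nonneg dyadic_above_in by (auto intro!: path_at_random_time)
  have [measurable]: "Z \<in> borel_measurable Q" "Zm m \<in> borel_measurable Q" for m
    unfolding Z_def[abs_def] Zm_def[abs_def] by measurable
  note [measurable] = AQ(1)
  \<comment> \<open>Both times may be rounded to the same value, which the event \<open>Am m\<close> excludes; every point of \<open>A\<close> lies in it from some level on.\<close>
  define Am where "Am m = {\<omega>\<in>A. dyadic_above m (\<sigma> \<omega>) < dyadic_above m (\<rho> \<omega>)}" for m
  have [measurable]: "Am m \<in> sets Q" for m
  proof -
    have "Am m = A \<inter> {\<omega>\<in>space Q. dyadic_above m (\<sigma> \<omega>) < dyadic_above m (\<rho> \<omega>)}" unfolding Am_def using AQ by auto
    also have "\<dots> \<in> sets Q" by measurable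
    finally show ?thesis .
  qed
  have set_m: "{\<omega>\<in>B. f \<omega> \<in> C} \<in> sets Q" if [measurable]: "B \<in> sets Q" "f \<in> borel_measurable Q" "C \<in> sets borel"
    for B C and f :: "'a \<Rightarrow> real"
  proof -
    have "{\<omega>\<in>B. f \<omega> \<in> C} = B \<inter> {\<omega>\<in>space Q. f \<omega> \<in> C}" using sets.sets_into_space[OF that(1)] by auto
    also have "\<dots> \<in> sets Q" by measurable
    finally show ?thesis .
  qed
  have step1: "prob {\<omega>\<in>Am m. Zm m \<omega> \<in> C} = prob (Am m) * N.prob C" if C [measurable]: "C \<in> sets borel" for m C
  proof -
    define I where "I = {(i, i'). i < (i'::nat)}"
    define Ai where "Ai = (\<lambda>(i, i'). {\<omega>\<in>A. nat \<lfloor>2 ^ m * \<sigma> \<omega>\<rfloor> = i \<and> nat \<lfloor>2 ^ m * \<rho> \<omega>\<rfloor> = i'})"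
    have AiG: "Ai z \<in> sets G" for z
    proof (cases z)
      case (Pair i i')
      have n1: "(\<lambda>\<omega>. nat \<lfloor>2 ^ m * \<sigma> \<omega>\<rfloor>) \<in> measurable G (count_space UNIV)"
        and n2: "(\<lambda>\<omega>. nat \<lfloor>2 ^ m * \<rho> \<omega>\<rfloor>) \<in> measurable G (count_space UNIV)" by measurable
      have "Ai z = A \<inter> (((\<lambda>\<omega>. nat \<lfloor>2 ^ m * \<sigma> \<omega>\<rfloor>) -` {i} \<inter> space G) \<inter> ((\<lambda>\<omega>. nat \<lfloor>2 ^ m * \<rho> \<omega>\<rfloor>) -` {i'} \<inter> space G))"
        unfolding Ai_def Pair using AQ G by auto
      also have "\<dots> \<in> sets G"
        by (intro sets.Int[OF A] sets.Int[OF measurable_sets[OF n1] measurable_sets[OF n2]]) auto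
      finally show ?thesis .
    qed
    then have AiQ [measurable]: "Ai z \<in> sets Q" for z using G(2) by blast
    have d1: "disjoint_family_on Ai I" unfolding disjoint_family_on_def Ai_def by auto
    have U1: "Am m = (\<Union>z\<in>I. Ai z)"
      unfolding Am_def I_def Ai_def dyadic_above_def by (auto simp: divide_less_cancel)
    have U2: "{\<omega>\<in>Am m. Zm m \<omega> \<in> C} = (\<Union>z\<in>I. {\<omega>\<in>Ai z. Zm m \<omega> \<in> C})" unfolding U1 by auto
    have each: "emeasure Q {\<omega>\<in>Ai z. Zm m \<omega> \<in> C} = emeasure Q (Ai z) * ennreal (N.prob C)" if z: "z \<in> I" for z
    proof (cases z)
      case (Pair i i')
      define q q' where "q = real (Suc i) / 2 ^ m" and "q' = real (Suc i') / 2 ^ m"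
      have qd: "q \<in> dyadics" "q' \<in> dyadics" "q < q'"
        using z Pair unfolding dyadics_def q_def q'_def I_def by (blast, blast, auto simp: divide_less_cancel)
      have e: "dyadic_above m (\<sigma> \<omega>) = q" "dyadic_above m (\<rho> \<omega>) = q'" if "\<omega> \<in> Ai z" for \<omega>
        using that Pair unfolding Ai_def q_def q'_def dyadic_above_def by auto
      have "\<sigma> \<omega> < q" if "\<omega> \<in> Ai z" for \<omega>
      proof -
        have "\<omega> \<in> space Q" using that AQ Pair unfolding Ai_def by auto
        then show ?thesis using e(1)[OF that] dyadic_above_bounds(1)[OF pos(1)] by metis
      qed
      then have "Ai z \<inter> {\<omega>\<in>space Q. \<sigma> \<omega> < q} = Ai z" using sets.sets_into_space[OF AiQ[of z]] by auto
      moreover have "Ai z \<subseteq> A" unfolding Ai_def Pair by auto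
      ultimately have "Ai z \<in> sets (past q)" using past[OF AiG[of z]] by metis
      from past_normalised_increment[OF qd this C]
      have "prob {\<omega>\<in>Ai z. (W q' \<omega> - W q \<omega>) / sqrt (q' - q) \<in> C} = prob (Ai z) * N.prob C" .
      also have "{\<omega>\<in>Ai z. (W q' \<omega> - W q \<omega>) / sqrt (q' - q) \<in> C} = {\<omega>\<in>Ai z. Zm m \<omega> \<in> C}"
        unfolding Zm_def using e by auto
      finally show ?thesis by (simp add: emeasure_eq_measure ennreal_mult')
    qed
    have cI: "countable I" by simp
    have "emeasure Q {\<omega>\<in>Am m. Zm m \<omega> \<in> C} = (\<integral>\<^sup>+z. emeasure Q {\<omega>\<in>Ai z. Zm m \<omega> \<in> C} \<partial>count_space I)"
      unfolding U2
    proof (intro emeasure_UN_countable cI set_m)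
      show "disjoint_family_on (\<lambda>z. {\<omega>\<in>Ai z. Zm m \<omega> \<in> C}) I"
        using d1 unfolding disjoint_family_on_def by blast
    qed auto
    also have "\<dots> = (\<integral>\<^sup>+z. emeasure Q (Ai z) * ennreal (N.prob C) \<partial>count_space I)"
      using each by (intro nn_integral_cong) auto
    also have "\<dots> = (\<integral>\<^sup>+z. emeasure Q (Ai z) \<partial>count_space I) * ennreal (N.prob C)"
      by (rule nn_integral_multc) simp
    also have "(\<integral>\<^sup>+z. emeasure Q (Ai z) \<partial>count_space I) = emeasure Q (Am m)"
      unfolding U1 using d1 by (intro emeasure_UN_countable[symmetric] cI) auto
    finally show ?thesis by (simp add: emeasure_eq_measure ennreal_mult'[symmetric])
  qed
  have step2: "prob {\<omega>\<in>A. Z \<omega> \<in> C} \<le> prob A * N.prob C" if C: "open C" for C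
  proof -
    have [measurable]: "C \<in> sets borel" using C by simp
    define L where "L n = (\<Inter>m\<in>{n..}. {\<omega>\<in>Am m. Zm m \<omega> \<in> C})" for n
    have Lm: "L n \<in> sets Q" for n unfolding L_def by (intro sets.countable_INT' set_m) auto
    have inc: "incseq L" unfolding L_def incseq_def by fastforce
    have sub: "{\<omega>\<in>A. Z \<omega> \<in> C} \<subseteq> (\<Union>n. L n)"
    proof
      fix \<omega> assume w: "\<omega> \<in> {\<omega>\<in>A. Z \<omega> \<in> C}"
      then have wQ: "\<omega> \<in> space Q" and wA: "\<omega> \<in> A" and wZ: "Z \<omega> \<in> C" using AQ by auto
      note t\<sigma> = dyadic_above_tendsto[OF pos(1)[OF wQ]] and t\<rho> = dyadic_above_tendsto[OF pos(2)[OF wQ]]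
      have cont: "continuous_on {0..} (\<lambda>t. W t \<omega>)" using W_continuous wQ by auto
      have c1: "(\<lambda>m. W (dyadic_above m (\<sigma> \<omega>)) \<omega>) \<longlonglongrightarrow> W (\<sigma> \<omega>) \<omega>"
        using cont t\<sigma> by (rule continuous_on_tendsto_compose)
          (auto intro!: eventuallyI dyadics_nonneg dyadic_above_in pos wQ)
      have c2: "(\<lambda>m. W (dyadic_above m (\<rho> \<omega>)) \<omega>) \<longlonglongrightarrow> W (\<rho> \<omega>) \<omega>"
        using cont t\<rho> by (rule continuous_on_tendsto_compose)
          (auto intro!: eventuallyI dyadics_nonneg dyadic_above_in pos wQ)
      have lt: "\<sigma> \<omega> < \<rho> \<omega>" using less[OF wA] .
      have "(\<lambda>m. Zm m \<omega>) \<longlonglongrightarrow> Z \<omega>" unfolding Zm_def Z_def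
        using lt by (intro tendsto_intros c1 c2 t\<sigma> t\<rho>) auto
      then have e1: "\<forall>\<^sub>F m in sequentially. Zm m \<omega> \<in> C" using C wZ by (rule topological_tendstoD)
      have "(\<lambda>m. dyadic_above m (\<rho> \<omega>) - dyadic_above m (\<sigma> \<omega>)) \<longlonglongrightarrow> \<rho> \<omega> - \<sigma> \<omega>"
        by (intro tendsto_intros t\<sigma> t\<rho>)
      then have "\<forall>\<^sub>F m in sequentially. 0 < dyadic_above m (\<rho> \<omega>) - dyadic_above m (\<sigma> \<omega>)"
        using lt by (intro order_tendstoD(1)) auto
      with e1 have "\<forall>\<^sub>F m in sequentially. \<omega> \<in> Am m \<and> Zm m \<omega> \<in> C"
        by eventually_elim (auto simp: Am_def wA)
      then show "\<omega> \<in> (\<Union>n. L n)" unfolding L_def eventually_sequentially by auto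
    qed
    have "L n \<subseteq> {\<omega>\<in>Am n. Zm n \<omega> \<in> C}" for n unfolding L_def by auto
    then have Lb: "prob (L n) \<le> prob A * N.prob C" for n
    proof -
      have "prob (L n) \<le> prob {\<omega>\<in>Am n. Zm n \<omega> \<in> C}" using \<open>L n \<subseteq> _\<close> by (intro finite_measure_mono set_m) auto
      also have "\<dots> \<le> prob A * N.prob C" unfolding step1[OF \<open>C \<in> sets borel\<close>]
        by (intro mult_right_mono finite_measure_mono) (auto simp: Am_def)
      finally show ?thesis .
    qed
    have "prob {\<omega>\<in>A. Z \<omega> \<in> C} \<le> prob (\<Union>n. L n)" using sub Lm by (intro finite_measure_mono) auto
    also have "\<dots> \<le> prob A * N.prob C"
    proof (rule LIMSEQ_le_const2)
      show "(\<lambda>n. prob (L n)) \<longlonglongrightarrow> prob (\<Union>n. L n)"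
        using Lm by (intro finite_Lim_measure_incseq inc) auto
    qed (use Lb in auto)
    finally show ?thesis .
  qed
  have step3: "prob {\<omega>\<in>A. Z \<omega> \<in> C} \<le> prob A * N.prob C" if C [measurable]: "C \<in> sets borel" for C
  proof (rule field_le_epsilon)
    fix e :: real assume e: "0 < e"
    have "emeasure std_normal C = (INF U \<in> {U. C \<subseteq> U \<and> open U}. emeasure std_normal U)"
      using C by (intro outer_regular) (auto simp: N.emeasure_eq_measure)
    moreover have "emeasure std_normal C < ennreal (N.prob C + e)"
      unfolding N.emeasure_eq_measure using e by (intro ennreal_lessI add_nonneg_pos) auto
    ultimately have "(INF U \<in> {U. C \<subseteq> U \<and> open U}. emeasure std_normal U) < ennreal (N.prob C + e)" by simp
    then obtain U where U: "C \<subseteq> U" "open U" "emeasure std_normal U < ennreal (N.prob C + e)"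
      unfolding INF_less_iff by auto
    have NU: "N.prob U \<le> N.prob C + e" using U(3) e unfolding N.emeasure_eq_measure by (simp add: ennreal_less_iff del: ennreal_plus)
    have "prob {\<omega>\<in>A. Z \<omega> \<in> C} \<le> prob {\<omega>\<in>A. Z \<omega> \<in> U}"
      using U by (intro finite_measure_mono set_m) auto
    also have "\<dots> \<le> prob A * N.prob U" by (rule step2[OF U(2)])
    also have "\<dots> \<le> prob A * (N.prob C + e)" using NU by (intro mult_left_mono) auto
    also have "\<dots> \<le> prob A * N.prob C + e" using e by (simp add: distrib_left mult_left_le_one_le)
    finally show "prob {\<omega>\<in>A. Z \<omega> \<in> C} \<le> prob A * N.prob C + e" .
  qed
  have "prob A = prob {\<omega>\<in>A. Z \<omega> \<in> C} + prob {\<omega>\<in>A. Z \<omega> \<in> - C}"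
  proof -
    have "A = {\<omega>\<in>A. Z \<omega> \<in> C} \<union> {\<omega>\<in>A. Z \<omega> \<in> - C}" by auto
    then show ?thesis
      using finite_measure_Union[OF set_m set_m, of A Z C A Z "- C"] C by auto
  qed
  moreover have "N.prob (- C) = 1 - N.prob C"
    using N.prob_compl[of C] C by (simp add: Compl_eq_Diff_UNIV)
  ultimately have "prob {\<omega>\<in>A. Z \<omega> \<in> C} \<ge> prob A * N.prob C"
    using step3[of "- C"] C by (simp add: right_diff_distrib)
  then show ?thesis using step3[OF C] unfolding Z_def by simp
qed

end


section \<open>Observation sequences and their information\<close>

lemma enn2real_less: "x < ennreal q \<Longrightarrow> enn2real x < q"
  by (cases x) (auto simp: ennreal_less_iff)

lemma enn2real_strict: "x < y \<Longrightarrow> y < \<top> \<Longrightarrow> enn2real x < enn2real y"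
  by (cases x; cases y) (auto simp: ennreal_less_iff)

text \<open>At this point the sequence \<open>\<tau>\<close> is arbitrary: a strategy is defined recursively from the quantities below, and
  these are therefore needed before its admissibility is known.\<close>

locale observed_model = detection_model lam c d \<alpha> Q W \<Theta> p0
  for lam c d \<alpha> :: real and Q :: "'a measure" and W \<Theta> p0 +
  fixes \<tau> :: "nat \<Rightarrow> 'a \<Rightarrow> ennreal"
begin

text \<open>The start of the process counts as a zeroth observation, at time 0 with value 0; thus \<open>obs_time (Suc k)\<close> is
  \<open>\<tau> k\<close>, and \<open>info k\<close> below is what the first \<open>k\<close> real observations reveal.\<close>

definition obs_time :: "nat \<Rightarrow> 'a \<Rightarrow> ennreal" where
  "obs_time k \<omega> = (case k of 0 \<Rightarrow> 0 | Suc j \<Rightarrow> \<tau> j \<omega>)"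

definition clock :: "nat \<Rightarrow> 'a \<Rightarrow> real" where
  "clock k \<omega> = enn2real (obs_time k \<omega>)"

definition obs_val :: "nat \<Rightarrow> 'a \<Rightarrow> real" where
  "obs_val k \<omega> = (case k of 0 \<Rightarrow> 0 | Suc j \<Rightarrow> snd (observation X \<tau> j \<omega>))"

text \<open>The belief after an infinite observation time has no meaning; it only has to stay in \<open>[0,1]\<close>.\<close>

primrec belief :: "nat \<Rightarrow> 'a \<Rightarrow> real" where
  "belief 0 \<omega> = p0"
| "belief (Suc k) \<omega> = posterior lam \<alpha> (clock (Suc k) \<omega> - clock k \<omega>) (belief k \<omega>)
                         (obs_val (Suc k) \<omega> - obs_val k \<omega>)"

definition history :: "nat \<Rightarrow> 'a \<Rightarrow> nat \<Rightarrow> ennreal \<times> real" where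
  "history k \<omega> = (\<lambda>i\<in>{..<k}. observation X \<tau> i \<omega>)"

abbreviation history_space :: "nat \<Rightarrow> (nat \<Rightarrow> ennreal \<times> real) measure" where
  "history_space k \<equiv> \<Pi>\<^sub>M i\<in>{..<k}. borel \<Otimes>\<^sub>M borel"

definition info :: "nat \<Rightarrow> 'a measure" where
  "info k = vimage_algebra (space Q) (history k) (history_space k)"

text \<open>The information of the first \<open>k\<close> observations together with the unobservable change time, with respect to which
  the next Brownian increment is still independent.\<close>

definition full_info :: "nat \<Rightarrow> 'a measure" where
  "full_info k = vimage_algebra (space Q) (\<lambda>\<omega>. (\<Theta> \<omega>, history k \<omega>)) (borel \<Otimes>\<^sub>M history_space k)"

definition remaining :: "nat \<Rightarrow> 'a \<Rightarrow> real" where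
  "remaining k \<omega> = max 0 (\<Theta> \<omega> - clock k \<omega>)"

definition reached :: "nat \<Rightarrow> 'a set" where
  "reached k = {\<omega>\<in>space Q. obs_time k \<omega> < \<top>}"

definition gap :: "nat \<Rightarrow> 'a \<Rightarrow> real" where
  "gap k \<omega> = clock (Suc k) \<omega> - clock k \<omega>"

definition jump :: "nat \<Rightarrow> 'a \<Rightarrow> real" where
  "jump k \<omega> = obs_val (Suc k) \<omega> - obs_val k \<omega>"

lemma belief_Suc: "belief (Suc k) \<omega> = posterior lam \<alpha> (gap k \<omega>) (belief k \<omega>) (jump k \<omega>)"
  by (simp add: gap_def jump_def)

lemma belief_bounds: "0 \<le> belief k \<omega>" "belief k \<omega> \<le> 1"
  by (induction k) (auto simp: p0 posterior_bounds[OF lam] simp del: belief.simps(2) simp: belief_Suc)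

lemma space_info [simp]: "space (info k) = space Q" and space_full_info [simp]: "space (full_info k) = space Q"
  by (simp_all add: info_def full_info_def)

lemma history_space_pair: "history k \<omega> \<in> space (history_space k)"
  by (simp add: history_def space_PiM space_pair_measure PiE_iff)

lemma history_info: "history k \<in> measurable (info k) (history_space k)"
  unfolding info_def by (rule measurable_vimage_algebra1) (simp add: history_space_pair)

lemma history_full_info: "(\<lambda>\<omega>. (\<Theta> \<omega>, history k \<omega>)) \<in> measurable (full_info k) (borel \<Otimes>\<^sub>M history_space k)"
  unfolding full_info_def by (rule measurable_vimage_algebra1) (auto simp: history_space_pair space_pair_measure)

lemma \<Theta>_full_info [measurable]: "\<Theta> \<in> borel_measurable (full_info k)"
  using measurable_compose[OF history_full_info measurable_fst] by simp

text \<open>Inclusions of sigma-algebras are stated as measurability of the identity, which composes directly with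
  measurable functions.\<close>

lemma measurable_into_info:
  assumes "space N \<subseteq> space Q" "history k \<in> measurable N (history_space k)"
  shows "(\<lambda>x. x) \<in> measurable N (info k)"
  unfolding info_def using assms by (intro measurable_vimage_algebra2) auto

lemma measurable_into_full_info:
  assumes "space N \<subseteq> space Q" "history k \<in> measurable N (history_space k)" "\<Theta> \<in> borel_measurable N"
  shows "(\<lambda>x. x) \<in> measurable N (full_info k)"
  unfolding full_info_def using assms by (intro measurable_vimage_algebra2) auto

lemma info_full_info: "(\<lambda>x. x) \<in> measurable (full_info k) (info k)"
  using measurable_compose[OF history_full_info measurable_snd] by (intro measurable_into_info) auto

lemma info_Suc: "(\<lambda>x. x) \<in> measurable (info (Suc k)) (info k)"
proof (rule measurable_into_info)
  have "(\<lambda>\<omega>. restrict (history (Suc k) \<omega>) {..<k}) \<in> measurable (info (Suc k)) (history_space k)"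
    by (rule measurable_compose[OF history_info measurable_restrict_subset]) auto
  moreover have "restrict (history (Suc k) \<omega>) {..<k} = history k \<omega>" for \<omega>
    unfolding history_def by (auto simp: fun_eq_iff)
  ultimately show "history k \<in> measurable (info (Suc k)) (history_space k)" by simp
qed simp

lemma observation_info:
  assumes "i < k" shows "observation X \<tau> i \<in> measurable (info k) (borel \<Otimes>\<^sub>M borel)"
proof -
  have "(\<lambda>\<omega>. history k \<omega> i) \<in> measurable (info k) (borel \<Otimes>\<^sub>M borel)"
    using assms by (intro measurable_compose[OF history_info measurable_component_singleton]) auto
  then show ?thesis using assms by (simp add: history_def)
qed

lemma obs_time_info: "j \<le> k \<Longrightarrow> obs_time j \<in> borel_measurable (info k)"
proof (cases j)
  case (Suc i)
  assume "j \<le> k"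
  then have "i < k" using Suc by simp
  from measurable_compose[OF observation_info[OF this] measurable_fst]
  show ?thesis by (simp add: obs_time_def[abs_def] Suc observation_def)
qed (simp add: obs_time_def[abs_def])

lemma obs_val_info: "j \<le> k \<Longrightarrow> obs_val j \<in> borel_measurable (info k)"
proof (cases j)
  case (Suc i)
  assume "j \<le> k"
  then have "i < k" using Suc by simp
  from measurable_compose[OF observation_info[OF this] measurable_snd]
  show ?thesis by (simp add: obs_val_def[abs_def] Suc)
qed (simp add: obs_val_def[abs_def])

lemma clock_info: "j \<le> k \<Longrightarrow> clock j \<in> borel_measurable (info k)"
  unfolding clock_def[abs_def] using obs_time_info[of j k] by measurable

lemma belief_info: "j \<le> k \<Longrightarrow> belief j \<in> borel_measurable (info k)"
proof (induction j)
  case 0 have "belief 0 = (\<lambda>_. p0)" by (simp add: fun_eq_iff) then show ?case by simp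
next
  case (Suc j)
  have [measurable]: "belief j \<in> borel_measurable (info k)" "clock j \<in> borel_measurable (info k)"
    "clock (Suc j) \<in> borel_measurable (info k)" "obs_val j \<in> borel_measurable (info k)"
    "obs_val (Suc j) \<in> borel_measurable (info k)"
    using Suc by (auto intro!: clock_info obs_val_info)
  have "belief (Suc j) = (\<lambda>\<omega>. posterior lam \<alpha> (clock (Suc j) \<omega> - clock j \<omega>) (belief j \<omega>)
                         (obs_val (Suc j) \<omega> - obs_val j \<omega>))" by (simp add: fun_eq_iff)
  then show ?case by simp
qed

lemma clock_nonneg: "0 \<le> clock k \<omega>" unfolding clock_def by simp

end

locale admissible_model = observed_model +
  assumes admissible: "\<tau> \<in> observation_sequences (space Q) X"
begin

lemma first_time: "\<exists>t>0. \<forall>\<omega>\<in>space Q. \<tau> 0 \<omega> = t"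
  using admissible unfolding observation_sequences_def by auto

lemma \<tau>_info: "\<tau> k \<in> borel_measurable (info k)"
proof (cases k)
  case 0
  obtain t where "\<forall>\<omega>\<in>space Q. \<tau> 0 \<omega> = t" using first_time by auto
  then show ?thesis using 0 measurable_cong[of "info 0" "\<tau> 0" "\<lambda>_. t" borel] by simp
next
  case (Suc j)
  then show ?thesis using admissible unfolding observation_sequences_def info_def history_def[abs_def] by auto
qed

lemma obs_time_Suc_info: "obs_time (Suc k) \<in> borel_measurable (info k)"
  using \<tau>_info[of k] by (simp add: obs_time_def[abs_def])

lemma obs_time_less:
  assumes "\<omega> \<in> space Q" "obs_time k \<omega> < \<top>"
  shows "obs_time k \<omega> < obs_time (Suc k) \<omega>"
proof (cases k)
  case 0 then show ?thesis using first_time assms by (auto simp: obs_time_def)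
next
  case (Suc j)
  then show ?thesis using admissible assms unfolding observation_sequences_def obs_time_def
    by (auto split: if_splits dest!: spec[of _ j] bspec[of _ _ \<omega>])
qed

lemma obs_time_top:
  assumes "\<omega> \<in> space Q" "obs_time k \<omega> = \<top>"
  shows "obs_time (Suc k) \<omega> = \<top>"
proof (cases k)
  case 0 then show ?thesis using assms by (auto simp: obs_time_def)
next
  case (Suc j)
  then show ?thesis using admissible assms unfolding observation_sequences_def obs_time_def
    by (auto split: if_splits dest!: spec[of _ j] bspec[of _ _ \<omega>])
qed

lemma obs_time_Suc_le: "\<omega> \<in> space Q \<Longrightarrow> obs_time k \<omega> \<le> obs_time (Suc k) \<omega>"
  using obs_time_less[of \<omega> k] obs_time_top[of \<omega> k] by (cases "obs_time k \<omega> = \<top>") (auto simp: less_top)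

lemma obs_time_mono: "\<omega> \<in> space Q \<Longrightarrow> j \<le> k \<Longrightarrow> obs_time j \<omega> \<le> obs_time k \<omega>"
  using lift_Suc_mono_le[of "\<lambda>k. obs_time k \<omega>"] obs_time_Suc_le by blast

lemma history_events: "history k \<in> measurable Q (history_space k)"
proof (induction k)
  case 0
  show ?case unfolding history_def by (rule measurable_restrict) simp
next
  case (Suc k)
  have [measurable]: "\<tau> k \<in> borel_measurable Q"
    using measurable_compose[OF measurable_into_info[OF _ Suc] \<tau>_info] by simp
  have [measurable]: "(\<lambda>\<omega>. W (enn2real (\<tau> k \<omega>)) \<omega>) \<in> borel_measurable Q"
    by (rule path_at_random_time) auto
  have k: "observation X \<tau> k \<in> measurable Q (borel \<Otimes>\<^sub>M borel)"
    unfolding observation_def[abs_def] obs_process_def by measurable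
  show ?case unfolding history_def
  proof (rule measurable_restrict)
    fix i assume "i \<in> {..<Suc k}"
    then consider "i = k" | "i < k" by fastforce
    then show "observation X \<tau> i \<in> measurable Q (borel \<Otimes>\<^sub>M borel)"
    proof cases
      case 2 then show ?thesis
        using measurable_compose[OF measurable_into_info[OF _ Suc] observation_info[OF 2]] by simp
    qed (use k in simp)
  qed
qed

lemma info_events: "(\<lambda>x. x) \<in> measurable Q (info k)" and full_info_events: "(\<lambda>x. x) \<in> measurable Q (full_info k)"
  by (auto intro!: measurable_into_info measurable_into_full_info history_events)

lemma sets_of_id: "(\<lambda>x. x) \<in> measurable N M' \<Longrightarrow> space N = space M' \<Longrightarrow> A \<in> sets M' \<Longrightarrow> A \<in> sets N"
  using measurable_sets[of "\<lambda>x. x" N M' A] sets.sets_into_space[of A M'] by (simp add: vimage_def Int_absorb2)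

text \<open>By induction on \<open>k\<close>: on the event that the next observation time is below \<open>q\<close>, this time is a function of
  the observations so far, which lie in the past of \<open>q\<close>, and the path at this time is determined before \<open>q\<close>.\<close>

lemma history_past:
  "{\<omega>\<in>space Q. obs_time k \<omega> < ennreal q} \<in> sets (past q) \<and>
   history k \<in> measurable (restrict_space (past q) {\<omega>\<in>space Q. obs_time k \<omega> < ennreal q}) (history_space k)"
proof (induction k)
  case 0
  have "{\<omega>\<in>space Q. obs_time 0 \<omega> < ennreal q} \<in> sets (past q)"
    using sets.top[of "past q"] by (cases "0 < ennreal q") (auto simp: obs_time_def)
  then show ?case unfolding history_def by (intro conjI measurable_restrict) auto
next
  case (Suc k)
  let ?U = "\<lambda>k. {\<omega>\<in>space Q. obs_time k \<omega> < ennreal q}"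
  let ?N = "\<lambda>k. restrict_space (past q) (?U k)"
  have sp: "space (?N k) = ?U k" for k by (auto simp: space_restrict_space)
  have idm: "(\<lambda>x. x) \<in> measurable (?N k) (info k)"
    using Suc by (intro measurable_into_info) (auto simp: sp)
  have \<tau>N: "\<tau> k \<in> borel_measurable (?N k)" using measurable_compose[OF idm \<tau>_info] .
  have Ueq: "?U (Suc k) = \<tau> k -` {..<ennreal q} \<inter> space (?N k)"
    unfolding sp using obs_time_Suc_le[of _ k] by (auto simp: obs_time_def intro: le_less_trans)
  have "?U (Suc k) \<in> sets (?N k)" unfolding Ueq using \<tau>N by (rule measurable_sets) simp
  moreover have "?U k \<inter> space (past q) \<in> sets (past q)" using Suc sets.top[of "past q"] by (intro sets.Int) auto
  ultimately have US: "?U (Suc k) \<in> sets (past q)"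
    by (simp add: sets_restrict_space_iff)
  have sub: "?U (Suc k) \<subseteq> ?U k" using obs_time_Suc_le[of _ k] by (auto intro: le_less_trans)
  have [measurable]: "\<tau> k \<in> borel_measurable (?N (Suc k))"
    using measurable_restrict_mono[OF \<tau>N sub] .
  have \<rho>: "0 \<le> enn2real (\<tau> k \<omega>)" "enn2real (\<tau> k \<omega>) < q" "\<tau> k \<omega> < \<top>" if "\<omega> \<in> space (?N (Suc k))" for \<omega>
    using that unfolding sp by (auto simp: obs_time_def enn2real_less intro: less_le_trans)
  have [measurable]: "(\<lambda>\<omega>. W (enn2real (\<tau> k \<omega>)) \<omega>) \<in> borel_measurable (?N (Suc k))"
  proof (rule path_at_random_time_measurable[where T="dyadics \<inter> {..q}"])
    show "W s \<in> borel_measurable (?N (Suc k))" if "s \<in> dyadics \<inter> {..q}" for s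
      using that past_W by (intro measurable_restrict_space1) auto
    fix \<omega> assume w: "\<omega> \<in> space (?N (Suc k))"
    have "\<forall>\<^sub>F m in sequentially. dyadic_above m (enn2real (\<tau> k \<omega>)) < q"
      using dyadic_above_tendsto[OF \<rho>(1)[OF w]] \<rho>(2)[OF w] by (rule order_tendstoD(2))
    then show "\<forall>\<^sub>F m in sequentially. dyadic_above m (enn2real (\<tau> k \<omega>)) \<in> dyadics \<inter> {..q}"
      by eventually_elim (auto simp: dyadic_above_in)
  qed (use \<rho> in \<open>auto simp: sp\<close>)
  have [measurable]: "\<Theta> \<in> borel_measurable (?N (Suc k))" by (intro measurable_restrict_space1 past_\<Theta>)
  have k: "observation X \<tau> k \<in> measurable (?N (Suc k)) (borel \<Otimes>\<^sub>M borel)"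
    unfolding observation_def[abs_def] obs_process_def by measurable
  have "history (Suc k) \<in> measurable (?N (Suc k)) (history_space (Suc k))" unfolding history_def
  proof (rule measurable_restrict)
    fix i assume "i \<in> {..<Suc k}"
    then consider "i = k" | "i < k" by fastforce
    then show "observation X \<tau> i \<in> measurable (?N (Suc k)) (borel \<Otimes>\<^sub>M borel)"
    proof cases
      case 2
      have "observation X \<tau> i \<in> measurable (?N k) (borel \<Otimes>\<^sub>M borel)"
        using measurable_compose[OF idm observation_info[OF 2]] .
      then show ?thesis using sub by (rule measurable_restrict_mono)
    qed (use k in simp)
  qed
  then show ?case using US by blast
qed

lemma full_info_past:
  assumes "A \<in> sets (full_info k)"
  shows "A \<inter> {\<omega>\<in>space Q. obs_time k \<omega> < ennreal q} \<in> sets (past q)"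
proof -
  let ?U = "{\<omega>\<in>space Q. obs_time k \<omega> < ennreal q}"
  let ?N = "restrict_space (past q) ?U"
  have sp: "space ?N = ?U" by (auto simp: space_restrict_space)
  have "(\<lambda>x. x) \<in> measurable ?N (full_info k)"
    using history_past[of k q] by (intro measurable_into_full_info) (auto simp: sp intro!: measurable_restrict_space1 past_\<Theta>)
  then have "(\<lambda>x. x) -` A \<inter> space ?N \<in> sets ?N" using assms by (rule measurable_sets)
  moreover have "?U \<inter> space (past q) \<in> sets (past q)" using history_past[of k q] sets.top[of "past q"] by (intro sets.Int) auto
  ultimately show ?thesis unfolding sp by (simp add: sets_restrict_space_iff Int_def)
qed

lemma reached_info: "reached k \<in> sets (info k)" "reached (Suc k) \<in> sets (info k)"
proof -
  note [measurable] = obs_time_info[of k k, simplified] obs_time_Suc_info[of k]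
  have "{\<omega>\<in>space (info k). obs_time k \<omega> < \<top>} \<in> sets (info k)"
    "{\<omega>\<in>space (info k). obs_time (Suc k) \<omega> < \<top>} \<in> sets (info k)" by measurable
  then show "reached k \<in> sets (info k)" "reached (Suc k) \<in> sets (info k)" by (simp_all add: reached_def)
qed

lemma reached_Suc: "reached (Suc k) \<subseteq> reached k"
  unfolding reached_def using le_less_trans[OF obs_time_Suc_le] by blast

lemma clock_less: "\<omega> \<in> reached (Suc k) \<Longrightarrow> clock k \<omega> < clock (Suc k) \<omega>"
proof -
  assume w: "\<omega> \<in> reached (Suc k)"
  then have "\<omega> \<in> space Q" "obs_time k \<omega> < \<top>" using reached_Suc[of k] unfolding reached_def by blast+
  from obs_time_less[OF this] w show ?thesis
    unfolding clock_def reached_def by (intro enn2real_strict) auto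
qed

lemma gap_pos: "\<omega> \<in> reached (Suc k) \<Longrightarrow> 0 < gap k \<omega>"
  using clock_less unfolding gap_def by simp

lemma clock_Suc_info: "clock (Suc k) \<in> borel_measurable (info k)"
  unfolding clock_def[abs_def] using obs_time_Suc_info[of k] by measurable

text \<open>The Brownian increment up to the next observation, normalised to a standard normal variable; this is meaningful only
  where the next observation is made.\<close>

definition noise :: "nat \<Rightarrow> 'a \<Rightarrow> real" where
  "noise k \<omega> = (W (clock (Suc k) \<omega>) \<omega> - W (clock k \<omega>) \<omega>) / sqrt (clock (Suc k) \<omega> - clock k \<omega>)"

lemma full_measurable: "f \<in> measurable (info k) N \<Longrightarrow> f \<in> measurable (full_info k) N"
  using measurable_compose[OF info_full_info] by blast

lemma info_measurable_Q: "f \<in> measurable (info k) N \<Longrightarrow> f \<in> measurable Q N"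
  using measurable_compose[OF info_events] by blast

lemma full_measurable_Q: "f \<in> measurable (full_info k) N \<Longrightarrow> f \<in> measurable Q N"
  using measurable_compose[OF full_info_events] by blast

lemma clock_Q [measurable]: "clock k \<in> borel_measurable Q" and obs_time_Q [measurable]: "obs_time k \<in> borel_measurable Q"
  and obs_val_Q [measurable]: "obs_val k \<in> borel_measurable Q" and belief_Q [measurable]: "belief k \<in> borel_measurable Q"
  by (rule info_measurable_Q[OF clock_info[OF order_refl]] info_measurable_Q[OF obs_time_info[OF order_refl]]
      info_measurable_Q[OF obs_val_info[OF order_refl]] info_measurable_Q[OF belief_info[OF order_refl]])+

lemma noise_Q [measurable]: "noise k \<in> borel_measurable Q"
proof -
  have [measurable]: "(\<lambda>\<omega>. W (clock k \<omega>) \<omega>) \<in> borel_measurable Q" for k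
    by (rule path_at_random_time) (auto simp: clock_nonneg)
  show ?thesis unfolding noise_def[abs_def] by measurable
qed

lemma reached_Q [measurable]: "reached k \<in> sets Q"
  using sets_of_id[OF info_events _ reached_info(1)] by simp

text \<open>The strong Markov property in integral form. The independence on rectangles says that, on the event that the next
  observation is made, the pair of outcome and noise has a product law.\<close>

lemma noise_independent:
  assumes h: "h \<in> borel_measurable (full_info k \<Otimes>\<^sub>M borel)"
  shows "(\<integral>\<^sup>+\<omega>. indicator (reached (Suc k)) \<omega> * h (\<omega>, noise k \<omega>) \<partial>Q)
     = (\<integral>\<^sup>+\<omega>. indicator (reached (Suc k)) \<omega> * (\<integral>\<^sup>+z. ennreal (std_normal_density z) * h (\<omega>, z) \<partial>lborel) \<partial>Q)"
proof -
  let ?E = "reached (Suc k)"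
  let ?D = "density Q (indicator ?E)"
  let ?G = "full_info k"
  interpret N: prob_space std_normal by (rule prob_space_normal_density) simp
  have [measurable]: "(\<lambda>\<omega>. \<omega>) \<in> measurable Q ?G" by (rule full_info_events)
  have idD: "(\<lambda>\<omega>. \<omega>) \<in> measurable ?D ?G" by simp
  have EG: "?E \<in> sets ?G" using sets_of_id[OF info_full_info _ reached_info(2)] by simp
  define \<mu> where "\<mu> = distr ?D ?G (\<lambda>\<omega>. \<omega>)"
  have fD: "finite_measure ?D"
    by standard (simp add: emeasure_density emeasure_eq_measure)
  have "finite_measure \<mu>" unfolding \<mu>_def using fD idD by (rule finite_measure.finite_measure_distr)
  then interpret \<mu>: finite_measure \<mu> .
  have sets_\<mu>: "sets \<mu> = sets ?G" unfolding \<mu>_def by simp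
  have eq: "\<mu> \<Otimes>\<^sub>M std_normal = distr ?D (?G \<Otimes>\<^sub>M borel) (\<lambda>\<omega>. (\<omega>, noise k \<omega>))"
  proof (rule pair_measure_eqI)
    show "sigma_finite_measure \<mu>" "sigma_finite_measure std_normal"
      by (rule \<mu>.sigma_finite_measure_axioms, rule N.sigma_finite_measure_axioms)
    show "sets (\<mu> \<Otimes>\<^sub>M std_normal) = sets (distr ?D (?G \<Otimes>\<^sub>M borel) (\<lambda>\<omega>. (\<omega>, noise k \<omega>)))"
      unfolding sets_distr by (rule sets_pair_measure_cong) (auto simp: sets_\<mu>)
    fix A B assume A: "A \<in> sets \<mu>" and B: "B \<in> sets std_normal"
    have A: "A \<in> sets ?G" and [measurable]: "B \<in> sets borel" using A B by (auto simp: sets_\<mu>)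
    have [measurable]: "A \<in> sets Q" using A sets_of_id[OF full_info_events] by simp
    have EA: "?E \<inter> A \<in> sets ?G" using EG A by auto
    have Asp: "A \<subseteq> space Q" using sets.sets_into_space[OF A] by simp
    have "prob {\<omega>\<in>?E \<inter> A. (W (clock (Suc k) \<omega>) \<omega> - W (clock k \<omega>) \<omega>) / sqrt (clock (Suc k) \<omega> - clock k \<omega>) \<in> B}
        = prob (?E \<inter> A) * measure std_normal B"
    proof (rule strong_markov_prob[of ?G])
      show "sets ?G \<subseteq> sets Q" using sets_of_id[OF full_info_events] by auto
      show "clock k \<in> borel_measurable ?G" "clock (Suc k) \<in> borel_measurable ?G"
        by (auto intro!: full_measurable clock_info clock_Suc_info)
      fix A' q assume A': "A' \<in> sets ?G" "A' \<subseteq> ?E \<inter> A"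
      have "A' \<inter> {\<omega>\<in>space Q. clock k \<omega> < q} = A' \<inter> {\<omega>\<in>space Q. obs_time k \<omega> < ennreal q}"
      proof -
        have "clock k \<omega> < q \<longleftrightarrow> obs_time k \<omega> < ennreal q" if "\<omega> \<in> A'" for \<omega>
        proof -
          have "obs_time k \<omega> < \<top>" using that A'(2) reached_Suc[of k] unfolding reached_def by auto
          then show ?thesis unfolding clock_def by (cases "obs_time k \<omega>") (auto simp: ennreal_less_iff)
        qed
        then show ?thesis by auto
      qed
      then show "A' \<inter> {\<omega>\<in>space Q. clock k \<omega> < q} \<in> sets (past q)" using full_info_past[OF A'(1)] by simp
    qed (use EA clock_nonneg clock_less in auto)
    then have pr: "prob {\<omega>\<in>?E \<inter> A. noise k \<omega> \<in> B} = prob (?E \<inter> A) * measure std_normal B"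
      unfolding noise_def .
    have "emeasure \<mu> A = emeasure ?D A" unfolding \<mu>_def using A Asp by (subst emeasure_distr) (auto simp: Int_absorb2)
    also have "\<dots> = emeasure Q (?E \<inter> A)" by (subst emeasure_density) (auto simp: indicator_inter_arith[symmetric])
    finally have 1: "emeasure \<mu> A = emeasure Q (?E \<inter> A)" .
    have "emeasure (distr ?D (?G \<Otimes>\<^sub>M borel) (\<lambda>\<omega>. (\<omega>, noise k \<omega>))) (A \<times> B)
       = emeasure ?D ((\<lambda>\<omega>. (\<omega>, noise k \<omega>)) -` (A \<times> B) \<inter> space Q)"
      using A by (subst emeasure_distr) auto
    also have "(\<lambda>\<omega>. (\<omega>, noise k \<omega>)) -` (A \<times> B) \<inter> space Q = A \<inter> (noise k -` B \<inter> space Q)" using Asp by auto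
    also have "emeasure ?D (A \<inter> (noise k -` B \<inter> space Q)) = emeasure Q (?E \<inter> (A \<inter> (noise k -` B \<inter> space Q)))"
    proof -
      have [measurable]: "noise k -` B \<inter> space Q \<in> sets Q" by measurable
      show ?thesis by (subst emeasure_density) (auto simp: indicator_inter_arith[symmetric])
    qed
    also have "?E \<inter> (A \<inter> (noise k -` B \<inter> space Q)) = {\<omega>\<in>?E \<inter> A. noise k \<omega> \<in> B}" using Asp by auto
    finally have 2: "emeasure (distr ?D (?G \<Otimes>\<^sub>M borel) (\<lambda>\<omega>. (\<omega>, noise k \<omega>))) (A \<times> B)
       = emeasure Q {\<omega>\<in>?E \<inter> A. noise k \<omega> \<in> B}" .
    show "emeasure \<mu> A * emeasure std_normal B = emeasure (distr ?D (?G \<Otimes>\<^sub>M borel) (\<lambda>\<omega>. (\<omega>, noise k \<omega>))) (A \<times> B)"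
      unfolding 1 2 emeasure_eq_measure N.emeasure_eq_measure pr by (simp add: ennreal_mult')
  qed
  have h': "h \<in> borel_measurable (\<mu> \<Otimes>\<^sub>M std_normal)"
    using h by (subst measurable_cong_sets[OF sets_pair_measure_cong[OF sets_\<mu>] refl]) auto
  have "h \<in> borel_measurable (?G \<Otimes>\<^sub>M std_normal)"
    using h by (subst measurable_cong_sets[OF sets_pair_measure_cong refl]) auto
  then have hm: "(\<lambda>\<omega>. \<integral>\<^sup>+z. h (\<omega>, z) \<partial>std_normal) \<in> borel_measurable ?G"
    by (rule N.borel_measurable_nn_integral_fst)
  have h2: "(\<lambda>z. h (\<omega>, z)) \<in> borel_measurable borel" if "\<omega> \<in> space Q" for \<omega>
    using measurable_compose[OF measurable_Pair1' h] that by simp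
  have "(\<integral>\<^sup>+\<omega>. indicator ?E \<omega> * h (\<omega>, noise k \<omega>) \<partial>Q) = (\<integral>\<^sup>+\<omega>. h (\<omega>, noise k \<omega>) \<partial>?D)"
  proof (rule nn_integral_density[symmetric])
    have "(\<lambda>\<omega>. (\<omega>, noise k \<omega>)) \<in> measurable Q (?G \<Otimes>\<^sub>M borel)" by measurable
    from measurable_compose[OF this h] show "(\<lambda>\<omega>. h (\<omega>, noise k \<omega>)) \<in> borel_measurable Q" .
  qed simp
  also have "\<dots> = integral\<^sup>N (distr ?D (?G \<Otimes>\<^sub>M borel) (\<lambda>\<omega>. (\<omega>, noise k \<omega>))) h"
    using h by (subst nn_integral_distr) auto
  also have "\<dots> = (\<integral>\<^sup>+\<omega>. \<integral>\<^sup>+z. h (\<omega>, z) \<partial>std_normal \<partial>\<mu>)"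
    unfolding eq[symmetric] by (rule N.nn_integral_fst[OF h', symmetric])
  also have "\<dots> = (\<integral>\<^sup>+\<omega>. \<integral>\<^sup>+z. h (\<omega>, z) \<partial>std_normal \<partial>?D)"
    unfolding \<mu>_def using hm by (intro nn_integral_distr[OF idD]) simp
  also have "\<dots> = (\<integral>\<^sup>+\<omega>. indicator ?E \<omega> * (\<integral>\<^sup>+z. h (\<omega>, z) \<partial>std_normal) \<partial>Q)"
    using full_measurable_Q[OF hm] by (intro nn_integral_density) simp_all
  also have "\<dots> = (\<integral>\<^sup>+\<omega>. indicator ?E \<omega> * (\<integral>\<^sup>+z. ennreal (std_normal_density z) * h (\<omega>, z) \<partial>lborel) \<partial>Q)"
    using h2 by (intro nn_integral_cong) (simp add: nn_integral_density)
  finally show ?thesis .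
qed

end


section \<open>Filtering along an observation sequence\<close>

lemma rectangle_measure_eqI:
  assumes M: "sets M = sets (A \<Otimes>\<^sub>M B)" and N: "sets N = sets (A \<Otimes>\<^sub>M B)"
    and fin: "emeasure M (space M) \<noteq> \<infinity>"
    and eq: "\<And>a b. a \<in> sets A \<Longrightarrow> b \<in> sets B \<Longrightarrow> emeasure M (a \<times> b) = emeasure N (a \<times> b)"
  shows "M = N"
proof (rule measure_eqI_generator_eq[OF Int_stable_pair_measure_generator[of A B], where \<Omega>="space A \<times> space B" and A="\<lambda>_. space A \<times> space B"])
  show "{a \<times> b |a b. a \<in> sets A \<and> b \<in> sets B} \<subseteq> Pow (space A \<times> space B)"
    using sets.space_closed[of A] sets.space_closed[of B] by auto
  show "sets M = sigma_sets (space A \<times> space B) {a \<times> b |a b. a \<in> sets A \<and> b \<in> sets B}"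
    "sets N = sigma_sets (space A \<times> space B) {a \<times> b |a b. a \<in> sets A \<and> b \<in> sets B}"
    using M N by (simp_all add: sets_pair_measure)
  show "range (\<lambda>_. space A \<times> space B) \<subseteq> {a \<times> b |a b. a \<in> sets A \<and> b \<in> sets B}" by auto
  show "emeasure M (space A \<times> space B) \<noteq> \<infinity>"
    using fin sets_eq_imp_space_eq[OF M] by (simp add: space_pair_measure)
qed (use eq in auto)

text \<open>A fixed measure of which every mixture law \<open>p \<delta>\<^sub>0 + (1 - p) Exp(lam)\<close> is an image, under
  \<open>(u, r) \<mapsto> (if u < p then 0 else r)\<close>. Thus a mixture law with a random weight comes from a product measure.\<close>

definition prior_base :: "real \<Rightarrow> (real \<times> real) measure" where
  "prior_base lam = density lborel (indicator {0..<1}) \<Otimes>\<^sub>M density lborel (exponential_density lam)"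

lemma prior_base_sigma_finite:
  assumes "0 < lam"
  shows "sigma_finite_measure (density lborel (\<lambda>x. ennreal (exponential_density lam x)))"
    "sigma_finite_measure (prior_base lam)" "sets (prior_base lam) = sets (borel \<Otimes>\<^sub>M borel)"
proof -
  interpret E: prob_space "density lborel (\<lambda>x. ennreal (exponential_density lam x))"
    by (rule prob_space_exponential_density[OF assms])
  show "sigma_finite_measure (density lborel (\<lambda>x. ennreal (exponential_density lam x)))"
    by (rule E.sigma_finite_measure_axioms)
  have "prob_space (density lborel (indicator {0..<1::real}))"
    by standard (simp add: emeasure_density)
  then interpret U: prob_space "density lborel (indicator {0..<1::real})" .
  interpret pair_prob_space "density lborel (indicator {0..<1::real})" "density lborel (\<lambda>x. ennreal (exponential_density lam x))" ..
  show "sigma_finite_measure (prior_base lam)" unfolding prior_base_def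
    by (rule sigma_finite_measure_axioms)
  show "sets (prior_base lam) = sets (borel \<Otimes>\<^sub>M borel)" unfolding prior_base_def
    by (intro sets_pair_measure_cong) auto
qed

lemma prior_integral_base:
  assumes l: "0 < lam" and p: "0 \<le> p" "p \<le> 1" and [measurable]: "g \<in> borel_measurable borel"
  shows "prior_integral lam p g = (\<integral>\<^sup>+b. g (if fst b < p then 0 else snd b) \<partial>prior_base lam)"
proof -
  interpret E: sigma_finite_measure "density lborel (\<lambda>x. ennreal (exponential_density lam x))"
    by (rule prior_base_sigma_finite(1)[OF l])
  let ?I = "\<integral>\<^sup>+r. ennreal (exponential_density lam r) * g r \<partial>lborel"
  have one: "(\<integral>\<^sup>+r. ennreal (exponential_density lam r) \<partial>lborel) = 1"
    using prior_integral_const[OF l, of 0 1] by (simp add: prior_integral_def)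
  have "(\<integral>\<^sup>+b. g (if fst b < p then 0 else snd b) \<partial>prior_base lam)
      = (\<integral>\<^sup>+u. \<integral>\<^sup>+r. g (if u < p then 0 else r) \<partial>density lborel (exponential_density lam) \<partial>density lborel (indicator {0..<1}))"
    unfolding prior_base_def by (subst E.nn_integral_fst[symmetric]) (auto cong: if_cong)
  also have "\<dots> = (\<integral>\<^sup>+u. indicator {0..<1} u * (if u < p then g 0 else ?I) \<partial>lborel)"
    by (subst nn_integral_density) (auto intro!: nn_integral_cong simp: nn_integral_density nn_integral_multc one)
  also have "\<dots> = (\<integral>\<^sup>+u. g 0 * indicator {0..<p} u + ?I * indicator {p..<1} u \<partial>lborel)"
    using p by (intro nn_integral_cong) (auto simp: indicator_def)
  also have "\<dots> = g 0 * emeasure lborel {0..<p} + ?I * emeasure lborel {p..<1}"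
    by (simp add: nn_integral_add nn_integral_cmult_indicator)
  also have "\<dots> = prior_integral lam p g"
    using p by (simp add: prior_integral_def mult.commute)
  finally show ?thesis by simp
qed

lemma measurable_compose3:
  assumes H: "(\<lambda>(x, y, z). H x y z) \<in> measurable (A \<Otimes>\<^sub>M (B \<Otimes>\<^sub>M C)) D"
    and "f \<in> measurable N A" "g \<in> measurable N B" "h \<in> measurable N C"
  shows "(\<lambda>x. H (f x) (g x) (h x)) \<in> measurable N D"
  using measurable_compose[OF measurable_Pair[OF assms(2) measurable_Pair[OF assms(3,4)]] H] by simp

lemma exponential_tail:
  assumes "0 < lam" "0 \<le> s"
  shows "(\<integral>\<^sup>+r. ennreal (exponential_density lam r) * indicator {s<..} r \<partial>lborel) = ennreal (exp (- lam * s))"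
proof -
  have "(\<integral>\<^sup>+r. ennreal (exponential_density lam r) * indicator {s<..} r \<partial>lborel)
      = (\<integral>\<^sup>+r. ennreal (lam * exp (- lam * r)) * indicator {s..} r \<partial>lborel)"
  proof (rule nn_integral_cong_AE)
    have "AE r in lborel. r \<noteq> s" by (rule AE_lborel_singleton)
    then show "AE r in lborel. ennreal (exponential_density lam r) * indicator {s<..} r
        = ennreal (lam * exp (- lam * r)) * indicator {s..} r"
      by eventually_elim (use assms in \<open>auto simp: exponential_density_def indicator_def mult_ac\<close>)
  qed
  also have "\<dots> = ennreal (0 - (- exp (- lam * s)))"
  proof (rule nn_integral_FTC_atLeast)
    show "((\<lambda>r. - exp (- lam * r)) \<longlongrightarrow> 0) at_top"
    proof -
      have "((\<lambda>r. exp (- lam * r)) \<longlongrightarrow> 0) at_top"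
        using assms(1) by (intro filterlim_compose[OF exp_at_bot] filterlim_tendsto_neg_mult_at_bot[OF tendsto_const _ filterlim_ident]) auto
      from tendsto_minus[OF this] show ?thesis by simp
    qed
  qed (use assms in \<open>auto intro!: derivative_eq_intros\<close>)
  finally show ?thesis by simp
qed

lemma exponential_shortfall:
  assumes "0 < lam" "0 \<le> s"
  shows "(\<integral>\<^sup>+r. ennreal (exponential_density lam r) * ennreal (max 0 (s - r)) \<partial>lborel)
     = ennreal (s - (1 - exp (- lam * s)) / lam)"
proof -
  have "(\<integral>\<^sup>+r. ennreal (exponential_density lam r) * ennreal (max 0 (s - r)) \<partial>lborel)
     = (\<integral>\<^sup>+r. ennreal (lam * exp (- lam * r) * (s - r)) * indicator {0..s} r \<partial>lborel)"
    using assms by (intro nn_integral_cong)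
      (auto simp: exponential_density_def indicator_def ennreal_mult'[symmetric] mult_ac max_def not_le)
  also have "\<dots> = ennreal ((- (s - s) * exp (- lam * s) + exp (- lam * s) / lam)
       - (- (s - 0) * exp (- lam * 0) + exp (- lam * 0) / lam))"
  proof (rule nn_integral_FTC_Icc[where F="\<lambda>r. - (s - r) * exp (- lam * r) + exp (- lam * r) / lam"])
    fix r assume "r \<in> {0..s}"
    show "DERIV (\<lambda>r. - (s - r) * exp (- lam * r) + exp (- lam * r) / lam) r :> lam * exp (- lam * r) * (s - r)"
      using assms(1) by (auto intro!: derivative_eq_intros simp: field_simps)
  qed (use assms in auto)
  finally show ?thesis using assms by (simp add: diff_divide_distrib algebra_simps)
qed

context detection_params
begin

lemma prior_integral_delay:
  assumes p: "0 \<le> p" "p \<le> 1" and s: "0 \<le> s"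
  shows "prior_integral lam p (\<lambda>r. ennreal c * ennreal (max 0 (s - r))) = ennreal (delay_cost p s)"
proof -
  let ?m = "s - (1 - exp (- lam * s)) / lam"
  have m: "0 \<le> ?m"
    using lam exp_ge_add_one_self[of "- lam * s"] by (simp add: field_simps)
  have "prior_integral lam p (\<lambda>r. ennreal c * ennreal (max 0 (s - r)))
      = ennreal p * (ennreal c * ennreal s) + ennreal (1 - p) * (ennreal c * ennreal ?m)"
    unfolding prior_integral_def mult.left_commute[of _ "ennreal c"]
    using s exponential_shortfall[OF lam s] by (simp add: nn_integral_cmult mult.left_commute)
  also have "\<dots> = ennreal (p * (c * s) + (1 - p) * (c * ?m))"
    using p s c m by (simp add: ennreal_mult)
  also have "p * (c * s) + (1 - p) * (c * ?m) = delay_cost p s"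
    unfolding delay_cost_def by (simp add: algebra_simps)
  finally show ?thesis .
qed

lemma prior_integral_stop:
  assumes p: "0 \<le> p" "p \<le> 1" and s: "0 \<le> s"
  shows "prior_integral lam p (\<lambda>r. indicator {s<..} r + ennreal c * ennreal (max 0 (s - r))) = ennreal (stop_cost p s)"
proof -
  have "prior_integral lam p (\<lambda>r. indicator {s<..} r + ennreal c * ennreal (max 0 (s - r)))
     = prior_integral lam p (indicator {s<..}) + prior_integral lam p (\<lambda>r. ennreal c * ennreal (max 0 (s - r)))"
    unfolding prior_integral_def by (simp add: distrib_left nn_integral_add add_ac)
  also have "prior_integral lam p (indicator {s<..}) = ennreal ((1 - p) * exp (- lam * s))"
    unfolding prior_integral_def using s p exponential_tail[OF lam s] by (simp add: ennreal_mult)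
  finally show ?thesis
    unfolding prior_integral_delay[OF assms] stop_cost_def
    using p s delay_cost_nonneg[OF p s] by simp
qed

end

context detection_model
begin

lemma law_of_\<Theta>:
  assumes [measurable]: "g \<in> borel_measurable borel"
  shows "(\<integral>\<^sup>+\<omega>. g (\<Theta> \<omega>) \<partial>Q) = prior_integral lam p0 g"
proof -
  let ?E = "{\<omega>\<in>space Q. 0 < \<Theta> \<omega>}" and ?Z = "{\<omega>\<in>space Q. \<Theta> \<omega> = 0}"
  have pE: "prob ?E = 1 - p0" using \<Theta>_tail[of 0] by simp
  let ?I = "\<integral>\<^sup>+r. ennreal (exponential_density lam r) * g r \<partial>lborel"
  have E: "(\<integral>\<^sup>+\<omega>. g (\<Theta> \<omega>) * indicator ?E \<omega> \<partial>Q) = ennreal (1 - p0) * ?I"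
  proof (cases "p0 = 1")
    case True
    then have "?E \<in> null_sets Q" using pE by (auto simp: null_sets_def emeasure_eq_measure)
    then have "AE \<omega> in Q. \<omega> \<notin> ?E" by (rule AE_not_in)
    then have "(\<integral>\<^sup>+\<omega>. g (\<Theta> \<omega>) * indicator ?E \<omega> \<partial>Q) = (\<integral>\<^sup>+\<omega>. 0 \<partial>Q)"
      by (intro nn_integral_cong_AE) (auto elim!: eventually_mono)
    then show ?thesis using True by simp
  next
    case False
    then have p: "0 < 1 - p0" using p0 by simp
    have eE: "emeasure Q ?E = ennreal (1 - p0)" by (simp add: emeasure_eq_measure pE)
    let ?U = "uniform_measure Q ?E"
    have "prob_space ?U" using p eE by (intro prob_space_uniform_measure) auto
    then interpret U: prob_space ?U .
    have "distributed ?U lborel \<Theta> (exponential_density lam)"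
      unfolding U.exponential_distributed_iff[OF lam]
    proof (intro conjI allI impI)
      fix a :: real assume a: "0 \<le> a"
      have s: "{\<omega>\<in>space Q. \<Theta> \<omega> \<le> a} \<inter> ?E = ?E - {\<omega>\<in>space Q. a < \<Theta> \<omega>}" using a by auto
      have "U.prob {\<omega>\<in>space ?U. \<Theta> \<omega> \<le> a} = prob ({\<omega>\<in>space Q. \<Theta> \<omega> \<le> a} \<inter> ?E) / prob ?E"
        using p eE by (subst measure_uniform_measure) (auto simp: Int_commute)
      also have "prob ({\<omega>\<in>space Q. \<Theta> \<omega> \<le> a} \<inter> ?E) = (1 - p0) - (1 - p0) * exp (- lam * a)"
        unfolding s using a by (subst finite_measure_Diff) (auto simp: pE \<Theta>_tail)
      finally show "U.prob {\<omega>\<in>space ?U. \<Theta> \<omega> \<le> a} = 1 - exp (- a * lam)"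
        unfolding pE using p by (simp add: diff_divide_distrib mult.commute[of a])
    qed simp
    then have "?I = (\<integral>\<^sup>+\<omega>. g (\<Theta> \<omega>) \<partial>?U)"
      by (intro distributed_nn_integral) auto
    also have "\<dots> = (\<integral>\<^sup>+\<omega>. g (\<Theta> \<omega>) * indicator ?E \<omega> \<partial>Q) / ennreal (1 - p0)"
      by (subst nn_integral_uniform_measure) (auto simp: eE)
    finally have I: "?I = (\<integral>\<^sup>+\<omega>. g (\<Theta> \<omega>) * indicator ?E \<omega> \<partial>Q) / ennreal (1 - p0)" .
    show ?thesis unfolding I using p
      by (simp add: ennreal_times_divide mult_divide_eq_ennreal mult.commute[of "ennreal (1 - p0)"])
  qed
  have "(\<integral>\<^sup>+\<omega>. g (\<Theta> \<omega>) \<partial>Q) = (\<integral>\<^sup>+\<omega>. g 0 * indicator ?Z \<omega> + g (\<Theta> \<omega>) * indicator ?E \<omega> \<partial>Q)"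
    using \<Theta>_nonneg by (intro nn_integral_cong) (auto simp: indicator_def less_le)
  also have "\<dots> = g 0 * emeasure Q ?Z + ennreal (1 - p0) * ?I"
    by (subst nn_integral_add) (auto simp: nn_integral_cmult_indicator E)
  finally show ?thesis unfolding prior_integral_def by (simp add: emeasure_eq_measure \<Theta>_zero mult.commute)
qed

end

context admissible_model
begin

lemma remaining_Q [measurable]: "remaining k \<in> borel_measurable Q"
  unfolding remaining_def[abs_def] by measurable

lemma sets_info: "sets (info k) = {history k -` C \<inter> space Q | C. C \<in> sets (history_space k)}"
  unfolding info_def by (intro sets_vimage_algebra2 funcsetI history_space_pair)

text \<open>Both sides are integrals of \<open>h\<close> against finite measures on \<open>info k \<Otimes>\<^sub>M borel\<close>: the law of the outcome
  with the remaining time, and the law of the outcome with a variable that is drawn with the current belief. They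
  agree as soon as they agree on rectangles.\<close>

lemma filter_extend:
  assumes rect: "\<And>A B. A \<in> sets (info k) \<Longrightarrow> B \<in> sets borel \<Longrightarrow>
      (\<integral>\<^sup>+\<omega>. indicator (reached k) \<omega> * (indicator A \<omega> * indicator B (remaining k \<omega>)) \<partial>Q)
    = (\<integral>\<^sup>+\<omega>. indicator (reached k) \<omega> * (indicator A \<omega> * prior_integral lam (belief k \<omega>) (indicator B)) \<partial>Q)"
    and h: "h \<in> borel_measurable (info k \<Otimes>\<^sub>M borel)"
  shows "(\<integral>\<^sup>+\<omega>. indicator (reached k) \<omega> * h (\<omega>, remaining k \<omega>) \<partial>Q)
       = (\<integral>\<^sup>+\<omega>. indicator (reached k) \<omega> * prior_integral lam (belief k \<omega>) (\<lambda>r. h (\<omega>, r)) \<partial>Q)"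
proof -
  let ?D = "density Q (indicator (reached k))"
  let ?G = "info k"
  interpret B: sigma_finite_measure "prior_base lam" by (rule prior_base_sigma_finite(2)[OF lam])
  note sb = prior_base_sigma_finite(3)[OF lam]
  have [measurable]: "(\<lambda>\<omega>. \<omega>) \<in> measurable Q ?G" by (rule info_events)
  define M1 where "M1 = distr ?D (?G \<Otimes>\<^sub>M borel) (\<lambda>\<omega>. (\<omega>, remaining k \<omega>))"
  define g where "g = (\<lambda>(\<omega>, b). (\<omega>, if fst b < belief k \<omega> then 0 else snd b :: real))"
  define M2 where "M2 = distr (?D \<Otimes>\<^sub>M prior_base lam) (?G \<Otimes>\<^sub>M borel) g"
  have g0: "g \<in> measurable (Q \<Otimes>\<^sub>M (borel \<Otimes>\<^sub>M borel)) (?G \<Otimes>\<^sub>M borel)"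
    unfolding g_def by measurable
  have g: "g \<in> measurable (?D \<Otimes>\<^sub>M prior_base lam) (?G \<Otimes>\<^sub>M borel)"
    using g0 measurable_cong_sets[OF sets_pair_measure_cong[OF _ sb] refl] by (metis sets_density)
  have F1: "integral\<^sup>N M1 h = (\<integral>\<^sup>+\<omega>. indicator (reached k) \<omega> * h (\<omega>, remaining k \<omega>) \<partial>Q)"
    if h: "h \<in> borel_measurable (?G \<Otimes>\<^sub>M borel)" for h
  proof -
    have "(\<lambda>\<omega>. (\<omega>, remaining k \<omega>)) \<in> measurable Q (?G \<Otimes>\<^sub>M borel)" by measurable
    then show ?thesis unfolding M1_def using h
      by (subst nn_integral_distr, simp, simp, subst nn_integral_density) (auto intro: measurable_compose)
  qed
  have F2: "integral\<^sup>N M2 h = (\<integral>\<^sup>+\<omega>. indicator (reached k) \<omega> * prior_integral lam (belief k \<omega>) (\<lambda>r. h (\<omega>, r)) \<partial>Q)"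
    if h: "h \<in> borel_measurable (?G \<Otimes>\<^sub>M borel)" for h
  proof -
    have hg: "(\<lambda>x. h (g x)) \<in> borel_measurable (?D \<Otimes>\<^sub>M prior_base lam)" using measurable_compose[OF g h] .
    have "integral\<^sup>N M2 h = (\<integral>\<^sup>+x. h (g x) \<partial>(?D \<Otimes>\<^sub>M prior_base lam))"
      unfolding M2_def using g h by (simp add: nn_integral_distr)
    also have "\<dots> = (\<integral>\<^sup>+\<omega>. \<integral>\<^sup>+b. h (g (\<omega>, b)) \<partial>prior_base lam \<partial>?D)"
      by (rule B.nn_integral_fst[OF hg, symmetric])
    also have "\<dots> = (\<integral>\<^sup>+\<omega>. prior_integral lam (belief k \<omega>) (\<lambda>r. h (\<omega>, r)) \<partial>?D)"
    proof (rule nn_integral_cong)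
      fix \<omega> assume "\<omega> \<in> space ?D"
      then have "(\<lambda>r. h (\<omega>, r)) \<in> borel_measurable borel"
        using measurable_compose[OF measurable_Pair1' h] by simp
      from prior_integral_base[OF lam belief_bounds this, of k \<omega>]
      show "(\<integral>\<^sup>+b. h (g (\<omega>, b)) \<partial>prior_base lam) = prior_integral lam (belief k \<omega>) (\<lambda>r. h (\<omega>, r))"
        by (simp add: g_def)
    qed
    also have "\<dots> = (\<integral>\<^sup>+\<omega>. indicator (reached k) \<omega> * prior_integral lam (belief k \<omega>) (\<lambda>r. h (\<omega>, r)) \<partial>Q)"
    proof (rule nn_integral_density)
      have "(\<lambda>\<omega>. prior_integral lam (belief k \<omega>) (\<lambda>r. h (\<omega>, r))) \<in> borel_measurable ?G"
        using h belief_info[of k k] by (intro prior_integral_measurable) (simp_all add: case_prod_eta)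
      then show "(\<lambda>\<omega>. prior_integral lam (belief k \<omega>) (\<lambda>r. h (\<omega>, r))) \<in> borel_measurable Q"
        by (rule info_measurable_Q)
    qed simp
    finally show ?thesis .
  qed
  have "M1 = M2"
  proof (rule rectangle_measure_eqI)
    show s: "sets M1 = sets (?G \<Otimes>\<^sub>M borel)" "sets M2 = sets (?G \<Otimes>\<^sub>M borel)" unfolding M1_def M2_def by auto
    have "finite_measure ?D"
      by standard (simp add: emeasure_density emeasure_eq_measure)
    then have "finite_measure M1" unfolding M1_def by (rule finite_measure.finite_measure_distr) simp
    then show "emeasure M1 (space M1) \<noteq> \<infinity>" by (simp add: finite_measure.emeasure_finite)
    fix A B assume A: "A \<in> sets ?G" and B: "B \<in> sets (borel :: real measure)"
    have AB: "A \<times> B \<in> sets (?G \<Otimes>\<^sub>M borel)" using A B by auto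
    have "emeasure M1 (A \<times> B) = integral\<^sup>N M1 (indicator (A \<times> B))" using AB s by simp
    also have "\<dots> = integral\<^sup>N M2 (indicator (A \<times> B))"
    proof -
      have *: "prior_integral lam p (\<lambda>r. indicator (A \<times> B) (\<omega>, r)) = indicator A \<omega> * prior_integral lam p (indicator B)" for p \<omega>
        by (cases "\<omega> \<in> A") (auto simp: prior_integral_def indicator_times)
      show ?thesis using AB rect[OF A B] by (simp add: F1 F2 *) (simp add: indicator_times)
    qed
    also have "\<dots> = emeasure M2 (A \<times> B)" using AB s by simp
    finally show "emeasure M1 (A \<times> B) = emeasure M2 (A \<times> B)" .
  qed
  then show ?thesis using F1[OF h] F2[OF h] by simp
qed

text \<open>Only almost surely, because for \<open>k = 0\<close> the value is 0 by definition whereas \<open>X 0 = W 0\<close>.\<close>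

lemma obs_val_eq: "AE \<omega> in Q. \<omega> \<in> reached k \<longrightarrow> obs_val k \<omega> = X (clock k \<omega>) \<omega>"
proof (cases k)
  case 0
  have "AE \<omega> in Q. \<omega> \<in> space Q" by simp
  with W_zero show ?thesis
  proof eventually_elim
    case (elim \<omega>)
    then show ?case using \<Theta>_nonneg[of \<omega>]
      by (auto simp: 0 obs_val_def clock_def obs_time_def obs_process_def max_def)
  qed
next
  case (Suc j)
  then show ?thesis
    by (simp add: obs_val_def clock_def obs_time_def observation_def reached_def)
qed

lemma dynamics:
  "AE \<omega> in Q. \<omega> \<in> reached (Suc k) \<longrightarrow>
     jump k \<omega> = \<alpha> * max 0 (gap k \<omega> - remaining k \<omega>) + sqrt (gap k \<omega>) * noise k \<omega>
     \<and> remaining (Suc k) \<omega> = max 0 (remaining k \<omega> - gap k \<omega>)"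
  using obs_val_eq[of k] obs_val_eq[of "Suc k"]
proof eventually_elim
  case (elim \<omega>)
  show ?case
  proof
    assume r: "\<omega> \<in> reached (Suc k)"
    let ?s = "clock k \<omega>" and ?s' = "clock (Suc k) \<omega>"
    have lt: "?s < ?s'" using clock_less[OF r] .
    have v: "jump k \<omega> = X ?s' \<omega> - X ?s \<omega>" using elim r reached_Suc[of k] unfolding jump_def by auto
    have n: "sqrt (gap k \<omega>) * noise k \<omega> = W ?s' \<omega> - W ?s \<omega>"
      unfolding noise_def gap_def using lt by simp
    have m: "max 0 (?s' - \<Theta> \<omega>) - max 0 (?s - \<Theta> \<omega>) = max 0 (gap k \<omega> - remaining k \<omega>)"
      unfolding gap_def remaining_def using lt by (auto simp: max_def)
    have "jump k \<omega> = \<alpha> * (max 0 (?s' - \<Theta> \<omega>) - max 0 (?s - \<Theta> \<omega>)) + (W ?s' \<omega> - W ?s \<omega>)"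
      unfolding v obs_process_def by (simp add: algebra_simps)
    moreover have "remaining (Suc k) \<omega> = max 0 (remaining k \<omega> - gap k \<omega>)"
      unfolding gap_def remaining_def using lt by (auto simp: max_def)
    ultimately show "jump k \<omega> = \<alpha> * max 0 (gap k \<omega> - remaining k \<omega>) + sqrt (gap k \<omega>) * noise k \<omega>
     \<and> remaining (Suc k) \<omega> = max 0 (remaining k \<omega> - gap k \<omega>)" unfolding m n by simp
  qed
qed

lemma gap_info: "gap k \<in> borel_measurable (info k)"
  unfolding gap_def[abs_def] using clock_info[of k k] clock_Suc_info[of k] by measurable

text \<open>First the noise is integrated out by its independence, then the remaining time is integrated with its
  conditional law, which is the assumption \<open>filt\<close>, and finally Bayes' formula exchanges the two.\<close>

lemma one_step_aux:
  assumes filt: "\<And>h. h \<in> borel_measurable (info k \<Otimes>\<^sub>M borel) \<Longrightarrow>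
      (\<integral>\<^sup>+\<omega>. indicator (reached k) \<omega> * h (\<omega>, remaining k \<omega>) \<partial>Q)
       = (\<integral>\<^sup>+\<omega>. indicator (reached k) \<omega> * prior_integral lam (belief k \<omega>) (\<lambda>r. h (\<omega>, r)) \<partial>Q)"
    and H: "(\<lambda>(\<omega>, y, r). H \<omega> y r) \<in> borel_measurable (info k \<Otimes>\<^sub>M (borel \<Otimes>\<^sub>M borel))"
  shows "(\<integral>\<^sup>+\<omega>. indicator (reached (Suc k)) \<omega> * H \<omega> (jump k \<omega>) (remaining (Suc k) \<omega>) \<partial>Q)
    = (\<integral>\<^sup>+\<omega>. indicator (reached (Suc k)) \<omega> *
        (\<integral>\<^sup>+y. ennreal (obs_density lam \<alpha> (gap k \<omega>) (belief k \<omega>) y) *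
           prior_integral lam (posterior lam \<alpha> (gap k \<omega>) (belief k \<omega>) y) (H \<omega> y) \<partial>lborel) \<partial>Q)"
proof -
  let ?E = "reached (Suc k)"
  note [measurable] = gap_info[of k] reached_info(2)[of k]
  define h0 where "h0 \<omega> z r = H \<omega> (\<alpha> * max 0 (gap k \<omega> - r) + sqrt (gap k \<omega>) * z) (max 0 (r - gap k \<omega>))" for \<omega> z r
  have "(\<integral>\<^sup>+\<omega>. indicator ?E \<omega> * H \<omega> (jump k \<omega>) (remaining (Suc k) \<omega>) \<partial>Q)
      = (\<integral>\<^sup>+\<omega>. indicator ?E \<omega> * (\<lambda>(\<omega>, z). h0 \<omega> z (remaining k \<omega>)) (\<omega>, noise k \<omega>) \<partial>Q)"
    using dynamics[of k] by (intro nn_integral_cong_AE, eventually_elim) (auto simp: indicator_def h0_def)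
  also have "\<dots> = (\<integral>\<^sup>+\<omega>. indicator ?E \<omega> * (\<integral>\<^sup>+z. ennreal (std_normal_density z) * h0 \<omega> z (remaining k \<omega>) \<partial>lborel) \<partial>Q)"
  proof (subst noise_independent)
    have [measurable]: "gap k \<in> borel_measurable (full_info k)" by (rule full_measurable[OF gap_info])
    have [measurable]: "clock k \<in> borel_measurable (full_info k)" by (rule full_measurable[OF clock_info]) simp
    have [measurable]: "remaining k \<in> borel_measurable (full_info k)" unfolding remaining_def[abs_def] by measurable
    have [measurable]: "(\<lambda>x. x) \<in> measurable (full_info k) (info k)" by (rule info_full_info)
    have "(\<lambda>x. h0 (fst x) (snd x) (remaining k (fst x))) \<in> borel_measurable (full_info k \<Otimes>\<^sub>M borel)"
      unfolding h0_def
    proof (rule measurable_compose3[OF H])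
      show "fst \<in> measurable (full_info k \<Otimes>\<^sub>M borel) (info k)"
        using measurable_compose[OF measurable_fst info_full_info] .
    qed measurable
    then show "(\<lambda>(\<omega>, z). h0 \<omega> z (remaining k \<omega>)) \<in> borel_measurable (full_info k \<Otimes>\<^sub>M borel)"
      by (simp add: case_prod_beta')
  qed simp
  also have "\<dots> = (\<integral>\<^sup>+\<omega>. indicator (reached k) \<omega> *
        (\<lambda>(\<omega>, r). indicator ?E \<omega> * (\<integral>\<^sup>+z. ennreal (std_normal_density z) * h0 \<omega> z r \<partial>lborel)) (\<omega>, remaining k \<omega>) \<partial>Q)"
    using reached_Suc[of k] by (intro nn_integral_cong) (auto simp: indicator_def)
  also have "\<dots> = (\<integral>\<^sup>+\<omega>. indicator (reached k) \<omega> * prior_integral lam (belief k \<omega>)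
        (\<lambda>r. indicator ?E \<omega> * (\<integral>\<^sup>+z. ennreal (std_normal_density z) * h0 \<omega> z r \<partial>lborel)) \<partial>Q)"
  proof (subst filt)
    have "(\<lambda>x. h0 (fst (fst x)) (snd x) (snd (fst x))) \<in> borel_measurable ((info k \<Otimes>\<^sub>M borel) \<Otimes>\<^sub>M lborel)"
      unfolding h0_def by (rule measurable_compose3[OF H]) measurable
    then have [measurable]: "(\<lambda>(x, z). h0 (fst x) z (snd x)) \<in> borel_measurable ((info k \<Otimes>\<^sub>M borel) \<Otimes>\<^sub>M lborel)"
      by (simp add: case_prod_beta')
    have "(\<lambda>x. indicator ?E (fst x) * (\<integral>\<^sup>+z. ennreal (std_normal_density z) * h0 (fst x) z (snd x) \<partial>lborel))
      \<in> borel_measurable (info k \<Otimes>\<^sub>M borel)" by measurable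
    then show "(\<lambda>(\<omega>, r). indicator ?E \<omega> * (\<integral>\<^sup>+z. ennreal (std_normal_density z) * h0 \<omega> z r \<partial>lborel))
      \<in> borel_measurable (info k \<Otimes>\<^sub>M borel)" by (simp add: case_prod_beta')
  qed simp
  also have "\<dots> = (\<integral>\<^sup>+\<omega>. indicator ?E \<omega> *
        (\<integral>\<^sup>+y. ennreal (obs_density lam \<alpha> (gap k \<omega>) (belief k \<omega>) y) *
           prior_integral lam (posterior lam \<alpha> (gap k \<omega>) (belief k \<omega>) y) (H \<omega> y) \<partial>lborel) \<partial>Q)"
  proof (rule nn_integral_cong)
    fix \<omega> assume w: "\<omega> \<in> space Q"
    show "indicator (reached k) \<omega> * prior_integral lam (belief k \<omega>)
        (\<lambda>r. indicator ?E \<omega> * (\<integral>\<^sup>+z. ennreal (std_normal_density z) * h0 \<omega> z r \<partial>lborel))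
      = indicator ?E \<omega> * (\<integral>\<^sup>+y. ennreal (obs_density lam \<alpha> (gap k \<omega>) (belief k \<omega>) y) *
           prior_integral lam (posterior lam \<alpha> (gap k \<omega>) (belief k \<omega>) y) (H \<omega> y) \<partial>lborel)"
    proof (cases "\<omega> \<in> ?E")
      case True
      have Hw: "(\<lambda>(y, r). H \<omega> y r) \<in> borel_measurable (borel \<Otimes>\<^sub>M borel)"
        using measurable_compose[OF measurable_Pair1' H] w by simp
      show ?thesis using True reached_Suc[of k] bayes_formula[OF lam belief_bounds gap_pos[OF True] Hw]
        unfolding h0_def by auto
    next
      case False then show ?thesis by (simp add: prior_integral_def)
    qed
  qed
  finally show ?thesis .
qed

text \<open>By induction on \<open>k\<close>. An event of \<open>info (Suc k)\<close> is a condition on the old history, the new observation time, which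
  is known already at stage \<open>k\<close>, and the new increment. By the one-step formula, its joint law with the new
  remaining time is determined by the increment and the posterior weight. The one-step formula is then read
  backwards, for a function that is constant in the remaining time, to return to an integral over \<open>Q\<close>.\<close>

theorem filter_correct:
  assumes h: "h \<in> borel_measurable (info k \<Otimes>\<^sub>M borel)"
  shows "(\<integral>\<^sup>+\<omega>. indicator (reached k) \<omega> * h (\<omega>, remaining k \<omega>) \<partial>Q)
       = (\<integral>\<^sup>+\<omega>. indicator (reached k) \<omega> * prior_integral lam (belief k \<omega>) (\<lambda>r. h (\<omega>, r)) \<partial>Q)"
  using h
proof (induction k arbitrary: h)
  case 0
  show ?case
  proof (rule filter_extend[OF _ 0])
    fix A B assume A: "A \<in> sets (info 0)" and [measurable]: "B \<in> sets (borel :: real measure)"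
    have "A \<in> {history 0 -` C \<inter> space Q | C. C \<in> sets (history_space 0)}"
      using A by (simp only: sets_info)
    moreover have "history 0 \<omega> = (\<lambda>_. undefined)" for \<omega> unfolding history_def by auto
    ultimately have "A = {} \<or> A = space Q" by auto
    moreover have "(\<integral>\<^sup>+\<omega>. indicator (reached 0) \<omega> * (indicator (space Q) \<omega> * indicator B (remaining 0 \<omega>)) \<partial>Q)
       = (\<integral>\<^sup>+\<omega>. indicator B (\<Theta> \<omega>) \<partial>Q)"
      using \<Theta>_nonneg by (intro nn_integral_cong)
        (auto simp: reached_def obs_time_def remaining_def clock_def max_def)
    moreover have "(\<integral>\<^sup>+\<omega>. indicator (reached 0) \<omega> * (indicator (space Q) \<omega> * prior_integral lam (belief 0 \<omega>) (indicator B)) \<partial>Q)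
       = (\<integral>\<^sup>+\<omega>. prior_integral lam p0 (indicator B) \<partial>Q)"
      by (intro nn_integral_cong) (auto simp: reached_def obs_time_def)
    ultimately show "(\<integral>\<^sup>+\<omega>. indicator (reached 0) \<omega> * (indicator A \<omega> * indicator B (remaining 0 \<omega>)) \<partial>Q)
      = (\<integral>\<^sup>+\<omega>. indicator (reached 0) \<omega> * (indicator A \<omega> * prior_integral lam (belief 0 \<omega>) (indicator B)) \<partial>Q)"
      using law_of_\<Theta>[of "indicator B"] by (auto simp: emeasure_space_1)
  qed
next
  case (Suc k)
  show ?case
  proof (rule filter_extend[OF _ Suc.prems])
    fix A B assume A: "A \<in> sets (info (Suc k))" and B [measurable]: "B \<in> sets (borel :: real measure)"
    have "A \<in> {history (Suc k) -` C \<inter> space Q | C. C \<in> sets (history_space (Suc k))}"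
      using A by (simp only: sets_info)
    then obtain C where C [measurable]: "C \<in> sets (history_space (Suc k))" and AC: "A = history (Suc k) -` C \<inter> space Q" by auto
    note [measurable] = gap_info[of k] obs_time_Suc_info[of k] obs_val_info[of k k, simplified] belief_info[of k k, simplified]
      history_info[of k]
    define hist where "hist \<omega> y = (history k \<omega>)(k := (obs_time (Suc k) \<omega>, obs_val k \<omega> + y))" for \<omega> y
    have hist: "hist \<omega> (jump k \<omega>) = history (Suc k) \<omega>" for \<omega>
      unfolding hist_def history_def jump_def obs_time_def obs_val_def
      by (auto simp: fun_eq_iff observation_def)
    define H where "H \<omega> y r = indicator C (hist \<omega> y) * (indicator B r :: ennreal)" for \<omega> y r
    have "(\<lambda>x. (history k (fst x), (obs_time (Suc k) (fst x), obs_val k (fst x) + fst (snd x))))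
        \<in> measurable (info k \<Otimes>\<^sub>M (borel \<Otimes>\<^sub>M borel)) (history_space k \<Otimes>\<^sub>M (borel \<Otimes>\<^sub>M borel))" by measurable
    from measurable_compose[OF this measurable_add_dim[where i=k and I="{..<k}" and M="\<lambda>_. borel \<Otimes>\<^sub>M borel"]]
    have [measurable]: "(\<lambda>x. hist (fst x) (fst (snd x))) \<in> measurable (info k \<Otimes>\<^sub>M (borel \<Otimes>\<^sub>M (borel :: real measure))) (history_space (Suc k))"
      unfolding hist_def by (simp add: lessThan_Suc)
    have H: "(\<lambda>(\<omega>, y, r). H \<omega> y r) \<in> borel_measurable (info k \<Otimes>\<^sub>M (borel \<Otimes>\<^sub>M borel))"
      unfolding H_def case_prod_beta' by measurable
    define H' where "H' \<omega> y = prior_integral lam (posterior lam \<alpha> (gap k \<omega>) (belief k \<omega>) y) (H \<omega> y)" for \<omega> y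
    have H'0: "(\<lambda>x. H' (fst x) (fst (snd x))) \<in> borel_measurable (info k \<Otimes>\<^sub>M (borel \<Otimes>\<^sub>M (borel :: real measure)))"
      unfolding H'_def
    proof (rule prior_integral_measurable)
      have "(\<lambda>x. (fst (fst x), (fst (snd (fst x)), snd x)))
        \<in> measurable ((info k \<Otimes>\<^sub>M (borel \<Otimes>\<^sub>M (borel :: real measure))) \<Otimes>\<^sub>M borel) (info k \<Otimes>\<^sub>M (borel \<Otimes>\<^sub>M borel))" by measurable
      from measurable_compose[OF this H]
      show "(\<lambda>(x, r). H (fst x) (fst (snd x)) r) \<in> borel_measurable ((info k \<Otimes>\<^sub>M (borel \<Otimes>\<^sub>M (borel :: real measure))) \<Otimes>\<^sub>M borel)"
        by (simp add: case_prod_beta')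
    qed measurable
    then have H': "(\<lambda>(\<omega>, y, r). H' \<omega> y) \<in> borel_measurable (info k \<Otimes>\<^sub>M (borel \<Otimes>\<^sub>M (borel :: real measure)))"
      by (simp add: case_prod_beta')
    let ?E = "reached (Suc k)"
    have iA: "indicator A \<omega> = (indicator C (hist \<omega> (jump k \<omega>)) :: ennreal)" if "\<omega> \<in> space Q" for \<omega>
      unfolding hist AC using that by (auto simp: indicator_def)
    have "(\<integral>\<^sup>+\<omega>. indicator ?E \<omega> * (indicator A \<omega> * indicator B (remaining (Suc k) \<omega>)) \<partial>Q)
      = (\<integral>\<^sup>+\<omega>. indicator ?E \<omega> * H \<omega> (jump k \<omega>) (remaining (Suc k) \<omega>) \<partial>Q)"
      by (intro nn_integral_cong) (simp add: iA H_def)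
    also have "\<dots> = (\<integral>\<^sup>+\<omega>. indicator ?E \<omega> *
        (\<integral>\<^sup>+y. ennreal (obs_density lam \<alpha> (gap k \<omega>) (belief k \<omega>) y) * H' \<omega> y \<partial>lborel) \<partial>Q)"
      unfolding H'_def by (rule one_step_aux[OF Suc.IH H])
    also have "\<dots> = (\<integral>\<^sup>+\<omega>. indicator ?E \<omega> *
        (\<integral>\<^sup>+y. ennreal (obs_density lam \<alpha> (gap k \<omega>) (belief k \<omega>) y) *
           prior_integral lam (posterior lam \<alpha> (gap k \<omega>) (belief k \<omega>) y) (\<lambda>_. H' \<omega> y) \<partial>lborel) \<partial>Q)"
      by (simp add: prior_integral_const[OF lam posterior_bounds[OF lam belief_bounds]])
    also have "\<dots> = (\<integral>\<^sup>+\<omega>. indicator ?E \<omega> * H' \<omega> (jump k \<omega>) \<partial>Q)"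
      by (rule one_step_aux[OF Suc.IH H', symmetric])
    also have "\<dots> = (\<integral>\<^sup>+\<omega>. indicator ?E \<omega> * (indicator A \<omega> * prior_integral lam (belief (Suc k) \<omega>) (indicator B)) \<partial>Q)"
    proof (rule nn_integral_cong)
      fix \<omega> assume w: "\<omega> \<in> space Q"
      have "H' \<omega> (jump k \<omega>) = prior_integral lam (belief (Suc k) \<omega>) (\<lambda>r. indicator A \<omega> * indicator B r)"
        unfolding H'_def H_def belief_Suc iA[OF w] ..
      also have "\<dots> = indicator A \<omega> * prior_integral lam (belief (Suc k) \<omega>) (indicator B)"
        by (cases "\<omega> \<in> A") (auto simp: prior_integral_def)
      finally show "indicator ?E \<omega> * H' \<omega> (jump k \<omega>) = indicator ?E \<omega> * (indicator A \<omega> * prior_integral lam (belief (Suc k) \<omega>) (indicator B))" by simp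
    qed
    finally show "(\<integral>\<^sup>+\<omega>. indicator ?E \<omega> * (indicator A \<omega> * indicator B (remaining (Suc k) \<omega>)) \<partial>Q)
      = (\<integral>\<^sup>+\<omega>. indicator ?E \<omega> * (indicator A \<omega> * prior_integral lam (belief (Suc k) \<omega>) (indicator B)) \<partial>Q)" .
  qed
qed

lemmas one_step = one_step_aux[OF filter_correct]

lemma filter_on:
  assumes E: "E \<in> sets (info k)" "E \<subseteq> reached k" and h: "h \<in> borel_measurable (info k \<Otimes>\<^sub>M borel)"
  shows "(\<integral>\<^sup>+\<omega>. indicator E \<omega> * h (\<omega>, remaining k \<omega>) \<partial>Q)
    = (\<integral>\<^sup>+\<omega>. indicator E \<omega> * prior_integral lam (belief k \<omega>) (\<lambda>r. h (\<omega>, r)) \<partial>Q)"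
proof -
  note [measurable] = E(1) h
  have "(\<lambda>x. indicator E (fst x) * h x) \<in> borel_measurable (info k \<Otimes>\<^sub>M borel)" by measurable
  note filter_correct[OF this]
  moreover have "indicator (reached k) \<omega> * (indicator E (fst (\<omega>, r)) * h (\<omega>, r)) = indicator E \<omega> * h (\<omega>, r)" for \<omega> r
    using E(2) by (auto simp: indicator_def)
  moreover have "indicator (reached k) \<omega> * prior_integral lam (belief k \<omega>) (\<lambda>r. indicator E (fst (\<omega>, r)) * h (\<omega>, r))
     = indicator E \<omega> * prior_integral lam (belief k \<omega>) (\<lambda>r. h (\<omega>, r))" for \<omega>
    using E(2) by (cases "\<omega> \<in> E") (auto simp: prior_integral_def)
  ultimately show ?thesis by simp
qed

text \<open>The conditional expectations needed for one stage, integrated over an event that is known at the \<open>k\<close>-th observation: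
  of the loss by stopping, of the delay up to a later time, and of a function of the next belief.\<close>

lemma stop_identity:
  assumes E: "E \<in> sets (info k)" "E \<subseteq> reached k" and s: "s \<in> borel_measurable (info k)" "\<And>\<omega>. 0 \<le> s \<omega>"
  shows "(\<integral>\<^sup>+\<omega>. indicator E \<omega> * (indicator {s \<omega><..} (remaining k \<omega>) + ennreal c * ennreal (max 0 (s \<omega> - remaining k \<omega>))) \<partial>Q)
    = (\<integral>\<^sup>+\<omega>. indicator E \<omega> * ennreal (stop_cost (belief k \<omega>) (s \<omega>)) \<partial>Q)"
proof -
  let ?h = "\<lambda>x. indicator {s (fst x)<..} (snd x) + ennreal c * ennreal (max 0 (s (fst x) - snd x))"
  note [measurable] = s(1)
  have "?h \<in> borel_measurable (info k \<Otimes>\<^sub>M borel)"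
    unfolding indicator_def greaterThan_iff by measurable
  from filter_on[OF E this] show ?thesis
    by (simp only: fst_conv snd_conv prior_integral_stop[OF belief_bounds s(2)])
qed

lemma delay_identity:
  assumes E: "E \<in> sets (info k)" "E \<subseteq> reached k" and s: "s \<in> borel_measurable (info k)" "\<And>\<omega>. \<omega> \<in> E \<Longrightarrow> 0 \<le> s \<omega>"
  shows "(\<integral>\<^sup>+\<omega>. indicator E \<omega> * (ennreal c * ennreal (max 0 (s \<omega> - remaining k \<omega>))) \<partial>Q)
    = (\<integral>\<^sup>+\<omega>. indicator E \<omega> * ennreal (delay_cost (belief k \<omega>) (s \<omega>)) \<partial>Q)"
proof -
  let ?h = "\<lambda>x. ennreal c * ennreal (max 0 (s (fst x) - snd x))"
  note [measurable] = s(1)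
  have "?h \<in> borel_measurable (info k \<Otimes>\<^sub>M borel)" by measurable
  from filter_on[OF E this] show ?thesis
    using prior_integral_delay[OF belief_bounds s(2)] by (auto intro!: nn_integral_cong simp: indicator_def)
qed

lemma belief_identity:
  assumes E: "E \<in> sets (info k)" "E \<subseteq> reached (Suc k)" and g: "g \<in> FF"
  shows "(\<integral>\<^sup>+\<omega>. indicator E \<omega> * ennreal (g (belief (Suc k) \<omega>)) \<partial>Q)
    = (\<integral>\<^sup>+\<omega>. indicator E \<omega> * ennreal (next_value g (belief k \<omega>) (gap k \<omega>)) \<partial>Q)"
proof -
  let ?H = "\<lambda>\<omega> y r::real. indicator E \<omega> * ennreal (g (posterior lam \<alpha> (gap k \<omega>) (belief k \<omega>) y))"
  note [measurable] = E(1) gap_info[of k] belief_info[of k k, simplified]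
  have "(\<lambda>x. g (posterior lam \<alpha> (gap k (fst x)) (belief k (fst x)) (fst (snd x))))
     \<in> borel_measurable (info k \<Otimes>\<^sub>M (borel \<Otimes>\<^sub>M (borel :: real measure)))"
    by (rule FF_compose_measurable[OF g]) (measurable, simp add: posterior_bounds[OF lam belief_bounds])
  then have H: "(\<lambda>(\<omega>, y, r). ?H \<omega> y r) \<in> borel_measurable (info k \<Otimes>\<^sub>M (borel \<Otimes>\<^sub>M borel))"
    unfolding case_prod_beta' by measurable
  have "(\<integral>\<^sup>+\<omega>. indicator E \<omega> * ennreal (g (belief (Suc k) \<omega>)) \<partial>Q)
     = (\<integral>\<^sup>+\<omega>. indicator (reached (Suc k)) \<omega> * ?H \<omega> (jump k \<omega>) (remaining (Suc k) \<omega>) \<partial>Q)"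
    using E(2) by (intro nn_integral_cong) (auto simp: indicator_def belief_Suc simp del: belief.simps)
  also have "\<dots> = (\<integral>\<^sup>+\<omega>. indicator (reached (Suc k)) \<omega> *
        (\<integral>\<^sup>+y. ennreal (obs_density lam \<alpha> (gap k \<omega>) (belief k \<omega>) y) *
           prior_integral lam (posterior lam \<alpha> (gap k \<omega>) (belief k \<omega>) y) (?H \<omega> y) \<partial>lborel) \<partial>Q)"
    by (rule one_step[OF _ H])
  also have "\<dots> = (\<integral>\<^sup>+\<omega>. indicator E \<omega> * ennreal (next_value g (belief k \<omega>) (gap k \<omega>)) \<partial>Q)"
  proof (rule nn_integral_cong)
    fix \<omega>
    show "indicator (reached (Suc k)) \<omega> *
        (\<integral>\<^sup>+y. ennreal (obs_density lam \<alpha> (gap k \<omega>) (belief k \<omega>) y) *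
           prior_integral lam (posterior lam \<alpha> (gap k \<omega>) (belief k \<omega>) y) (?H \<omega> y) \<partial>lborel)
      = indicator E \<omega> * ennreal (next_value g (belief k \<omega>) (gap k \<omega>))"
    proof (cases "\<omega> \<in> E")
      case True
      then have r: "\<omega> \<in> reached (Suc k)" using E(2) by auto
      show ?thesis using True r next_value_integrable(4)[OF g belief_bounds gap_pos[OF r]]
        by (simp add: prior_integral_const[OF lam posterior_bounds[OF lam belief_bounds]])
    next
      case False then show ?thesis by (simp add: prior_integral_def)
    qed
  qed
  finally show ?thesis .
qed

end


section \<open>The cost of an admissible strategy\<close>

locale stopped_model = admissible_model +
  fixes T :: "'a \<Rightarrow> ennreal"
  assumes stopping: "stopping_time (obs_filtration (space Q) X \<tau>) T"

context observed_model
begin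

text \<open>The record that generates the observation filtration at time \<open>t\<close>.\<close>

definition visible :: "ennreal \<Rightarrow> 'a \<Rightarrow> nat \<Rightarrow> ennreal \<times> real" where
  "visible t \<omega> i = (if \<tau> i \<omega> \<le> t then observation X \<tau> i \<omega> else (\<top>, 0))"

lemma sets_obs_filtration:
  "sets (obs_filtration (space Q) X \<tau> t) =
     {visible t -` C \<inter> space Q | C. C \<in> sets (\<Pi>\<^sub>M i\<in>UNIV. borel \<Otimes>\<^sub>M borel)}"
  unfolding obs_filtration_def visible_def[symmetric]
  by (rule sets_vimage_algebra2) (auto simp: space_PiM space_pair_measure)

lemma space_obs_filtration [simp]: "space (obs_filtration (space Q) X \<tau> t) = space Q"
  by (simp add: obs_filtration_def)

lemma fst_observation: "fst (observation X \<tau> i \<omega>) = \<tau> i \<omega>"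
  by (simp add: observation_def)

end

context admissible_model
begin

text \<open>Once the \<open>k\<close>-th observation is made, the first \<open>k\<close> entries of the record are the history. The condition on
  the entry with number \<open>k - 1\<close> recognises from the record whether this is so.\<close>

lemma info_visible:
  assumes A: "A \<in> sets (info k)" and le: "\<And>\<omega>. \<omega> \<in> A \<Longrightarrow> obs_time k \<omega> \<le> t"
  shows "A \<in> sets (obs_filtration (space Q) X \<tau> t)"
proof -
  obtain C where C: "C \<in> sets (history_space k)" and AC: "A = history k -` C \<inter> space Q"
    using A unfolding sets_info by auto
  let ?U = "\<Pi>\<^sub>M i\<in>UNIV. (borel :: ennreal measure) \<Otimes>\<^sub>M (borel :: real measure)"
  define D where "D = {x\<in>space ?U. (k = 0 \<or> fst (x (k - 1)) \<le> t) \<and> restrict x {..<k} \<in> C}"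
  have [measurable]: "(\<lambda>x. restrict x {..<k}) \<in> measurable ?U (history_space k)"
    by (rule measurable_restrict_subset) auto
  have [measurable]: "C \<in> sets (history_space k)" by fact
  have D: "D \<in> sets ?U" unfolding D_def by measurable
  have vis: "restrict (visible t \<omega>) {..<k} = history k \<omega>" if "\<omega> \<in> space Q" "obs_time k \<omega> \<le> t" for \<omega>
  proof (rule ext)
    fix i
    show "restrict (visible t \<omega>) {..<k} i = history k \<omega> i"
    proof (cases "i < k")
      case True
      then have "\<tau> i \<omega> \<le> obs_time k \<omega>" using obs_time_mono[OF that(1), of "Suc i" k] by (simp add: obs_time_def)
      then show ?thesis using True that(2) by (auto simp: visible_def history_def)
    qed (simp add: history_def)
  qed
  have "\<omega> \<in> A \<longleftrightarrow> visible t \<omega> \<in> D" if w: "\<omega> \<in> space Q" for \<omega>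
  proof (cases "obs_time k \<omega> \<le> t")
    case True
    have "k = 0 \<or> fst (visible t \<omega> (k - 1)) \<le> t"
      using True by (cases k) (auto simp: visible_def fst_observation obs_time_def)
    then show ?thesis unfolding D_def AC using vis[OF w True] w by (auto simp: space_PiM space_pair_measure)
  next
    case False
    have "\<not> (k = 0 \<or> fst (visible t \<omega> (k - 1)) \<le> t)"
      using False by (cases k) (auto simp: visible_def fst_observation obs_time_def top_unique)
    moreover have "\<omega> \<notin> A" using le False by auto
    ultimately show ?thesis unfolding D_def by auto
  qed
  then have "A = visible t -` D \<inter> space Q" using AC by auto
  then show ?thesis unfolding sets_obs_filtration using D by auto
qed

lemma obs_filtration_events: "sets (obs_filtration (space Q) X \<tau> t) \<subseteq> sets Q"
proof -
  have "(\<lambda>\<omega> i. visible t \<omega> i) \<in> measurable Q (\<Pi>\<^sub>M i\<in>UNIV. borel \<Otimes>\<^sub>M borel)"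
  proof (rule measurable_abs_UNIV)
    fix i
    have [measurable]: "observation X \<tau> i \<in> measurable Q (borel \<Otimes>\<^sub>M borel)"
      using info_measurable_Q[OF observation_info[of i "Suc i"]] by simp
    have [measurable]: "\<tau> i \<in> borel_measurable Q" using info_measurable_Q[OF \<tau>_info] .
    show "(\<lambda>\<omega>. visible t \<omega> i) \<in> measurable Q (borel \<Otimes>\<^sub>M borel)"
      unfolding visible_def by measurable
  qed
  from measurable_sets[OF this] show ?thesis unfolding sets_obs_filtration by auto
qed

end

context stopped_model
begin

lemma T_le_filtration: "{\<omega>\<in>space Q. T \<omega> \<le> t} \<in> sets (obs_filtration (space Q) X \<tau> t)"
  using stopping unfolding stopping_time_def pred_def by simp

lemma T_Q [measurable]: "T \<in> borel_measurable Q"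
  using T_le_filtration obs_filtration_events by (intro borel_measurableI_le) blast

text \<open>Before the next observation is made, the record at time \<open>t\<close> is the history of the first \<open>k\<close> observations,
  truncated at \<open>t\<close>.\<close>

lemma stopped_by_before_next: "{\<omega>\<in>space Q. T \<omega> \<le> t \<and> t < obs_time (Suc k) \<omega>} \<in> sets (info k)"
proof -
  let ?U = "\<Pi>\<^sub>M i\<in>UNIV. (borel :: ennreal measure) \<Otimes>\<^sub>M (borel :: real measure)"
  obtain C where C: "C \<in> sets ?U" and TC: "{\<omega>\<in>space Q. T \<omega> \<le> t} = visible t -` C \<inter> space Q"
    using T_le_filtration[of t] unfolding sets_obs_filtration by auto
  define trunc :: "(nat \<Rightarrow> ennreal \<times> real) \<Rightarrow> nat \<Rightarrow> ennreal \<times> real"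
    where "trunc x i = (if i < k then (if fst (x i) \<le> t then x i else (\<top>, 0)) else (\<top>, 0))" for x i
  have tm: "(\<lambda>x i. trunc x i) \<in> measurable (history_space k) ?U"
  proof (rule measurable_abs_UNIV)
    fix i show "(\<lambda>x. trunc x i) \<in> measurable (history_space k) (borel \<Otimes>\<^sub>M borel)"
    proof (cases "i < k")
      case True
      then have [measurable]: "(\<lambda>x. x i) \<in> measurable (history_space k) (borel \<Otimes>\<^sub>M borel)"
        by (intro measurable_component_singleton) auto
      show ?thesis unfolding trunc_def using True by simp
    qed (simp add: trunc_def)
  qed
  have TC': "T \<omega> \<le> t \<longleftrightarrow> visible t \<omega> \<in> C" if "\<omega> \<in> space Q" for \<omega> using TC that by blast
  have "visible t \<omega> = trunc (history k \<omega>)" if "\<omega> \<in> space Q" "t < obs_time (Suc k) \<omega>" for \<omega>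
  proof (rule ext)
    fix i
    show "visible t \<omega> i = trunc (history k \<omega>) i"
    proof (cases "i < k")
      case True then show ?thesis by (simp add: visible_def trunc_def history_def fst_observation)
    next
      case False
      then have "obs_time (Suc k) \<omega> \<le> \<tau> i \<omega>"
        using obs_time_mono[OF that(1), of "Suc k" "Suc i"] by (simp add: obs_time_def)
      then have "\<not> \<tau> i \<omega> \<le> t" using that(2) by auto
      then show ?thesis using False by (simp add: visible_def trunc_def)
    qed
  qed
  then have "{\<omega>\<in>space Q. T \<omega> \<le> t \<and> t < obs_time (Suc k) \<omega>}
     = ((\<lambda>\<omega>. trunc (history k \<omega>)) -` C \<inter> space (info k)) \<inter> {\<omega>\<in>space (info k). t < obs_time (Suc k) \<omega>}"
    using TC' by auto
  also have "\<dots> \<in> sets (info k)"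
  proof (rule sets.Int)
    show "(\<lambda>\<omega>. trunc (history k \<omega>)) -` C \<inter> space (info k) \<in> sets (info k)"
      using measurable_compose[OF history_info tm] C by (rule measurable_sets)
    note [measurable] = obs_time_Suc_info[of k]
    show "{\<omega>\<in>space (info k). t < obs_time (Suc k) \<omega>} \<in> sets (info k)" by measurable
  qed
  finally show ?thesis .
qed

text \<open>If the stopping time is \<open>\<le> t\<close> and comes before an observation time that is itself \<open>\<le> t\<close>, then a rational time
  separates the two; this reduces the event to countably many of those in \<open>stopped_by_before_next\<close>.\<close>

lemma T_before_next_info: "(\<lambda>\<omega>. if T \<omega> < obs_time (Suc k) \<omega> then T \<omega> else \<top>) \<in> borel_measurable (info k)"
proof (rule borel_measurableI_le)
  fix t :: ennreal
  define q where "q r = ennreal (real_of_rat r)" for r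
  have "{\<omega>\<in>space (info k). (if T \<omega> < obs_time (Suc k) \<omega> then T \<omega> else \<top>) \<le> t}
     = (if t = \<top> then space (info k) else {\<omega>\<in>space Q. T \<omega> \<le> t \<and> t < obs_time (Suc k) \<omega>} \<union>
         (\<Union>r\<in>{r. q r \<le> t}. {\<omega>\<in>space Q. T \<omega> \<le> q r \<and> q r < obs_time (Suc k) \<omega>}))" (is "?L = ?R")
  proof (cases "t = \<top>")
    case False
    have "T \<omega> < obs_time (Suc k) \<omega> \<and> T \<omega> \<le> t \<longleftrightarrow> (T \<omega> \<le> t \<and> t < obs_time (Suc k) \<omega>) \<or>
       (\<exists>r\<in>{r. q r \<le> t}. T \<omega> \<le> q r \<and> q r < obs_time (Suc k) \<omega>)" for \<omega>
    proof
      assume a: "T \<omega> < obs_time (Suc k) \<omega> \<and> T \<omega> \<le> t"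
      show "(T \<omega> \<le> t \<and> t < obs_time (Suc k) \<omega>) \<or> (\<exists>r\<in>{r. q r \<le> t}. T \<omega> \<le> q r \<and> q r < obs_time (Suc k) \<omega>)"
      proof (cases "t < obs_time (Suc k) \<omega>")
        case False
        obtain r where "T \<omega> < q r" "q r < obs_time (Suc k) \<omega>"
          using ennreal_rat_dense[of "T \<omega>" "obs_time (Suc k) \<omega>"] a unfolding q_def by auto
        then show ?thesis using False by (intro disjI2 bexI[of _ r]) auto
      qed (use a in auto)
    qed auto
    then show ?thesis using False by (auto simp: top_unique)
  qed simp
  also have "?R \<in> sets (info k)"
    using stopped_by_before_next sets.top[of "info k"] by (auto intro!: sets.Un sets.countable_UN'')
  finally show "?L \<in> sets (info k)" .
qed

definition stopped_at :: "nat \<Rightarrow> 'a set" where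
  "stopped_at k = {\<omega>\<in>space Q. obs_time k \<omega> \<le> T \<omega> \<and> T \<omega> < obs_time (Suc k) \<omega>}"

definition continued_at :: "nat \<Rightarrow> 'a set" where
  "continued_at k = {\<omega>\<in>space Q. obs_time (Suc k) \<omega> \<le> T \<omega> \<and> obs_time (Suc k) \<omega> < \<top>}"

lemma before_next_info: "{\<omega>\<in>space Q. T \<omega> < obs_time (Suc k) \<omega>} \<in> sets (info k)"
proof -
  note [measurable] = T_before_next_info[of k]
  have "{\<omega>\<in>space (info k). (if T \<omega> < obs_time (Suc k) \<omega> then T \<omega> else \<top>) < \<top>} \<in> sets (info k)" by measurable
  also have "{\<omega>\<in>space (info k). (if T \<omega> < obs_time (Suc k) \<omega> then T \<omega> else \<top>) < \<top>}
     = {\<omega>\<in>space Q. T \<omega> < obs_time (Suc k) \<omega>}" by (auto simp: less_top[symmetric] top_unique)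
  finally show ?thesis .
qed

lemma stopped_at_info: "stopped_at k \<in> sets (info k)"
proof -
  note [measurable] = T_before_next_info[of k] obs_time_info[of k k, simplified]
  have "stopped_at k = {\<omega>\<in>space Q. T \<omega> < obs_time (Suc k) \<omega>} \<inter>
     {\<omega>\<in>space (info k). obs_time k \<omega> \<le> (if T \<omega> < obs_time (Suc k) \<omega> then T \<omega> else \<top>)}"
    unfolding stopped_at_def by auto
  also have "\<dots> \<in> sets (info k)" by (intro sets.Int before_next_info) measurable
  finally show ?thesis .
qed

lemma continued_at_info: "continued_at k \<in> sets (info k)"
proof -
  have "continued_at k = reached (Suc k) - {\<omega>\<in>space Q. T \<omega> < obs_time (Suc k) \<omega>}"
    unfolding continued_at_def reached_def by auto
  also have "\<dots> \<in> sets (info k)" by (intro sets.Diff reached_info before_next_info)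
  finally show ?thesis .
qed

lemma stopped_at_reached: "stopped_at k \<subseteq> reached k" and continued_at_reached: "continued_at k \<subseteq> reached (Suc k)"
  unfolding stopped_at_def continued_at_def reached_def by (auto intro: le_less_trans less_le_trans)

definition wait_time :: "nat \<Rightarrow> 'a \<Rightarrow> real" where
  "wait_time k \<omega> = (if \<omega> \<in> stopped_at k then enn2real (T \<omega>) - clock k \<omega> else 0)"

lemma wait_time_info: "wait_time k \<in> borel_measurable (info k)"
proof -
  note [measurable] = T_before_next_info[of k] clock_info[of k k, simplified] stopped_at_info[of k]
  have "wait_time k = (\<lambda>\<omega>. if \<omega> \<in> stopped_at k
      then enn2real (if T \<omega> < obs_time (Suc k) \<omega> then T \<omega> else \<top>) - clock k \<omega> else 0)"
    unfolding wait_time_def stopped_at_def by (auto simp: fun_eq_iff)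
  also have "\<dots> \<in> borel_measurable (info k)" by measurable
  finally show ?thesis .
qed

lemma wait_time_nonneg: "0 \<le> wait_time k \<omega>"
proof (cases "\<omega> \<in> stopped_at k")
  case True
  then have "obs_time k \<omega> \<le> T \<omega>" "T \<omega> < \<top>" unfolding stopped_at_def by (auto intro: less_le_trans)
  then show ?thesis using True unfolding wait_time_def clock_def by (simp add: enn2real_mono)
qed (simp add: wait_time_def)

definition stop_loss :: "'a \<Rightarrow> ennreal" where
  "stop_loss \<omega> = (if T \<omega> < ennreal (\<Theta> \<omega>) then 1 else 0) + ennreal c * (T \<omega> - ennreal (\<Theta> \<omega>))"

definition made :: "nat \<Rightarrow> 'a \<Rightarrow> ennreal" where
  "made k \<omega> = (\<Sum>i<k. if \<tau> i \<omega> \<le> T \<omega> then 1 else 0)"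

text \<open>The cost of a strategy that is broken off at the \<open>k\<close>-th observation, if it is not stopped before it, with \<open>g\<close> of
  the belief charged for the future. In the next definition the costs of the stage after that observation
  are replaced by their conditional expectations. The infinite value there belongs to
  the case that neither stopping nor observing ever happens again.\<close>

definition stage_cost :: "(real \<Rightarrow> real) \<Rightarrow> nat \<Rightarrow> 'a \<Rightarrow> ennreal" where
  "stage_cost g k \<omega> = ennreal d * made k \<omega> + (if T \<omega> < obs_time k \<omega> then stop_loss \<omega>
     else ennreal (g (belief k \<omega>)) + ennreal c * (obs_time k \<omega> - ennreal (\<Theta> \<omega>)))"

definition expected_stage_cost :: "(real \<Rightarrow> real) \<Rightarrow> nat \<Rightarrow> 'a \<Rightarrow> ennreal" where
  "expected_stage_cost g k \<omega> = ennreal d * made k \<omega> + (if T \<omega> < obs_time k \<omega> then stop_loss \<omega>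
     else if T \<omega> < obs_time (Suc k) \<omega> then ennreal (stop_cost (belief k \<omega>) (wait_time k \<omega>)) + ennreal c * (obs_time k \<omega> - ennreal (\<Theta> \<omega>))
     else if obs_time (Suc k) \<omega> < \<top> then ennreal (J0 g (belief k \<omega>) (gap k \<omega>)) + ennreal c * (obs_time k \<omega> - ennreal (\<Theta> \<omega>))
     else \<top>)"

lemma ennreal_pos_diff: "0 \<le> b \<Longrightarrow> ennreal a - ennreal b = ennreal (max 0 (a - b))"
  by (cases "b \<le> a") (auto simp: ennreal_minus ennreal_neg max_def)

lemma delay_split:
  assumes "0 \<le> th" "0 \<le> s" "s \<le> u"
  shows "ennreal u - ennreal th = ennreal (max 0 ((u - s) - max 0 (th - s))) + (ennreal s - ennreal th)"
proof -
  have "max 0 (u - th) = max 0 ((u - s) - max 0 (th - s)) + max 0 (s - th)" using assms by (auto simp: max_def)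
  then show ?thesis unfolding ennreal_pos_diff[OF assms(1)] by simp
qed

lemma \<tau>_Q [measurable]: "\<tau> i \<in> borel_measurable Q" by (rule info_measurable_Q[OF \<tau>_info])

lemma stop_loss_Q [measurable]: "stop_loss \<in> borel_measurable Q" and made_Q [measurable]: "made k \<in> borel_measurable Q"
  unfolding stop_loss_def[abs_def] made_def[abs_def] by measurable

text \<open>The integrands differ only in three terms: the loss by stopping, the future cost charged at the new belief, and the
  delay up to the next observation. Each is integrated over an event of \<open>info k\<close>, where the filter gives its
  conditional expectation.\<close>

lemma stage_cost_step:
  assumes g: "g \<in> FF"
  shows "(\<integral>\<^sup>+\<omega>. stage_cost g (Suc k) \<omega> \<partial>Q) = (\<integral>\<^sup>+\<omega>. expected_stage_cost g k \<omega> \<partial>Q)"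
proof -
  let ?E1 = "stopped_at k" and ?E2 = "continued_at k"
  let ?E0 = "{\<omega>\<in>space Q. T \<omega> < obs_time k \<omega>}" and ?E3 = "{\<omega>\<in>space Q. obs_time (Suc k) \<omega> \<le> T \<omega> \<and> obs_time (Suc k) \<omega> = \<top>}"
  define base where "base \<omega> = ennreal d * made k \<omega> + indicator ?E0 \<omega> * stop_loss \<omega>
      + indicator (?E1 \<union> ?E2) \<omega> * (ennreal c * (obs_time k \<omega> - ennreal (\<Theta> \<omega>))) + indicator ?E3 \<omega> * \<top>
      + indicator ?E2 \<omega> * ennreal d" for \<omega>
  define u1 where "u1 \<omega> = indicator ?E1 \<omega> * (indicator {wait_time k \<omega><..} (remaining k \<omega>)
       + ennreal c * ennreal (max 0 (wait_time k \<omega> - remaining k \<omega>)))" for \<omega>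
  define v1 where "v1 \<omega> = indicator ?E1 \<omega> * ennreal (stop_cost (belief k \<omega>) (wait_time k \<omega>))" for \<omega>
  define u2 where "u2 \<omega> = indicator ?E2 \<omega> * ennreal (g (belief (Suc k) \<omega>))" for \<omega>
  define v2 where "v2 \<omega> = indicator ?E2 \<omega> * ennreal (next_value g (belief k \<omega>) (gap k \<omega>))" for \<omega>
  define u3 where "u3 \<omega> = indicator ?E2 \<omega> * (ennreal c * ennreal (max 0 (gap k \<omega> - remaining k \<omega>)))" for \<omega>
  define v3 where "v3 \<omega> = indicator ?E2 \<omega> * ennreal (delay_cost (belief k \<omega>) (gap k \<omega>))" for \<omega>
  have eqs: "stage_cost g (Suc k) \<omega> = base \<omega> + (u1 \<omega> + (u2 \<omega> + u3 \<omega>))"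
    "expected_stage_cost g k \<omega> = base \<omega> + (v1 \<omega> + (v2 \<omega> + v3 \<omega>))" if w: "\<omega> \<in> space Q" for \<omega>
  proof -
    let ?th = "\<Theta> \<omega>"
    have th: "0 \<le> ?th" using \<Theta>_nonneg[OF w] .
    have made: "made (Suc k) \<omega> = made k \<omega> + (if obs_time (Suc k) \<omega> \<le> T \<omega> then 1 else 0)"
      unfolding made_def by (simp add: obs_time_def)
    have mono: "obs_time k \<omega> \<le> obs_time (Suc k) \<omega>" using obs_time_Suc_le[OF w] .
    consider (0) "T \<omega> < obs_time k \<omega>" | (1) "\<omega> \<in> ?E1" | (2) "\<omega> \<in> ?E2" | (3) "\<omega> \<in> ?E3"
      unfolding stopped_at_def continued_at_def using w
      by (cases "T \<omega> < obs_time k \<omega>"; cases "T \<omega> < obs_time (Suc k) \<omega>"; cases "obs_time (Suc k) \<omega> = \<top>")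
         (auto simp: not_less less_top[symmetric])
    then have "stage_cost g (Suc k) \<omega> = base \<omega> + (u1 \<omega> + (u2 \<omega> + u3 \<omega>)) \<and>
       expected_stage_cost g k \<omega> = base \<omega> + (v1 \<omega> + (v2 \<omega> + v3 \<omega>))"
    proof cases
      case 0
      then have "T \<omega> < obs_time (Suc k) \<omega>" using mono by simp
      then have "\<omega> \<in> ?E0" "\<omega> \<notin> ?E1" "\<omega> \<notin> ?E2" "\<omega> \<notin> ?E3" using 0 w unfolding stopped_at_def continued_at_def by auto
      then show ?thesis using 0 \<open>T \<omega> < obs_time (Suc k) \<omega>\<close> made
        unfolding stage_cost_def expected_stage_cost_def base_def u1_def u2_def u3_def v1_def v2_def v3_def by auto
    next
      case 1
      then have le: "obs_time k \<omega> \<le> T \<omega>" "T \<omega> < obs_time (Suc k) \<omega>" "T \<omega> < \<top>"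
        unfolding stopped_at_def by (auto intro: less_le_trans)
      have n: "\<omega> \<notin> ?E0" "\<omega> \<notin> ?E2" "\<omega> \<notin> ?E3" using le unfolding continued_at_def by auto
      obtain t where t: "T \<omega> = ennreal t" "0 \<le> t" using le(3) by (cases "T \<omega>") auto
      have "obs_time k \<omega> < \<top>" using le(1,3) by (rule le_less_trans)
      then obtain s where s: "obs_time k \<omega> = ennreal s" "0 \<le> s" by (cases "obs_time k \<omega>") auto
      have st: "s \<le> t" using le(1) t s by simp
      have wt: "wait_time k \<omega> = t - s" "remaining k \<omega> = max 0 (?th - s)"
        using 1 t s by (auto simp: wait_time_def clock_def remaining_def)
      have ind: "(if T \<omega> < ennreal ?th then 1 else 0) = (indicator {t - s<..} (max 0 (?th - s)) :: ennreal)"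
        using t st th by (auto simp: indicator_def ennreal_less_iff max_def)
      have "stop_loss \<omega> = (indicator {t - s<..} (max 0 (?th - s)) + ennreal c * ennreal (max 0 ((t - s) - max 0 (?th - s))))
         + ennreal c * (obs_time k \<omega> - ennreal ?th)"
        unfolding stop_loss_def ind unfolding t s delay_split[OF th s(2) st] by (simp add: distrib_left add_ac)
      then show ?thesis using 1 n le made
        unfolding stage_cost_def expected_stage_cost_def base_def u1_def u2_def u3_def v1_def v2_def v3_def wt
        by (auto simp: add_ac)
    next
      case 2
      then have le: "obs_time (Suc k) \<omega> \<le> T \<omega>" "obs_time (Suc k) \<omega> < \<top>" unfolding continued_at_def by auto
      have leT: "\<not> T \<omega> < obs_time k \<omega>" "\<not> T \<omega> < obs_time (Suc k) \<omega>" using le mono by auto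
      have n: "\<omega> \<notin> ?E0" "\<omega> \<notin> ?E1" "\<omega> \<notin> ?E3" using le leT unfolding stopped_at_def by auto
      obtain t where t: "obs_time (Suc k) \<omega> = ennreal t" "0 \<le> t" using le(2) by (cases "obs_time (Suc k) \<omega>") auto
      have "obs_time k \<omega> < \<top>" using mono le(2) by (rule le_less_trans)
      then obtain s where s: "obs_time k \<omega> = ennreal s" "0 \<le> s" by (cases "obs_time k \<omega>") auto
      have st: "s \<le> t" using mono t s by simp
      have gt: "gap k \<omega> = t - s" "remaining k \<omega> = max 0 (?th - s)"
        using t s by (auto simp: gap_def clock_def remaining_def)
      have gp: "0 < gap k \<omega>" using gap_pos 2 continued_at_reached by blast
      have "ennreal c * (obs_time (Suc k) \<omega> - ennreal ?th) = ennreal c * ennreal (max 0 ((t - s) - max 0 (?th - s)))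
         + ennreal c * (obs_time k \<omega> - ennreal ?th)"
        unfolding t s delay_split[OF th s(2) st] by (simp add: distrib_left)
      moreover have "ennreal (J0 g (belief k \<omega>) (gap k \<omega>)) = ennreal d + ennreal (next_value g (belief k \<omega>) (gap k \<omega>))
         + ennreal (delay_cost (belief k \<omega>) (gap k \<omega>))"
        unfolding J0_def using d gp next_value_integrable(2)[OF g belief_bounds gp] delay_cost_nonneg[OF belief_bounds, of "gap k \<omega>"]
        by simp
      ultimately show ?thesis using 2 n le leT made gt
        unfolding stage_cost_def expected_stage_cost_def base_def u1_def u2_def u3_def v1_def v2_def v3_def
        by (auto simp: add_ac distrib_left simp del: belief.simps)
    next
      case 3
      then have tp: "T \<omega> = \<top>" "obs_time (Suc k) \<omega> = \<top>" by (auto simp: top_unique)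
      have n: "\<omega> \<notin> ?E0" "\<omega> \<notin> ?E1" "\<omega> \<notin> ?E2" using tp unfolding stopped_at_def continued_at_def by auto
      then show ?thesis using 3 tp c made
        unfolding stage_cost_def expected_stage_cost_def base_def u1_def u2_def u3_def v1_def v2_def v3_def
        by (auto simp: ennreal_mult_top)
    qed
    then show "stage_cost g (Suc k) \<omega> = base \<omega> + (u1 \<omega> + (u2 \<omega> + u3 \<omega>))"
      "expected_stage_cost g k \<omega> = base \<omega> + (v1 \<omega> + (v2 \<omega> + v3 \<omega>))" by auto
  qed
  have [measurable]: "?E1 \<in> sets Q" "?E2 \<in> sets Q"
    using sets_of_id[OF info_events _ stopped_at_info] sets_of_id[OF info_events _ continued_at_info] by auto
  have [measurable]: "wait_time k \<in> borel_measurable Q" "gap k \<in> borel_measurable Q"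
    using info_measurable_Q wait_time_info gap_info by blast+
  have [measurable]: "base \<in> borel_measurable Q" unfolding base_def[abs_def] by measurable
  have [measurable]: "u1 \<in> borel_measurable Q" unfolding u1_def[abs_def] indicator_def greaterThan_iff by measurable
  have [measurable]: "v1 \<in> borel_measurable Q" unfolding v1_def[abs_def] stop_cost_def delay_cost_def by measurable
  have [measurable]: "u3 \<in> borel_measurable Q" unfolding u3_def[abs_def] by measurable
  have [measurable]: "v3 \<in> borel_measurable Q" unfolding v3_def[abs_def] delay_cost_def by measurable
  have [measurable]: "(\<lambda>\<omega>. g (belief (Suc k) \<omega>)) \<in> borel_measurable Q"
    using belief_bounds belief_Q[of "Suc k"] by (intro FF_compose_measurable[OF g]) (auto simp del: belief.simps)
  have [measurable]: "u2 \<in> borel_measurable Q" unfolding u2_def[abs_def] by measurable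
  have [measurable]: "v2 \<in> borel_measurable Q"
  proof -
    have "(\<lambda>x. g (posterior lam \<alpha> (gap k (fst x)) (belief k (fst x)) (snd x))) \<in> borel_measurable (Q \<Otimes>\<^sub>M lborel)"
      by (rule FF_compose_measurable[OF g]) (measurable, simp add: posterior_bounds[OF lam belief_bounds])
    then have [measurable]: "(\<lambda>(\<omega>, y). g (posterior lam \<alpha> (gap k \<omega>) (belief k \<omega>) y)) \<in> borel_measurable (Q \<Otimes>\<^sub>M lborel)"
      by (simp add: case_prod_beta')
    show ?thesis unfolding v2_def[abs_def] next_value_def by measurable
  qed
  have 1: "(\<integral>\<^sup>+\<omega>. u1 \<omega> \<partial>Q) = (\<integral>\<^sup>+\<omega>. v1 \<omega> \<partial>Q)" unfolding u1_def v1_def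
    by (rule stop_identity[OF stopped_at_info stopped_at_reached wait_time_info wait_time_nonneg])
  have 2: "(\<integral>\<^sup>+\<omega>. u2 \<omega> \<partial>Q) = (\<integral>\<^sup>+\<omega>. v2 \<omega> \<partial>Q)" unfolding u2_def v2_def
    by (rule belief_identity[OF continued_at_info continued_at_reached g])
  have 3: "(\<integral>\<^sup>+\<omega>. u3 \<omega> \<partial>Q) = (\<integral>\<^sup>+\<omega>. v3 \<omega> \<partial>Q)" unfolding u3_def v3_def
    using continued_at_reached[of k] reached_Suc[of k] gap_pos[of _ k]
    by (intro delay_identity[OF continued_at_info _ gap_info]) (auto intro: less_imp_le)
  have "(\<integral>\<^sup>+\<omega>. stage_cost g (Suc k) \<omega> \<partial>Q) = (\<integral>\<^sup>+\<omega>. base \<omega> + (u1 \<omega> + (u2 \<omega> + u3 \<omega>)) \<partial>Q)"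
    using eqs(1) by (rule nn_integral_cong)
  also have "\<dots> = (\<integral>\<^sup>+\<omega>. base \<omega> + (v1 \<omega> + (v2 \<omega> + v3 \<omega>)) \<partial>Q)"
    by (simp add: nn_integral_add 1 2 3)
  also have "\<dots> = (\<integral>\<^sup>+\<omega>. expected_stage_cost g k \<omega> \<partial>Q)"
    using eqs(2) by (intro nn_integral_cong) simp
  finally show ?thesis .
qed

definition total_cost :: "'a \<Rightarrow> ennreal" where
  "total_cost \<omega> = stop_loss \<omega> + ennreal d * (\<Sum>k. if \<tau> k \<omega> \<le> T \<omega> then 1 else 0)"

lemma cost_eq: "cost c d Q \<Theta> \<tau> T = (\<integral>\<^sup>+\<omega>. total_cost \<omega> \<partial>Q)"
proof -
  have "emeasure Q {\<omega>\<in>space Q. T \<omega> < ennreal (\<Theta> \<omega>)} = (\<integral>\<^sup>+\<omega>. indicator {\<omega>\<in>space Q. T \<omega> < ennreal (\<Theta> \<omega>)} \<omega> \<partial>Q)"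
    by simp
  also have "\<dots> = (\<integral>\<^sup>+\<omega>. (if T \<omega> < ennreal (\<Theta> \<omega>) then 1 else 0) \<partial>Q)"
    by (intro nn_integral_cong) auto
  finally show ?thesis unfolding cost_def total_cost_def stop_loss_def
    by (simp add: nn_integral_add add.assoc)
qed

lemma stage_cost_0: "(\<integral>\<^sup>+\<omega>. stage_cost g 0 \<omega> \<partial>Q) = ennreal (g p0)"
  by (simp add: stage_cost_def made_def obs_time_def emeasure_space_1)

text \<open>The expected stage cost increases with the stage when \<open>g \<le> J g\<close>. It exceeds the true cost \<open>C\<close> by at most the probability that the
  \<open>k\<close>-th observation is made, as \<open>g \<le> 1\<close>, and this probability is at most \<open>C / (d k)\<close>, because
  \<open>k\<close> observations cost \<open>d k\<close>.\<close>

lemma cost_lower_bound: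
  assumes g: "g \<in> FF" and gF: "\<And>p. 0 \<le> p \<Longrightarrow> p \<le> 1 \<Longrightarrow> g p \<le> F_fun lam c p"
    and gJ: "\<And>p t. 0 \<le> p \<Longrightarrow> p \<le> 1 \<Longrightarrow> 0 < t \<Longrightarrow> g p \<le> J0 g p t"
  shows "ennreal (g p0) \<le> cost c d Q \<Theta> \<tau> T"
proof (cases "cost c d Q \<Theta> \<tau> T")
  case (real C)
  have step: "(\<integral>\<^sup>+\<omega>. stage_cost g k \<omega> \<partial>Q) \<le> (\<integral>\<^sup>+\<omega>. stage_cost g (Suc k) \<omega> \<partial>Q)" for k
    unfolding stage_cost_step[OF g]
  proof (rule nn_integral_mono)
    fix \<omega> assume w: "\<omega> \<in> space Q"
    have "g (belief k \<omega>) \<le> stop_cost (belief k \<omega>) (wait_time k \<omega>)"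
      using gF[OF belief_bounds] F_bounds(3)[OF belief_bounds wait_time_nonneg] by (rule order_trans)
    moreover have "g (belief k \<omega>) \<le> J0 g (belief k \<omega>) (gap k \<omega>)" if "obs_time (Suc k) \<omega> < \<top>"
      using gJ[OF belief_bounds] gap_pos[of \<omega> k] that w by (simp add: reached_def)
    ultimately show "stage_cost g k \<omega> \<le> expected_stage_cost g k \<omega>"
      unfolding stage_cost_def expected_stage_cost_def by (auto intro!: add_mono ennreal_leI)
  qed
  have le: "ennreal (g p0) \<le> (\<integral>\<^sup>+\<omega>. stage_cost g k \<omega> \<partial>Q)" for k
  proof (induction k)
    case 0 then show ?case by (simp add: stage_cost_0)
  next
    case (Suc k) then show ?case using step by (rule order_trans)
  qed
  define A where "A k = {\<omega>\<in>space Q. obs_time k \<omega> \<le> T \<omega>}" for k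
  have [measurable]: "A k \<in> sets Q" for k unfolding A_def by measurable
  have [measurable]: "total_cost \<in> borel_measurable Q" unfolding total_cost_def[abs_def] by measurable
  have made_le: "made k \<omega> \<le> (\<Sum>i. if \<tau> i \<omega> \<le> T \<omega> then 1 else 0)" for k \<omega>
    unfolding made_def by (rule sum_le_suminf) auto
  have up: "ennreal (g p0) \<le> ennreal C + ennreal (prob (A k))" for k
  proof -
    have "(\<integral>\<^sup>+\<omega>. stage_cost g k \<omega> \<partial>Q) \<le> (\<integral>\<^sup>+\<omega>. total_cost \<omega> + indicator (A k) \<omega> \<partial>Q)"
    proof (rule nn_integral_mono)
      fix \<omega> assume w: "\<omega> \<in> space Q"
      show "stage_cost g k \<omega> \<le> total_cost \<omega> + indicator (A k) \<omega>"
      proof (cases "T \<omega> < obs_time k \<omega>")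
        case True
        then have "stage_cost g k \<omega> \<le> total_cost \<omega>" unfolding stage_cost_def total_cost_def
          by (simp add: add.commute add_left_mono mult_left_mono made_le)
        then show ?thesis by (rule add_increasing2[OF zero_le])
      next
        case False
        then have i: "indicator (A k) \<omega> = (1 :: ennreal)" using w unfolding A_def by auto
        have "ennreal c * (obs_time k \<omega> - ennreal (\<Theta> \<omega>)) \<le> ennreal c * (T \<omega> - ennreal (\<Theta> \<omega>))"
          using False by (intro mult_left_mono ennreal_minus_mono) auto
        then have "ennreal c * (obs_time k \<omega> - ennreal (\<Theta> \<omega>)) \<le> stop_loss \<omega>"
          unfolding stop_loss_def by (intro add_increasing) auto
        moreover have "ennreal (g (belief k \<omega>)) \<le> 1" using FF_bounds[OF g belief_bounds] by (simp add: ennreal_le_1)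
        moreover have "ennreal d * made k \<omega> \<le> ennreal d * (\<Sum>i. if \<tau> i \<omega> \<le> T \<omega> then 1 else 0)"
          by (intro mult_left_mono made_le) auto
        ultimately have "ennreal d * made k \<omega> + (ennreal (g (belief k \<omega>)) + ennreal c * (obs_time k \<omega> - ennreal (\<Theta> \<omega>)))
           \<le> ennreal d * (\<Sum>i. if \<tau> i \<omega> \<le> T \<omega> then 1 else 0) + (1 + stop_loss \<omega>)"
          by (intro add_mono)
        then show ?thesis using False i unfolding stage_cost_def total_cost_def by (simp add: add_ac)
      qed
    qed
    also have "\<dots> = ennreal C + ennreal (prob (A k))"
      by (subst nn_integral_add) (auto simp: cost_eq[symmetric] real emeasure_eq_measure)
    finally show ?thesis using le[of k] by (rule order_trans[rotated])
  qed
  have Ak: "d * real k * prob (A k) \<le> C" for k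
  proof -
    have "ennreal (d * real k) * indicator (A k) \<omega> \<le> total_cost \<omega>" if w: "\<omega> \<in> space Q" for \<omega>
    proof (cases "\<omega> \<in> A k")
      case True
      have "\<tau> i \<omega> \<le> T \<omega>" if "i < k" for i
      proof -
        have "\<tau> i \<omega> \<le> obs_time k \<omega>" using obs_time_mono[OF w, of "Suc i" k] that by (simp add: obs_time_def)
        then show ?thesis using True unfolding A_def by auto
      qed
      then have "made k \<omega> = of_nat k" unfolding made_def by simp
      then have "ennreal (d * real k) = ennreal d * made k \<omega>" using d by (simp add: ennreal_mult ennreal_of_nat_eq_real_of_nat)
      also have "\<dots> \<le> total_cost \<omega>" unfolding total_cost_def by (intro add_increasing mult_left_mono made_le) auto
      finally show ?thesis using True by simp
    qed simp
    then have "(\<integral>\<^sup>+\<omega>. ennreal (d * real k) * indicator (A k) \<omega> \<partial>Q) \<le> ennreal C"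
      using nn_integral_mono[of Q "\<lambda>\<omega>. ennreal (d * real k) * indicator (A k) \<omega>" total_cost]
      by (simp add: cost_eq[symmetric] real)
    then have "ennreal (d * real k * prob (A k)) \<le> ennreal C"
      using d by (simp add: nn_integral_cmult_indicator emeasure_eq_measure ennreal_mult)
    then show ?thesis using real by (simp add: ennreal_le_iff)
  qed
  have "g p0 \<le> C + C / d * inverse (real (Suc k))" for k
  proof -
    have "prob (A (Suc k)) \<le> C / (d * real (Suc k))"
      using Ak[of "Suc k"] d by (subst pos_le_divide_eq) (auto simp: mult.commute)
    moreover have "g p0 \<le> C + prob (A (Suc k))" using up[of "Suc k"] real by (simp add: ennreal_plus[symmetric] ennreal_le_iff del: ennreal_plus)
    ultimately show ?thesis by (simp add: divide_inverse mult.assoc)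
  qed
  moreover have "(\<lambda>k. C + C / d * inverse (real (Suc k))) \<longlonglongrightarrow> C + C / d * 0"
    by (intro tendsto_intros LIMSEQ_inverse_real_of_nat)
  ultimately have "g p0 \<le> C" by (intro LIMSEQ_le_const[of _ C "g p0"]) auto
  then show ?thesis unfolding real by (rule ennreal_leI)
qed simp

text \<open>The function charged for the future may depend on the stage, because a strategy with at most \<open>n\<close>
  observations has fewer of them left at later stages.\<close>

lemma cost_upper_bound:
  assumes g: "\<And>k. g k \<in> FF" and e: "0 \<le> e"
    and stop: "\<And>k \<omega>. k < K \<Longrightarrow> \<omega> \<in> stopped_at k \<Longrightarrow> stop_cost (belief k \<omega>) (wait_time k \<omega>) \<le> g k (belief k \<omega>) + e"
    and cont: "\<And>k \<omega>. k < K \<Longrightarrow> \<omega> \<in> continued_at k \<Longrightarrow> J0 (g (Suc k)) (belief k \<omega>) (gap k \<omega>) \<le> g k (belief k \<omega>) + e"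
    and fin: "\<And>\<omega>. \<omega> \<in> space Q \<Longrightarrow> T \<omega> < obs_time K \<omega>" "\<And>\<omega>. \<omega> \<in> space Q \<Longrightarrow> T \<omega> < \<top>"
  shows "cost c d Q \<Theta> \<tau> T \<le> ennreal (g 0 p0 + real K * e)"
proof -
  have step: "(\<integral>\<^sup>+\<omega>. stage_cost (g (Suc k)) (Suc k) \<omega> \<partial>Q) \<le> (\<integral>\<^sup>+\<omega>. stage_cost (g k) k \<omega> \<partial>Q) + ennreal e" if k: "k < K" for k
  proof -
    have "(\<integral>\<^sup>+\<omega>. expected_stage_cost (g (Suc k)) k \<omega> \<partial>Q) \<le> (\<integral>\<^sup>+\<omega>. stage_cost (g k) k \<omega> + ennreal e \<partial>Q)"
    proof (rule nn_integral_mono)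
      fix \<omega> assume w: "\<omega> \<in> space Q"
      have g0: "0 \<le> g k (belief k \<omega>)" using FF_bounds[OF g belief_bounds] by auto
      consider "T \<omega> < obs_time k \<omega>" | "\<not> T \<omega> < obs_time k \<omega>" "\<omega> \<in> stopped_at k" | "\<not> T \<omega> < obs_time k \<omega>" "\<not> T \<omega> < obs_time (Suc k) \<omega>" "\<omega> \<in> continued_at k"
        using w fin(2)[OF w] obs_time_Suc_le[OF w, of k] unfolding stopped_at_def continued_at_def
        by (force simp: not_less intro: le_less_trans)
      then show "expected_stage_cost (g (Suc k)) k \<omega> \<le> stage_cost (g k) k \<omega> + ennreal e"
      proof cases
        case 1 then show ?thesis unfolding stage_cost_def expected_stage_cost_def by simp
      next
        case 2
        have "ennreal (stop_cost (belief k \<omega>) (wait_time k \<omega>)) \<le> ennreal (g k (belief k \<omega>)) + ennreal e"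
          using ennreal_leI[OF stop[OF k 2(2)]] g0 e by simp
        from add_left_mono[OF add_right_mono[OF this, of "ennreal c * (obs_time k \<omega> - ennreal (\<Theta> \<omega>))"], of "ennreal d * made k \<omega>"]
        show ?thesis using 2 unfolding stage_cost_def expected_stage_cost_def
          by (simp add: stopped_at_def add_ac)
      next
        case 3
        have "ennreal (J0 (g (Suc k)) (belief k \<omega>) (gap k \<omega>)) \<le> ennreal (g k (belief k \<omega>)) + ennreal e"
          using ennreal_leI[OF cont[OF k 3(3)]] g0 e by simp
        from add_left_mono[OF add_right_mono[OF this, of "ennreal c * (obs_time k \<omega> - ennreal (\<Theta> \<omega>))"], of "ennreal d * made k \<omega>"]
        show ?thesis using 3 unfolding stage_cost_def expected_stage_cost_def
          by (simp add: continued_at_def add_ac)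
      qed
    qed
    also have "\<dots> = (\<integral>\<^sup>+\<omega>. stage_cost (g k) k \<omega> \<partial>Q) + ennreal e"
    proof -
      have [measurable]: "(\<lambda>\<omega>. g k (belief k \<omega>)) \<in> borel_measurable Q"
        using belief_bounds by (intro FF_compose_measurable[OF g]) auto
      have "stage_cost (g k) k \<in> borel_measurable Q" unfolding stage_cost_def[abs_def] by measurable
      then show ?thesis by (simp add: nn_integral_add emeasure_space_1)
    qed
    finally show ?thesis unfolding stage_cost_step[OF g] .
  qed
  have "(\<integral>\<^sup>+\<omega>. stage_cost (g k) k \<omega> \<partial>Q) \<le> ennreal (g 0 p0 + real k * e)" if "k \<le> K" for k
    using that
  proof (induction k)
    case 0 then show ?case by (simp add: stage_cost_0)
  next
    case (Suc k)
    have "(\<integral>\<^sup>+\<omega>. stage_cost (g (Suc k)) (Suc k) \<omega> \<partial>Q) \<le> ennreal (g 0 p0 + real k * e) + ennreal e"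
      using step[of k] Suc by (auto intro: order_trans add_right_mono)
    also have "\<dots> = ennreal (g 0 p0 + real (Suc k) * e)"
      using e FF_bounds[OF g p0, of 0] by (subst ennreal_plus[symmetric]) (auto simp: algebra_simps)
    finally show ?case .
  qed
  moreover have "total_cost \<omega> = stage_cost (g K) K \<omega>" if w: "\<omega> \<in> space Q" for \<omega>
  proof -
    have "(\<Sum>i. if \<tau> i \<omega> \<le> T \<omega> then 1 else 0 :: ennreal) = (\<Sum>i<K. if \<tau> i \<omega> \<le> T \<omega> then 1 else 0)"
    proof (rule suminf_finite)
      fix i assume "i \<notin> {..<K}"
      then have "obs_time K \<omega> \<le> \<tau> i \<omega>" using obs_time_mono[OF w, of K "Suc i"] by (simp add: obs_time_def)
      then show "(if \<tau> i \<omega> \<le> T \<omega> then 1 else 0 :: ennreal) = 0" using fin(1)[OF w] by auto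
    qed simp
    then show ?thesis using fin(1)[OF w] unfolding total_cost_def stage_cost_def made_def by (simp add: add.commute)
  qed
  ultimately show ?thesis unfolding cost_eq by (simp cong: nn_integral_cong)
qed

end


section \<open>Almost optimal strategies and the value function\<close>

context detection_params
begin

definition near_stop :: "real \<Rightarrow> (real \<Rightarrow> real) \<Rightarrow> bool" where
  "near_stop e s \<longleftrightarrow> s \<in> borel_measurable borel \<and> (\<forall>p. 0 \<le> s p) \<and>
     (\<forall>p\<in>{0..1}. stop_cost p (s p) \<le> F_fun lam c p + e)"

definition near_wait :: "real \<Rightarrow> nat \<Rightarrow> (real \<Rightarrow> real) \<Rightarrow> bool" where
  "near_wait e j t \<longleftrightarrow> t \<in> borel_measurable borel \<and> (\<forall>p. 0 < t p) \<and>
     (\<forall>p\<in>{0..1}. J0 (iter j) p (t p) \<le> (INF t\<in>{0<..}. J0 (iter j) p t) + e)"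

lemma near_stop_exists: "0 < e \<Longrightarrow> \<exists>s. near_stop e s"
  using concave_selection[of "{0..}" "\<lambda>t p. stop_cost p t" e] stop_cost_concave stop_cost_nonneg
  unfolding near_stop_def F_fun_eq by fastforce

lemma near_wait_exists:
  assumes "0 < e" shows "\<exists>t. near_wait e j t"
proof -
  have "\<exists>s \<in> borel_measurable borel. (\<forall>p. s p \<in> {0<..}) \<and>
    (\<forall>p\<in>{0..1}. J0 (iter j) p (s p) \<le> (INF t\<in>{0<..}. J0 (iter j) p t) + e)"
  proof (rule concave_selection)
    show "concave_on {0..1} (\<lambda>p. J0 (iter j) p t)" if "t \<in> {0<..}" for t
      using that by (intro J0_concave iter_in_FF iter_concave) auto
    show "0 \<le> J0 (iter j) p t" if "t \<in> {0<..}" "p \<in> {0..1}" for t p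
      using that J0_ge_d[OF iter_in_FF, of p t j] d by auto
  qed (use assms in auto)
  then show ?thesis unfolding near_wait_def by auto
qed

lemma J_cong:
  assumes "f \<in> FF" "g \<in> FF" "0 \<le> p" "p \<le> 1" "\<And>p. 0 \<le> p \<Longrightarrow> p \<le> 1 \<Longrightarrow> f p = g p"
  shows "J f p = J g p"
  using J_mono[of f g p] J_mono[of g f p] assms by (intro antisym) auto

end

context detection_model
begin

text \<open>With \<open>m\<close> observations left, no further observation is made when stopping is at least as good.\<close>

definition next_wait :: "(nat \<Rightarrow> real \<Rightarrow> real) \<Rightarrow> nat \<Rightarrow> real \<Rightarrow> ennreal" where
  "next_wait t m p = (case m of 0 \<Rightarrow> \<top> | Suc j \<Rightarrow> if F_fun lam c p \<le> iter m p then \<top> else ennreal (t j p))"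

text \<open>The observation time, the belief and the observed value after \<open>k\<close> observations. They are defined together, because the
  sequence of observation times is not available while it is being defined; the proof below identifies the three
  components with \<open>obs_time\<close>, \<open>belief\<close> and \<open>obs_val\<close> of the resulting sequence.\<close>

primrec strategy_state :: "(nat \<Rightarrow> real \<Rightarrow> real) \<Rightarrow> nat \<Rightarrow> nat \<Rightarrow> 'a \<Rightarrow> ennreal \<times> real \<times> real" where
  "strategy_state t n 0 \<omega> = (0, p0, 0)"
| "strategy_state t n (Suc k) \<omega> =
     (let S = fst (strategy_state t n k \<omega>); p = fst (snd (strategy_state t n k \<omega>)); x = snd (snd (strategy_state t n k \<omega>));
          S' = S + next_wait t (n - k) p;
          x' = (if S' = \<top> then 0 else X (enn2real S') \<omega>)
      in (S', posterior lam \<alpha> (enn2real S' - enn2real S) p (x' - x), x'))"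

definition strategy :: "(nat \<Rightarrow> real \<Rightarrow> real) \<Rightarrow> nat \<Rightarrow> nat \<Rightarrow> 'a \<Rightarrow> ennreal" where
  "strategy t n k \<omega> = fst (strategy_state t n (Suc k) \<omega>)"

text \<open>The strategy observes after almost optimal waiting times as long as this is better than stopping and one of the
  \<open>n\<close> observations is left, and then stops after an almost optimal further time. Each of the at most \<open>n\<close>
  observations and the final stop loses at most \<open>e\<close>.\<close>

lemma strategy_value:
  assumes e: "0 < e"
  shows "\<exists>\<tau>\<in>observation_sequences (space Q) X.
    \<exists>T. stopping_time (obs_filtration (space Q) X \<tau>) T \<and>
      cost c d Q \<Theta> \<tau> T \<le> ennreal (iter n p0 + real (Suc n) * e)"
proof -
  obtain s where s: "near_stop e s" using near_stop_exists[OF e] by auto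
  have "\<forall>j. \<exists>t. near_wait e j t" using near_wait_exists[OF e] by auto
  then obtain t where t: "\<And>j. near_wait e j (t j)" by metis
  have s_meas [measurable]: "s \<in> borel_measurable borel" and s0: "0 \<le> s p"
    and s_opt: "0 \<le> p \<Longrightarrow> p \<le> 1 \<Longrightarrow> stop_cost p (s p) \<le> F_fun lam c p + e" for p
    using s unfolding near_stop_def by auto
  have t_meas [measurable]: "t j \<in> borel_measurable borel" and t0: "0 < t j p"
    and t_opt: "0 \<le> p \<Longrightarrow> p \<le> 1 \<Longrightarrow> J0 (iter j) p (t j p) \<le> (INF t\<in>{0<..}. J0 (iter j) p t) + e" for j p
    using t[of j] unfolding near_wait_def by auto
  let ?\<tau> = "strategy t n"
  interpret O: observed_model lam c d \<alpha> Q W \<Theta> p0 ?\<tau> by unfold_locales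
  have st: "strategy_state t n k \<omega> = (O.obs_time k \<omega>, O.belief k \<omega>, O.obs_val k \<omega>)" for k \<omega>
  proof (induction k)
    case 0 show ?case by (simp add: O.obs_time_def O.obs_val_def)
  next
    case (Suc k)
    have tm: "O.obs_time (Suc k) \<omega> = O.obs_time k \<omega> + next_wait t (n - k) (O.belief k \<omega>)"
    proof -
      have "O.obs_time (Suc k) \<omega> = strategy t n k \<omega>" by (simp add: O.obs_time_def)
      also have "\<dots> = fst (strategy_state t n (Suc k) \<omega>)" by (rule strategy_def)
      also have "\<dots> = O.obs_time k \<omega> + next_wait t (n - k) (O.belief k \<omega>)"
        by (simp only: strategy_state.simps Let_def Suc fst_conv snd_conv)
      finally show ?thesis .
    qed
    have vl: "O.obs_val (Suc k) \<omega> = (if O.obs_time (Suc k) \<omega> = \<top> then 0 else X (enn2real (O.obs_time (Suc k) \<omega>)) \<omega>)"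
      by (simp add: O.obs_val_def O.obs_time_def observation_def)
    show ?case
      by (simp only: strategy_state.simps Let_def Suc fst_conv snd_conv tm[symmetric] vl[symmetric]
          O.belief.simps O.clock_def)
  qed
  have tm: "O.obs_time (Suc k) \<omega> = O.obs_time k \<omega> + next_wait t (n - k) (O.belief k \<omega>)" for k \<omega>
  proof -
    have "O.obs_time (Suc k) \<omega> = fst (strategy_state t n (Suc k) \<omega>)" unfolding st by simp
    also have "\<dots> = O.obs_time k \<omega> + next_wait t (n - k) (O.belief k \<omega>)"
      by (simp only: strategy_state.simps Let_def st[of k \<omega>] fst_conv snd_conv)
    finally show ?thesis .
  qed
  have wm: "(\<lambda>\<omega>. next_wait t (n - k) (O.belief k \<omega>)) \<in> borel_measurable (O.info k)" for k
  proof (cases "n - k")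
    case 0 then show ?thesis by (simp add: next_wait_def)
  next
    case (Suc j)
    note [measurable] = O.belief_info[of k k, simplified]
    have [measurable]: "(\<lambda>\<omega>. F_fun lam c (O.belief k \<omega>)) \<in> borel_measurable (O.info k)"
      "(\<lambda>\<omega>. iter (Suc j) (O.belief k \<omega>)) \<in> borel_measurable (O.info k)"
      using O.belief_bounds by (auto intro!: FF_compose_measurable[OF F_in_FF] FF_compose_measurable[OF iter_in_FF] simp del: iter.simps)
    show ?thesis unfolding Suc next_wait_def nat.case by measurable
  qed
  have wpos: "0 < next_wait t m p" for m p
    unfolding next_wait_def using t0 by (auto split: nat.split)
  have tm_meas: "O.obs_time (Suc k) \<in> borel_measurable (O.info k)" for k
  proof -
    note [measurable] = O.obs_time_info[of k k, simplified] wm[of k]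
    have "(\<lambda>\<omega>. O.obs_time k \<omega> + next_wait t (n - k) (O.belief k \<omega>)) \<in> borel_measurable (O.info k)" by measurable
    then show ?thesis by (simp add: tm[symmetric])
  qed
  have adm: "?\<tau> \<in> observation_sequences (space Q) X"
    unfolding observation_sequences_def
  proof (intro CollectI conjI)
    show "\<exists>t'>0. \<forall>\<omega>\<in>space Q. ?\<tau> 0 \<omega> = t'"
      using wpos[of n p0] by (intro exI[of _ "next_wait t n p0"]) (auto simp: strategy_def Let_def)
    show "\<forall>k\<ge>1. ?\<tau> k \<in> borel_measurable (vimage_algebra (space Q) (\<lambda>\<omega>. \<lambda>i\<in>{..<k}. observation X ?\<tau> i \<omega>)
           (\<Pi>\<^sub>M i\<in>{..<k}. borel \<Otimes>\<^sub>M borel))"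
      using tm_meas unfolding O.info_def O.history_def[abs_def] by (auto simp: O.obs_time_def[abs_def])
    show "\<forall>k. \<forall>\<omega>\<in>space Q. if ?\<tau> k \<omega> = \<top> then ?\<tau> (Suc k) \<omega> = \<top> else ?\<tau> k \<omega> < ?\<tau> (Suc k) \<omega>"
    proof (intro allI ballI)
      fix k \<omega>
      have "?\<tau> (Suc k) \<omega> = ?\<tau> k \<omega> + next_wait t (n - Suc k) (O.belief (Suc k) \<omega>)"
        using tm[of "Suc k" \<omega>] by (simp add: O.obs_time_def)
      moreover have "?\<tau> k \<omega> < ?\<tau> k \<omega> + next_wait t (n - Suc k) (O.belief (Suc k) \<omega>)" if "?\<tau> k \<omega> \<noteq> \<top>"
        using wpos that by (simp add: less_top)
      ultimately show "if ?\<tau> k \<omega> = \<top> then ?\<tau> (Suc k) \<omega> = \<top> else ?\<tau> k \<omega> < ?\<tau> (Suc k) \<omega>" by simp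
    qed
  qed
  interpret O: admissible_model lam c d \<alpha> Q W \<Theta> p0 ?\<tau> by unfold_locales (rule adm)
  \<comment> \<open>The last finite observation is the one with number \<open>K \<omega>\<close>; it is recognised at that observation.\<close>
  define last where "last k = {\<omega>\<in>space Q. O.obs_time k \<omega> < \<top> \<and> O.obs_time (Suc k) \<omega> = \<top>}" for k
  have end_n: "O.obs_time (Suc n) \<omega> = \<top>" for \<omega> by (simp add: tm next_wait_def)
  have last_unique: "j = k" if "\<omega> \<in> last j" "\<omega> \<in> last k" for j k \<omega>
  proof (rule ccontr)
    have aux: False if "\<omega> \<in> last j" "\<omega> \<in> last k" "j < k" for j k
    proof -
      have "O.obs_time (Suc j) \<omega> \<le> O.obs_time k \<omega>" using that by (intro O.obs_time_mono) (auto simp: last_def)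
      then show False using that unfolding last_def by (auto simp: top_unique)
    qed
    assume "j \<noteq> k"
    then show False using aux that by (meson nat_neq_iff)
  qed
  define K where "K \<omega> = (LEAST k. O.obs_time (Suc k) \<omega> = \<top>)" for \<omega>
  have K_last: "\<omega> \<in> last (K \<omega>)" and K_le: "K \<omega> \<le> n" if w: "\<omega> \<in> space Q" for \<omega>
  proof -
    have "O.obs_time (Suc (K \<omega>)) \<omega> = \<top>" unfolding K_def by (rule LeastI[of _ n], rule end_n)
    moreover have "O.obs_time (K \<omega>) \<omega> < \<top>"
    proof (cases "K \<omega>")
      case 0 then show ?thesis by (simp add: O.obs_time_def)
    next
      case (Suc j)
      then have "\<not> O.obs_time (Suc j) \<omega> = \<top>" unfolding K_def by (intro not_less_Least) simp
      then show ?thesis using Suc by (simp add: less_top)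
    qed
    ultimately show "\<omega> \<in> last (K \<omega>)" using w unfolding last_def by simp
    show "K \<omega> \<le> n" unfolding K_def by (rule Least_le) (rule end_n)
  qed
  define T where "T \<omega> = O.obs_time (K \<omega>) \<omega> + ennreal (s (O.belief (K \<omega>) \<omega>))" for \<omega>
  have T_last: "T \<omega> = O.obs_time k \<omega> + ennreal (s (O.belief k \<omega>))" if "\<omega> \<in> last k" for k \<omega>
    using last_unique[OF that K_last, THEN sym] that unfolding T_def last_def by simp
  have T_fin: "T \<omega> < \<top>" if "\<omega> \<in> space Q" for \<omega>
    using K_last[OF that] unfolding T_def last_def by (simp add: less_top[symmetric])
  have stop: "stopping_time (obs_filtration (space Q) X ?\<tau>) T"
    unfolding stopping_time_def pred_def O.space_obs_filtration
  proof
    fix u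
    have "{\<omega>\<in>space Q. T \<omega> \<le> u} = (\<Union>k\<in>{..n}. {\<omega>\<in>last k. O.obs_time k \<omega> + ennreal (s (O.belief k \<omega>)) \<le> u})"
    proof (intro equalityI subsetI)
      fix \<omega> assume "\<omega> \<in> {\<omega>\<in>space Q. T \<omega> \<le> u}"
      then show "\<omega> \<in> (\<Union>k\<in>{..n}. {\<omega>\<in>last k. O.obs_time k \<omega> + ennreal (s (O.belief k \<omega>)) \<le> u})"
        using K_last[of \<omega>] K_le[of \<omega>] by (auto simp: T_def)
    next
      fix \<omega> assume "\<omega> \<in> (\<Union>k\<in>{..n}. {\<omega>\<in>last k. O.obs_time k \<omega> + ennreal (s (O.belief k \<omega>)) \<le> u})"
      then obtain k where "\<omega> \<in> last k" "O.obs_time k \<omega> + ennreal (s (O.belief k \<omega>)) \<le> u" by auto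
      then show "\<omega> \<in> {\<omega>\<in>space Q. T \<omega> \<le> u}" using T_last[of \<omega> k] by (simp add: last_def)
    qed
    also have "\<dots> \<in> sets (obs_filtration (space Q) X ?\<tau> u)"
    proof (intro sets.finite_UN)
      fix k assume "k \<in> {..n}"
      note [measurable] = O.obs_time_info[of k k, simplified] tm_meas[of k] O.belief_info[of k k, simplified]
      show "{\<omega>\<in>last k. O.obs_time k \<omega> + ennreal (s (O.belief k \<omega>)) \<le> u} \<in> sets (obs_filtration (space Q) X ?\<tau> u)"
      proof (rule O.info_visible)
        have "{\<omega>\<in>space (O.info k). O.obs_time k \<omega> < \<top> \<and> O.obs_time (Suc k) \<omega> = \<top> \<and> O.obs_time k \<omega> + ennreal (s (O.belief k \<omega>)) \<le> u} \<in> sets (O.info k)"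
          by measurable
        then show "{\<omega>\<in>last k. O.obs_time k \<omega> + ennreal (s (O.belief k \<omega>)) \<le> u} \<in> sets (O.info k)"
          by (simp add: last_def conj_assoc)
        fix \<omega> assume "\<omega> \<in> {\<omega>\<in>last k. O.obs_time k \<omega> + ennreal (s (O.belief k \<omega>)) \<le> u}"
        then have "O.obs_time k \<omega> + ennreal (s (O.belief k \<omega>)) \<le> u" by simp
        then show "O.obs_time k \<omega> \<le> u" by (rule order_trans[rotated]) simp
      qed
    qed simp
    finally show "{\<omega>\<in>space Q. T \<omega> \<le> u} \<in> sets (obs_filtration (space Q) X ?\<tau> u)" .
  qed
  interpret O: stopped_model lam c d \<alpha> Q W \<Theta> p0 ?\<tau> T by unfold_locales (rule stop)
  have "cost c d Q \<Theta> ?\<tau> T \<le> ennreal ((\<lambda>k. iter (n - k)) 0 p0 + real (Suc n) * e)"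
  proof (rule O.cost_upper_bound[where g="\<lambda>k. iter (n - k)"])
    show "T \<omega> < O.obs_time (Suc n) \<omega>" "T \<omega> < \<top>" if "\<omega> \<in> space Q" for \<omega>
      using T_fin[OF that] end_n by auto
    fix k \<omega> assume k: "k < Suc n"
    note b = O.belief_bounds[of k \<omega>]
    { assume w: "\<omega> \<in> O.stopped_at k"
      then have wQ: "\<omega> \<in> space Q" and le: "O.obs_time k \<omega> \<le> T \<omega>" "T \<omega> < O.obs_time (Suc k) \<omega>"
        unfolding O.stopped_at_def by auto
      have "\<not> K \<omega> < k"
      proof
        assume "K \<omega> < k"
        then have "O.obs_time (Suc (K \<omega>)) \<omega> \<le> O.obs_time k \<omega>" using wQ by (intro O.obs_time_mono) auto
        then have "T \<omega> = \<top>" using K_last[OF wQ] le(1) unfolding last_def by (auto simp: top_unique)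
        then show False using T_fin[OF wQ] by simp
      qed
      moreover have "\<not> k < K \<omega>"
      proof
        assume "k < K \<omega>"
        then have "O.obs_time (Suc k) \<omega> \<le> O.obs_time (K \<omega>) \<omega>" using wQ by (intro O.obs_time_mono) auto
        also have "\<dots> \<le> T \<omega>" unfolding T_def by simp
        finally show False using le(2) by simp
      qed
      ultimately have "K \<omega> = k" by simp
      then have lk: "\<omega> \<in> last k" using K_last[OF wQ] by simp
      have wt: "O.wait_time k \<omega> = s (O.belief k \<omega>)"
        using w lk T_last[OF lk] s0 unfolding O.wait_time_def O.clock_def last_def
        by (simp add: enn2real_plus)
      have "F_fun lam c (O.belief k \<omega>) \<le> iter (n - k) (O.belief k \<omega>)"
      proof (cases "n - k")
        case (Suc j)
        have "next_wait t (n - k) (O.belief k \<omega>) = \<top>"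
          using lk tm[of k \<omega>] unfolding last_def by auto
        then show ?thesis unfolding next_wait_def Suc by (auto split: if_splits)
      qed simp
      then show "stop_cost (O.belief k \<omega>) (O.wait_time k \<omega>) \<le> iter (n - k) (O.belief k \<omega>) + e"
        using s_opt[OF b] unfolding wt by simp
    }
    { assume w: "\<omega> \<in> O.continued_at k"
      then have fin: "O.obs_time (Suc k) \<omega> < \<top>" unfolding O.continued_at_def by auto
      then have nt: "next_wait t (n - k) (O.belief k \<omega>) \<noteq> \<top>" "O.obs_time k \<omega> < \<top>" unfolding tm by (auto simp: less_top)
      then obtain j where j: "n - k = Suc j" unfolding next_wait_def by (cases "n - k") auto
      have nF: "\<not> F_fun lam c (O.belief k \<omega>) \<le> iter (Suc j) (O.belief k \<omega>)"
        and wt: "next_wait t (n - k) (O.belief k \<omega>) = ennreal (t j (O.belief k \<omega>))"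
        using nt unfolding next_wait_def j by (auto split: if_splits)
      have gap: "O.gap k \<omega> = t j (O.belief k \<omega>)"
        unfolding O.gap_def O.clock_def tm wt using nt(2) t0[of j "O.belief k \<omega>"] by (simp add: enn2real_plus)
      have "iter (Suc j) (O.belief k \<omega>) = (INF t\<in>{0<..}. J0 (iter j) (O.belief k \<omega>) t)"
        using nF unfolding iter.simps(2) J_def by (auto simp: min_def)
      then have "J0 (iter j) (O.belief k \<omega>) (O.gap k \<omega>) \<le> iter (n - k) (O.belief k \<omega>) + e"
        using t_opt[OF b, of j] unfolding gap j by simp
      moreover have "n - Suc k = j" using j by simp
      ultimately show "J0 (iter (n - Suc k)) (O.belief k \<omega>) (O.gap k \<omega>) \<le> iter (n - k) (O.belief k \<omega>) + e" by simp
    }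
  qed (use e iter_in_FF in auto)
  then show ?thesis using adm stop by auto
qed

text \<open>The observation sequence with a single observation at time \<open>t\<close> has the posterior as its belief after that
  observation.\<close>

lemma expectation_posterior:
  assumes f: "f \<in> FF" and t: "0 < t"
  shows "(LINT \<omega>|Q. f (posterior lam \<alpha> t p0 (X t \<omega>))) = next_value f p0 t"
proof -
  define \<tau> :: "nat \<Rightarrow> 'a \<Rightarrow> ennreal" where "\<tau> k \<omega> = (if k = 0 then ennreal t else \<top>)" for k \<omega>
  have "\<tau> \<in> observation_sequences (space Q) X"
    unfolding observation_sequences_def \<tau>_def[abs_def] using t by (auto intro!: exI[of _ "ennreal t"])
  then interpret O: admissible_model lam c d \<alpha> Q W \<Theta> p0 \<tau> by unfold_locales
  have t1: "O.obs_time 0 \<omega> = 0" "O.obs_time (Suc 0) \<omega> = ennreal t" for \<omega> by (simp_all add: O.obs_time_def \<tau>_def)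
  have cl: "O.clock 0 \<omega> = 0" "O.clock (Suc 0) \<omega> = t" for \<omega> using t by (simp_all add: O.clock_def t1)
  have ov: "O.obs_val 0 \<omega> = 0" "O.obs_val (Suc 0) \<omega> = X t \<omega>" for \<omega>
    using t by (simp_all add: O.obs_val_def observation_def \<tau>_def)
  have b1: "O.belief (Suc 0) \<omega> = posterior lam \<alpha> t p0 (X t \<omega>)" for \<omega>
    by (simp add: cl ov)
  have "(\<integral>\<^sup>+\<omega>. indicator (space Q) \<omega> * ennreal (f (O.belief (Suc 0) \<omega>)) \<partial>Q)
    = (\<integral>\<^sup>+\<omega>. indicator (space Q) \<omega> * ennreal (next_value f (O.belief 0 \<omega>) (O.gap 0 \<omega>)) \<partial>Q)"
    using sets.top[of "O.info 0"] by (intro O.belief_identity[OF _ _ f]) (auto simp: O.reached_def t1)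
  then have "(\<integral>\<^sup>+\<omega>. ennreal (f (O.belief (Suc 0) \<omega>)) \<partial>Q) = (\<integral>\<^sup>+\<omega>. ennreal (next_value f p0 t) \<partial>Q)"
    by (simp add: O.gap_def cl cong: nn_integral_cong del: O.belief.simps(2))
  then have I: "(\<integral>\<^sup>+\<omega>. ennreal (f (O.belief (Suc 0) \<omega>)) \<partial>Q) = ennreal (next_value f p0 t)"
    by (simp add: emeasure_space_1)
  have "(\<lambda>\<omega>. f (O.belief (Suc 0) \<omega>)) \<in> borel_measurable Q"
    using O.belief_bounds O.belief_Q[of "Suc 0"] by (intro FF_compose_measurable[OF f]) (auto simp del: O.belief.simps)
  then have "(LINT \<omega>|Q. f (O.belief (Suc 0) \<omega>)) = enn2real (\<integral>\<^sup>+\<omega>. ennreal (f (O.belief (Suc 0) \<omega>)) \<partial>Q)"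
    using FF_bounds[OF f O.belief_bounds] by (intro integral_eq_nn_integral) (auto simp del: O.belief.simps)
  then show ?thesis unfolding I using next_value_integrable(2)[OF f p0 t] by (simp add: b1 del: O.belief.simps)
qed

lemma value_eq_iter_lim:
  shows "(INF \<tau>\<in>observation_sequences (space Q) X.
        INF T\<in>{T. stopping_time (obs_filtration (space Q) X \<tau>) T}. cost c d Q \<Theta> \<tau> T) = ennreal (iter_lim p0)"
    (is "?V = _")
proof (rule antisym)
  have up: "?V \<le> ennreal (iter n p0)" for n
  proof (rule ennreal_le_epsilon)
    fix e :: real assume e: "0 < e"
    obtain \<tau> T where \<tau>: "\<tau> \<in> observation_sequences (space Q) X"
      and T: "stopping_time (obs_filtration (space Q) X \<tau>) T"
      and le: "cost c d Q \<Theta> \<tau> T \<le> ennreal (iter n p0 + real (Suc n) * (e / real (Suc n)))"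
      using strategy_value[of "e / real (Suc n)" n] e by auto
    have "?V \<le> cost c d Q \<Theta> \<tau> T" using T by (intro INF_lower2[OF \<tau>] INF_lower) auto
    also have "\<dots> \<le> ennreal (iter n p0 + e)" using le by simp
    also have "\<dots> = ennreal (iter n p0) + ennreal e" using e FF_bounds[OF iter_in_FF p0, of n] by simp
    finally show "?V \<le> ennreal (iter n p0) + ennreal e" .
  qed
  have "(\<lambda>n. ennreal (iter n p0)) \<longlonglongrightarrow> ennreal (iter_lim p0)"
    by (intro tendsto_ennrealI iter_tendsto p0)
  then show "?V \<le> ennreal (iter_lim p0)" using up by (intro LIMSEQ_le_const) auto
  show "ennreal (iter_lim p0) \<le> ?V"
  proof (intro INF_greatest)
    fix \<tau> T assume \<tau>: "\<tau> \<in> observation_sequences (space Q) X"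
      and T: "T \<in> {T. stopping_time (obs_filtration (space Q) X \<tau>) T}"
    interpret O: stopped_model lam c d \<alpha> Q W \<Theta> p0 \<tau> T by unfold_locales (use \<tau> T in auto)
    show "ennreal (iter_lim p0) \<le> cost c d Q \<Theta> \<tau> T"
    proof (rule O.cost_lower_bound[OF iter_lim_in_FF])
      fix p :: real assume p: "0 \<le> p" "p \<le> 1"
      show "iter_lim p \<le> F_fun lam c p" using iter_lim_le[OF p, of 0] by simp
      show "iter_lim p \<le> J0 iter_lim p t" if "0 < t" for t
        using J_le(2)[OF iter_lim_in_FF p that] iter_lim_fixed[OF p] by simp
    qed
  qed
qed

end

lemma detection_setting_model:
  assumes "0 < lam" "0 < c" "0 < d" and S: "detection_setting lam M P W \<Theta>" and \<pi>: "\<pi> \<in> {0..1}"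
  shows "detection_model lam c d (P \<pi>) W \<Theta> \<pi>"
proof -
  have se: "sets (P \<pi>) = sets M" using S \<pi> unfolding detection_setting_def by blast
  then have sp: "space (P \<pi>) = space M" by (rule sets_eq_imp_space_eq)
  have bm: "standard_brownian_motion (P \<pi>) W" using S \<pi> unfolding detection_setting_def by blast
  then interpret prob_space "P \<pi>" unfolding standard_brownian_motion_def by blast
  show ?thesis
  proof
    show "0 < lam" "0 < c" "0 < d" by fact+
    show "\<Theta> \<in> borel_measurable (P \<pi>)" using S unfolding detection_setting_def by (simp add: measurable_cong_sets[OF se refl])
    show "0 \<le> \<Theta> \<omega>" if "\<omega> \<in> space (P \<pi>)" for \<omega> using S that unfolding detection_setting_def sp by auto
    show "0 \<le> \<pi>" "\<pi> \<le> 1" using \<pi> by auto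
    show "indep_vars (\<lambda>_. borel) (\<lambda>i \<omega>. W (r (Suc i)) \<omega> - W (r i) \<omega>) {..<n}"
      if "0 \<le> r 0" "\<And>i. i < n \<Longrightarrow> r i < r (Suc i)" for r and n :: nat
      using bm that unfolding standard_brownian_motion_def by blast
  qed (use bm S \<pi> in \<open>auto simp: standard_brownian_motion_def detection_setting_def sp\<close>)
qed

theorem proposition2p6:
  fixes lam c d \<alpha> :: real
    and M :: "'a measure" and P :: "real \<Rightarrow> 'a measure"
    and W X :: "real \<Rightarrow> 'a \<Rightarrow> real" and \<Theta> :: "'a \<Rightarrow> real"
    and f :: "nat \<Rightarrow> real \<Rightarrow> real" and f_lim :: "real \<Rightarrow> real" and V :: "real \<Rightarrow> ennreal"
  assumes "0 < lam" and "0 < c" and "0 < d"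
    and "detection_setting lam M P W \<Theta>"
  defines "X \<equiv> obs_process \<alpha> W \<Theta>"
    and "V \<equiv> value_function c d P X \<Theta>"
    and "f \<equiv> J_iter lam c d \<alpha> P X"
    and "f_lim \<equiv> (\<lambda>\<pi>. lim (\<lambda>n. f n \<pi>))"
  shows "(\<forall>n. f n \<in> FF) \<and>
    (\<forall>\<pi>\<in>{0..1}. decseq (\<lambda>n. f n \<pi>) \<and> (\<lambda>n. f n \<pi>) \<longlonglongrightarrow> f_lim \<pi>) \<and>
    (\<forall>\<pi>\<in>{0..1}. V \<pi> = ennreal (f_lim \<pi>)) \<and>
    is_unique_fixed_point_in_FF (J_op lam c d \<alpha> P X) (\<lambda>\<pi>. enn2real (V \<pi>))"
proof -
  interpret A: detection_params lam c d \<alpha> by unfold_locales fact+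
  have model: "detection_model lam c d (P \<pi>) W \<Theta> \<pi>" if "\<pi> \<in> {0..1}" for \<pi>
    using assms(1-4) that by (rule detection_setting_model)
  have J_op: "J_op lam c d \<alpha> P X g \<pi> = A.J g \<pi>" if g: "g \<in> FF" and \<pi>: "\<pi> \<in> {0..1}" for g \<pi>
  proof -
    interpret D: detection_model lam c d \<alpha> "P \<pi>" W \<Theta> \<pi> by (rule model[OF \<pi>])
    have "J0_op lam c d \<alpha> P X g \<pi> t = A.J0 g \<pi> t" if "0 < t" for t
      unfolding J0_op_def A.J0_def X_def D.expectation_posterior[OF g that] A.delay_cost_def by simp
    then show ?thesis unfolding J_op_def A.J_def by (auto intro!: arg_cong2[where f=min] INF_cong)
  qed
  have FF_cong: "g \<in> FF" if "h \<in> FF" "\<And>\<pi>. \<pi> \<in> {0..1} \<Longrightarrow> g \<pi> = h \<pi>" for g h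
  proof -
    have "g \<in> borel_measurable (restrict_space borel {0..1}) \<longleftrightarrow> h \<in> borel_measurable (restrict_space borel {0..1})"
      using that(2) by (intro measurable_cong) (auto simp: space_restrict_space)
    then show ?thesis using that unfolding FF_def by auto
  qed
  have f_eq: "\<forall>\<pi>\<in>{0..1}. f n \<pi> = A.iter n \<pi>" for n
  proof (induction n)
    case 0 show ?case by (simp add: f_def)
  next
    case (Suc n)
    have fn: "f n \<in> FF" using A.iter_in_FF Suc by (intro FF_cong[of "A.iter n" "f n"]) auto
    show ?case
    proof
      fix \<pi> :: real assume \<pi>: "\<pi> \<in> {0..1}"
      have "f (Suc n) \<pi> = J_op lam c d \<alpha> P X (f n) \<pi>" by (simp add: f_def)
      also have "\<dots> = A.J (f n) \<pi>" by (rule J_op[OF fn \<pi>])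
      also have "\<dots> = A.J (A.iter n) \<pi>" using \<pi> Suc by (intro A.J_cong fn A.iter_in_FF) auto
      finally show "f (Suc n) \<pi> = A.iter (Suc n) \<pi>" by simp
    qed
  qed
  have f_FF: "f n \<in> FF" for n using A.iter_in_FF f_eq by (intro FF_cong[of "A.iter n" "f n"]) auto
  have lim_eq: "f_lim \<pi> = A.iter_lim \<pi>" if "\<pi> \<in> {0..1}" for \<pi>
    unfolding f_lim_def A.iter_lim_def using f_eq that by simp
  have V_eq: "V \<pi> = ennreal (f_lim \<pi>)" if \<pi>: "\<pi> \<in> {0..1}" for \<pi>
  proof -
    interpret D: detection_model lam c d \<alpha> "P \<pi>" W \<Theta> \<pi> by (rule model[OF \<pi>])
    show ?thesis unfolding V_def value_function_def X_def D.value_eq_iter_lim lim_eq[OF \<pi>] ..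
  qed
  have V_lim: "enn2real (V \<pi>) = A.iter_lim \<pi>" if "\<pi> \<in> {0..1}" for \<pi>
    using V_eq[OF that] lim_eq[OF that] FF_bounds[OF A.iter_lim_in_FF, of \<pi>] that by simp
  have V_FF: "(\<lambda>\<pi>. enn2real (V \<pi>)) \<in> FF" using A.iter_lim_in_FF V_lim by (rule FF_cong)
  have "is_unique_fixed_point_in_FF (J_op lam c d \<alpha> P X) (\<lambda>\<pi>. enn2real (V \<pi>))"
    unfolding is_unique_fixed_point_in_FF_def
  proof (intro conjI ballI impI)
    show "(\<lambda>\<pi>. enn2real (V \<pi>)) \<in> FF" by (rule V_FF)
    fix \<pi> :: real assume \<pi>: "\<pi> \<in> {0..1}"
    have "A.J (\<lambda>\<pi>. enn2real (V \<pi>)) \<pi> = A.J A.iter_lim \<pi>"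
      using \<pi> V_lim by (intro A.J_cong V_FF A.iter_lim_in_FF) auto
    then show "J_op lam c d \<alpha> P X (\<lambda>\<pi>. enn2real (V \<pi>)) \<pi> = enn2real (V \<pi>)"
      using \<pi> A.iter_lim_fixed[of \<pi>] by (simp add: J_op[OF V_FF \<pi>] V_lim)
  next
    fix g and \<pi> :: real assume g: "g \<in> FF" "\<forall>\<pi>\<in>{0..1}. J_op lam c d \<alpha> P X g \<pi> = g \<pi>" and \<pi>: "\<pi> \<in> {0..1}"
    have "g \<pi> = A.iter_lim \<pi>" using g \<pi> J_op[OF g(1)] by (intro A.fixed_point_unique) auto
    then show "g \<pi> = enn2real (V \<pi>)" by (simp add: V_lim[OF \<pi>])
  qed
  moreover have "decseq (\<lambda>n. f n \<pi>) \<and> (\<lambda>n. f n \<pi>) \<longlonglongrightarrow> f_lim \<pi>" if "\<pi> \<in> {0..1}" for \<pi>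
    using A.iter_decseq[of \<pi>] A.iter_tendsto[of \<pi>] f_eq that by (simp add: lim_eq[OF that])
  ultimately show ?thesis using f_FF V_eq by blast
qed

end
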